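(* Let $\Gamma$ be a compact metric graph, $q\in L^\infty(\Gamma)$ real, and let $v_0\in\mathcal V$. Denote by $H$ the Schrödinger operator on $\Gamma$ with potential $q$ subject to arbitrary local self-adjoint vertex conditions at all $v\in\mathcal V\setminus\{v_0\}$ and a $\delta$ vertex condition with strength $\alpha_{v_0}\in\mathbb R$ at $v_0$. Denote by $\widetilde H$ the Schrödinger operator with the same potential and the same vertex conditions as $H$ at all vertices except $v_0$, and a $\delta'$ vertex condition with strength $\beta_{v_0}\in\mathbb R\setminus\{0\}$ at $v_0$. Assume that $$\frac{\deg(v_0)^2}{\beta_{v_0}}\le\alpha_{v_0}.$$ Then $\lambda_k(\widetilde H)\le\lambda_k(H)$ holds for all $k\in\mathbb N$.
   Context: A compact metric graph $\Gamma$ consists of a finite vertex set $\mathcal V$, a finite edge set $\mathcal E$ and a length function $L:\mathcal E\to(0,\infty)$; each edge $e$ is identified with $[0,L(e)]$ and its two ends are attached to vertices (loops and multiple edges allowed). $\deg(v)$ is the number of edge ends attached to $v$. $L^2(\Gamma)=\bigoplus_e L^2(0,L(e))$, $\widetilde H^k(\Gamma)=\bigoplus_e H^k(0,L(e))$. For a function $f$ on $\Gamma$ and a vertex $v$, $F(v)\in\mathbb C^{\deg(v)}$ is the vector of boundary values of $f$ at the edge ends attached to $v$, and $F'(v)$ the vector of derivatives at these ends, taken in the direction pointing out of $v$ into the edges. Local self-adjoint vertex conditions at $v$: given orthogonal projections $P_{v,D},P_{v,N},P_{v,R}$ in $\mathbb C^{\deg(v)}$ with mutually orthogonal ranges and sum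 $I$, and a self-adjoint invertible operator $\Lambda_v$ on $\operatorname{ran}P_{v,R}$, one requires $P_{v,D}F(v)=0$, $P_{v,N}F'(v)=0$, $P_{v,R}F'(v)=\Lambda_vP_{v,R}F(v)$. The Schrödinger operator $H$ with real potential $q=(q_e)_e\in L^\infty(\Gamma)$ and given such conditions at each vertex acts as $(Hf)_e=-f_e''+q_ef_e$ on all $f\in\widetilde H^2(\Gamma)$ satisfying the vertex conditions; it is self-adjoint in $L^2(\Gamma)$, bounded below with purely discrete spectrum, and $\lambda_1(H)\le\lambda_2(H)\le\dots$ are its eigenvalues counted with multiplicities. $\delta$ condition of strength $\alpha_v\in\mathbb R$ at $v$: $F(v)$ is a constant vector with common value $f(v)$, and $\sum_{j}F_j'(v)=\alpha_vf(v)$. $\delta'$ condition of strength $\beta_v\in\mathbb R\setminus\{0\}$ at $v$: $F'(v)$ is a constant vector with common value $f'(v)$, and $\sum_{j}F_j(v)=\beta_vf'(v)$. *)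

theory Defs
  imports "HOL-Analysis.Analysis" "HOL-Library.Function_Algebras"
begin

section \<open>Metric graphs\<close>

text \<open>
  The vertex and edge sets are finite types. Edge \<open>e\<close> is the interval \<open>[0, len G e]\<close>. Its two
  ends are \<open>(e, False)\<close>, at \<open>0\<close>, and \<open>(e, True)\<close>, at \<open>len G e\<close>; \<open>att G\<close> sends each end to the
  vertex it is attached to, so that loops, multiple edges, isolated vertices and disconnected
  graphs are all allowed.
\<close>

record ('v, 'e) metric_graph =
  len :: "'e \<Rightarrow> real"
  att :: "'e \<times> bool \<Rightarrow> 'v"

definition compact_metric_graph :: "('v::finite, 'e::finite) metric_graph \<Rightarrow> bool" where
  "compact_metric_graph G \<longleftrightarrow> (\<forall>e. 0 < len G e)"

definition ends_at :: "('v::finite, 'e::finite) metric_graph \<Rightarrow> 'v \<Rightarrow> ('e \<times> bool) set" where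
  "ends_at G v = {p. att G p = v}"

definition deg :: "('v::finite, 'e::finite) metric_graph \<Rightarrow> 'v \<Rightarrow> nat" where
  "deg G v = card (ends_at G v)"


section \<open>Functions on a metric graph\<close>

text \<open>
  A function on the graph is a family \<open>f :: 'e \<Rightarrow> real \<Rightarrow> complex\<close>, of which only the values
  \<open>f e x\<close> with \<open>0 \<le> x \<le> len G e\<close> matter.
\<close>

type_synonym 'e graph_fun = "'e \<Rightarrow> real \<Rightarrow> complex"

definition gscale :: "complex \<Rightarrow> 'e graph_fun \<Rightarrow> 'e graph_fun" where
  "gscale c f = (\<lambda>e x. c * f e x)"

global_interpretation graph_fun: vector_space "gscale :: complex \<Rightarrow> 'e graph_fun \<Rightarrow> 'e graph_fun"
  defines graph_dim = graph_fun.dim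
  by unfold_locales (auto simp: gscale_def fun_eq_iff algebra_simps)

definition L2_on :: "real set \<Rightarrow> (real \<Rightarrow> complex) \<Rightarrow> bool" where
  "L2_on S h \<longleftrightarrow> h \<in> borel_measurable (lebesgue_on S) \<and>
     integrable (lebesgue_on S) (\<lambda>x. (cmod (h x))\<^sup>2)"

text \<open>
  \<open>H2_derivs l f g h\<close>: on \<open>[0,l]\<close> the function \<open>f\<close> is the \<open>C\<^sup>1\<close> representative of an element of
  the Sobolev space \<open>H\<^sup>2(0,l)\<close>, with first derivative \<open>g\<close> (absolutely continuous) and second weak
  derivative \<open>h \<in> L\<^sup>2(0,l)\<close>.
\<close>

definition H2_derivs ::
    "real \<Rightarrow> (real \<Rightarrow> complex) \<Rightarrow> (real \<Rightarrow> complex) \<Rightarrow> (real \<Rightarrow> complex) \<Rightarrow> bool" where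
  "H2_derivs l f g h \<longleftrightarrow>
     (\<forall>x\<in>{0..l}. (f has_vector_derivative g x) (at x within {0..l})) \<and>
     L2_on {0..l} h \<and>
     (\<forall>x\<in>{0..l}. g x = g 0 + integral {0..x} h)"

text \<open>
  Elements of \<open>H\<^sup>2\<close> are equivalence classes; the \<open>C\<^sup>1\<close> representative extended by zero outside
  \<open>[0, len G e]\<close> makes the representative unique, so that dimensions of subspaces of
  \<open>H2_graph G\<close> are the dimensions in \<open>L\<^sup>2\<close>.
\<close>

definition H2_graph :: "('v::finite, 'e::finite) metric_graph \<Rightarrow> 'e graph_fun set" where
  "H2_graph G = {f. \<forall>e. (\<exists>g h. H2_derivs (len G e) (f e) g h) \<and>
                        (\<forall>x. x \<notin> {0..len G e} \<longrightarrow> f e x = 0)}"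

definition real_Linf_potential ::
    "('v::finite, 'e::finite) metric_graph \<Rightarrow> ('e \<Rightarrow> real \<Rightarrow> real) \<Rightarrow> bool" where
  "real_Linf_potential G q \<longleftrightarrow>
     (\<forall>e. q e \<in> borel_measurable (lebesgue_on {0..len G e}) \<and>
          (\<exists>C. AE x in lebesgue_on {0..len G e}. \<bar>q e x\<bar> \<le> C))"


section \<open>Boundary values\<close>

text \<open>
  The \<open>deg G v\<close>-dimensional complex space of boundary vectors at \<open>v\<close> is the subspace of \<open>complex ^ ('e \<times> bool)\<close> of vectors
  vanishing at all ends that are not attached to \<open>v\<close>; \<open>at_vertex G v\<close> is the projection onto it.
\<close>

type_synonym 'e end_vec = "complex ^ ('e \<times> bool)"

definition at_vertex :: "('v::finite, 'e::finite) metric_graph \<Rightarrow> 'v \<Rightarrow> 'e end_vec \<Rightarrow> 'e end_vec" where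
  "at_vertex G v F = (\<chi> p. if att G p = v then F $ p else 0)"

definition bd_values :: "('v::finite, 'e::finite) metric_graph \<Rightarrow> 'e graph_fun \<Rightarrow> 'v \<Rightarrow> 'e end_vec" where
  "bd_values G f v = at_vertex G v (\<chi> p. case p of (e, b) \<Rightarrow> f e (if b then len G e else 0))"

text \<open>Derivatives are taken out of the vertex, into the edge: \<open>f'(0)\<close> and \<open>- f'(len G e)\<close>.\<close>

definition bd_derivs :: "('v::finite, 'e::finite) metric_graph \<Rightarrow> 'e graph_fun \<Rightarrow> 'v \<Rightarrow> 'e end_vec" where
  "bd_derivs G f v = at_vertex G v (\<chi> p. case p of (e, b) \<Rightarrow>
     if b then - vector_derivative (f e) (at (len G e) within {0..len G e})
          else vector_derivative (f e) (at 0 within {0..len G e}))"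


section \<open>Vertex conditions\<close>

text \<open>A vertex condition is a relation between \<open>F(v)\<close> and \<open>F'(v)\<close>.\<close>

type_synonym 'e vertex_cond = "'e end_vec \<Rightarrow> 'e end_vec \<Rightarrow> bool"

definition cdot :: "complex ^ 'n \<Rightarrow> complex ^ 'n \<Rightarrow> complex" where
  "cdot x y = (\<Sum>i\<in>UNIV. cnj (x $ i) * y $ i)"

definition orthogonal_projection :: "complex ^ 'n ^ 'n \<Rightarrow> bool" where
  "orthogonal_projection P \<longleftrightarrow> P ** P = P \<and> (\<forall>x y. cdot (P *v x) y = cdot x (P *v y))"

definition orthogonal_ranges :: "complex ^ 'n ^ 'n \<Rightarrow> complex ^ 'n ^ 'n \<Rightarrow> bool" where
  "orthogonal_ranges P Q \<longleftrightarrow> (\<forall>x y. cdot (P *v x) (Q *v y) = 0)"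

text \<open>Only the restriction of the matrix \<open>A\<close> to the range of \<open>P\<close> matters here.\<close>

definition selfadjoint_invertible_on_range :: "complex ^ 'n ^ 'n \<Rightarrow> complex ^ 'n ^ 'n \<Rightarrow> bool" where
  "selfadjoint_invertible_on_range P A \<longleftrightarrow>
     bij_betw ((*v) A) (range ((*v) P)) (range ((*v) P)) \<and>
     (\<forall>x\<in>range ((*v) P). \<forall>y\<in>range ((*v) P). cdot (A *v x) y = cdot x (A *v y))"

text \<open>
  The requirement that the three projections sum to the projection \<open>at_vertex G v\<close> (the identity
  at \<open>v\<close>) forces them to vanish at the ends not attached to \<open>v\<close>.
\<close>

definition local_selfadjoint_cond ::
    "('v::finite, 'e::finite) metric_graph \<Rightarrow> 'v \<Rightarrow> 'e vertex_cond \<Rightarrow> bool" where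
  "local_selfadjoint_cond G v B \<longleftrightarrow>
     (\<exists>PD PN PR A.
        orthogonal_projection PD \<and> orthogonal_projection PN \<and> orthogonal_projection PR \<and>
        orthogonal_ranges PD PN \<and> orthogonal_ranges PD PR \<and> orthogonal_ranges PN PR \<and>
        (\<forall>x. PD *v x + PN *v x + PR *v x = at_vertex G v x) \<and>
        selfadjoint_invertible_on_range PR A \<and>
        (\<forall>F F'. B F F' \<longleftrightarrow>
           PD *v F = 0 \<and> PN *v F' = 0 \<and> PR *v F' = A *v (PR *v F)))"

definition delta_cond ::
    "('v::finite, 'e::finite) metric_graph \<Rightarrow> 'v \<Rightarrow> real \<Rightarrow> 'e vertex_cond" where
  "delta_cond G v \<alpha> F F' \<longleftrightarrow>
     (\<exists>c. (\<forall>p\<in>ends_at G v. F $ p = c) \<and> (\<Sum>p\<in>ends_at G v. F' $ p) = of_real \<alpha> * c)"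

definition delta_prime_cond ::
    "('v::finite, 'e::finite) metric_graph \<Rightarrow> 'v \<Rightarrow> real \<Rightarrow> 'e vertex_cond" where
  "delta_prime_cond G v \<beta> F F' \<longleftrightarrow>
     (\<exists>c. (\<forall>p\<in>ends_at G v. F' $ p = c) \<and> (\<Sum>p\<in>ends_at G v. F $ p) = of_real \<beta> * c)"


section \<open>Schroedinger operators and their eigenvalues\<close>

text \<open>
  The operator is given by its graph: pairs \<open>(f, w)\<close> with \<open>f\<close> in the domain and
  \<open>w = - f'' + q f\<close> almost everywhere on every edge.
\<close>

definition schroedinger ::
    "('v::finite, 'e::finite) metric_graph \<Rightarrow> ('e \<Rightarrow> real \<Rightarrow> real) \<Rightarrow> ('v \<Rightarrow> 'e vertex_cond)
      \<Rightarrow> ('e graph_fun \<times> 'e graph_fun) set" where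
  "schroedinger G q B =
     {(f, w). f \<in> H2_graph G \<and>
        (\<forall>v. B v (bd_values G f v) (bd_derivs G f v)) \<and>
        (\<forall>e. \<exists>g h. H2_derivs (len G e) (f e) g h \<and>
           (AE x in lebesgue_on {0..len G e}. w e x = - h x + of_real (q e x) * f e x))}"

definition eigenspace :: "('e graph_fun \<times> 'e graph_fun) set \<Rightarrow> real \<Rightarrow> 'e graph_fun set" where
  "eigenspace H \<mu> = {f. (f, gscale (of_real \<mu>) f) \<in> H}"

definition eig_mult :: "('e graph_fun \<times> 'e graph_fun) set \<Rightarrow> real \<Rightarrow> nat" where
  "eig_mult H \<mu> = graph_dim (eigenspace H \<mu>)"

text \<open>
  The \<open>k\<close>-th eigenvalue, \<open>k \<ge> 1\<close>, counted with multiplicities: the least \<open>x\<close> such that the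
  eigenvalues \<open>\<mu> \<le> x\<close> have total multiplicity at least \<open>k\<close>. For operators bounded below with
  purely discrete spectrum this is the \<open>k\<close>-th term of the nondecreasing enumeration, see
  \<open>eigenvalue_eq_enumeration\<close>.
\<close>

definition eigenvalue :: "('e graph_fun \<times> 'e graph_fun) set \<Rightarrow> nat \<Rightarrow> real" where
  "eigenvalue H k = Inf {x. \<exists>M. finite M \<and> M \<subseteq> {..x} \<and> k \<le> (\<Sum>\<mu>\<in>M. eig_mult H \<mu>)}"

lemma eigenvalue_eq_enumeration:
  fixes lam :: "nat \<Rightarrow> real"
  assumes mono: "\<And>i j. 1 \<le> i \<Longrightarrow> i \<le> j \<Longrightarrow> lam i \<le> lam j"
    and fin: "\<And>\<mu>. finite {i. 1 \<le> i \<and> lam i = \<mu>}"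
    and mult: "\<And>\<mu>. card {i. 1 \<le> i \<and> lam i = \<mu>} = eig_mult H \<mu>"
    and k: "1 \<le> k"
  shows "eigenvalue H k = lam k"
proof -
  have sum: "(\<Sum>\<mu>\<in>M. eig_mult H \<mu>) = card {i. 1 \<le> i \<and> lam i \<in> M}"
    and finM: "finite {i. 1 \<le> i \<and> lam i \<in> M}" if "finite M" for M
  proof -
    have eq: "{i. 1 \<le> i \<and> lam i \<in> M} = (\<Union>\<mu>\<in>M. {i. 1 \<le> i \<and> lam i = \<mu>})" by auto
    show "finite {i. 1 \<le> i \<and> lam i \<in> M}" unfolding eq using that fin by blast
    have "card (\<Union>\<mu>\<in>M. {i. 1 \<le> i \<and> lam i = \<mu>}) = (\<Sum>\<mu>\<in>M. card {i. 1 \<le> i \<and> lam i = \<mu>})"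
      by (rule card_UN_disjoint) (use that fin in auto)
    then show "(\<Sum>\<mu>\<in>M. eig_mult H \<mu>) = card {i. 1 \<le> i \<and> lam i \<in> M}"
      unfolding eq mult by simp
  qed
  have "{x. \<exists>M. finite M \<and> M \<subseteq> {..x} \<and> k \<le> (\<Sum>\<mu>\<in>M. eig_mult H \<mu>)} = {lam k..}"
  proof (intro equalityI subsetI; clarsimp)
    fix x M assume M: "finite M" "M \<subseteq> {..x}" "k \<le> (\<Sum>\<mu>\<in>M. eig_mult H \<mu>)"
    show "lam k \<le> x"
    proof (rule ccontr)
      assume "\<not> lam k \<le> x"
      then have "{i. 1 \<le> i \<and> lam i \<in> M} \<subseteq> {1..<k}"
        using M(2) mono[OF k] by (auto simp: subset_iff) (meson leI order_trans)
      then have "card {i. 1 \<le> i \<and> lam i \<in> M} \<le> card {1..<k}"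
        by (intro card_mono) auto
      with M k show False by (simp add: sum)
    qed
  next
    fix x assume x: "lam k \<le> x"
    let ?M = "lam ` {1..k}"
    have "card {1..k} \<le> card {i. 1 \<le> i \<and> lam i \<in> ?M}"
      by (rule card_mono[OF finM]) auto
    then have "k \<le> (\<Sum>\<mu>\<in>?M. eig_mult H \<mu>)" by (simp add: sum)
    moreover have "?M \<subseteq> {..x}" using mono x by fastforce
    ultimately show "\<exists>M. finite M \<and> M \<subseteq> {..x} \<and> k \<le> (\<Sum>\<mu>\<in>M. eig_mult H \<mu>)"
      by (intro exI[of _ ?M]) simp
  qed
  then show ?thesis by (simp add: eigenvalue_def)
qed

end

theory Submission
  imports Defs "HOL-Complex_Analysis.Great_Picard"
begin

text \<open>
  Both operators come from quadratic forms with the same energy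
  \<open>\<integral> |f'|\<^sup>2 + q |f|\<^sup>2\<close> and the same boundary terms away from \<open>v0\<close>. Let \<open>d\<close> be the degree of
  \<open>v0\<close>. The \<open>\<delta>\<close> form is defined on functions that are continuous at \<open>v0\<close> and contains the term
  \<open>\<alpha> |f(v0)|\<^sup>2\<close>; the \<open>\<delta>'\<close> form puts no restriction on the boundary values at \<open>v0\<close> and contains
  \<open>|s|\<^sup>2 / \<beta>\<close>, where \<open>s\<close> is the sum of these values. On functions that are continuous at \<open>v0\<close> one
  has \<open>s = d f(v0)\<close>, so the second term is \<open>(d\<^sup>2 / \<beta>) |f(v0)|\<^sup>2 \<le> \<alpha> |f(v0)|\<^sup>2\<close>. The \<open>\<delta>'\<close> form thus has
  the larger domain and is the smaller form on the common domain, and the min-max principle gives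
  the inequality of the eigenvalues.

  The min-max principle is used in the form of two statements about the number of eigenvalues
  \<open>\<le> x\<close>, counted with multiplicities. The eigenfunctions for such eigenvalues span a space on which
  the form is at most \<open>x \<parallel>f\<parallel>\<^sup>2\<close> (\<open>spectral_subspace\<close>). Conversely a \<open>k\<close>-dimensional space with this
  property forces \<open>k\<close> eigenvalues \<open>\<le> x\<close> (\<open>eigenvalue_count_lower_bound\<close>): with fewer of them, some
  nonzero \<open>f\<close> in the space would be orthogonal to all their eigenfunctions, which contradicts
  \<open>spectral_gap\<close>. That lemma rests on the resolvent \<open>K\<close> of the operator shifted by a large constant
  \<open>c\<close>: on the orthogonal complement of given eigenspaces the Rayleigh quotient of \<open>K\<close> attains its
  supremum \<open>\<mu>\<close> at an eigenvector, so that \<open>1/\<mu> - c\<close> is an eigenvalue of the operator outside the given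
  set, and the Cauchy-Schwarz inequality of the shifted form turns \<open>\<langle>K f, f\<rangle> \<le> \<mu> \<parallel>f\<parallel>\<^sup>2\<close> into
  the lower bound \<open>1/\<mu> - c\<close> for the form itself. With the set of all real numbers in place of
  \<open>{..x}\<close> the same argument shows that there are infinitely many eigenvalues; together with the lower
  bound of the form this makes the infimum in the definition of \<open>eigenvalue\<close> one over a
  nonempty set that is bounded below.

  The resolvent acts on continuous functions \<open>w\<close>: the equation
  \<open>- u'' + (q + c) u = w\<close> is solved edge by edge as an ordinary differential equation, and the
  vertex conditions become a square linear system for the initial data, which is injective
  because the shifted form is positive. The resolvent is compact by the Arzela-Ascoli
  theorem, as a bound on the form is a bound in \<open>H\<^sup>1\<close> and hence one for the Hoelder norm.

  All vertices are treated at once. Every vertex condition considered here can be written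
  \<open>P F = 0\<close>, \<open>F' - P F' = A F\<close> with an orthogonal projection \<open>P\<close> and a Hermitian \<open>A\<close> such that \<open>P A = 0\<close>;
  summing over the vertices gives one condition of this kind on the vectors of all boundary values, with
  form domain \<open>P F = 0\<close> and boundary term \<open>\<langle>F, A F\<rangle>\<close>.
\<close>

section \<open>Compact symmetric operators on spaces with a semi-inner product\<close>

text \<open>
  Functions on the graph form a complex vector space through \<open>gscale\<close>. Orthogonality and the
  Rayleigh quotient need its real structure only, and the type class gives access to the
  library of real vector spaces.
\<close>

instantiation "fun" :: (type, real_vector) real_vector
begin
definition scaleR_fun_def: "scaleR r f = (\<lambda>x. r *\<^sub>R f x)"
instance by standard (auto simp: scaleR_fun_def fun_eq_iff algebra_simps)
end
text \<open>
  The form may vanish on nonzero elements: two functions on the graph that agree on the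
  edges are indistinguishable for it. Everything is relative to a carrier, since the integrals are linear
  only on integrable functions.
\<close>

locale pre_inner_space =
  fixes X :: "'a::real_vector set" and ip :: "'a \<Rightarrow> 'a \<Rightarrow> real"
  assumes sub: "subspace X"
    and ip_add_left: "\<And>x y z. \<lbrakk>x \<in> X; y \<in> X; z \<in> X\<rbrakk> \<Longrightarrow> ip (x + y) z = ip x z + ip y z"
    and ip_scale_left: "\<And>x y r. \<lbrakk>x \<in> X; y \<in> X\<rbrakk> \<Longrightarrow> ip (r *\<^sub>R x) y = r * ip x y"
    and ip_sym: "\<And>x y. \<lbrakk>x \<in> X; y \<in> X\<rbrakk> \<Longrightarrow> ip x y = ip y x"
    and ip_nonneg: "\<And>x. x \<in> X \<Longrightarrow> 0 \<le> ip x x"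
begin

lemma carrier_closed [simp]:
  "x \<in> X \<Longrightarrow> y \<in> X \<Longrightarrow> x + y \<in> X" "x \<in> X \<Longrightarrow> y \<in> X \<Longrightarrow> x - y \<in> X" "x \<in> X \<Longrightarrow> r *\<^sub>R x \<in> X"
  "0 \<in> X" "x \<in> X \<Longrightarrow> - x \<in> X"
  using sub by (auto simp: subspace_add subspace_diff subspace_scale subspace_0 subspace_neg)

lemma ip_add_right: "\<lbrakk>x \<in> X; y \<in> X; z \<in> X\<rbrakk> \<Longrightarrow> ip z (x + y) = ip z x + ip z y"
  using ip_add_left[of x y z] ip_sym by simp

lemma ip_scale_right: "\<lbrakk>x \<in> X; y \<in> X\<rbrakk> \<Longrightarrow> ip y (r *\<^sub>R x) = r * ip y x"
  using ip_scale_left[of x y r] ip_sym by simp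

lemma ip_minus_left: "\<lbrakk>x \<in> X; y \<in> X\<rbrakk> \<Longrightarrow> ip (- x) y = - ip x y"
  using ip_scale_left[of x y "-1"] by simp

lemma ip_diff_left: "\<lbrakk>x \<in> X; y \<in> X; z \<in> X\<rbrakk> \<Longrightarrow> ip (x - y) z = ip x z - ip y z"
  using ip_add_left[of x "- y" z] by (simp add: ip_minus_left)

lemma ip_diff_right: "\<lbrakk>x \<in> X; y \<in> X; z \<in> X\<rbrakk> \<Longrightarrow> ip z (x - y) = ip z x - ip z y"
  using ip_diff_left[of x y z] ip_sym by simp

lemma ip_zero_left: "x \<in> X \<Longrightarrow> ip 0 x = 0"
  using ip_scale_left[of x x 0] by simp

lemma Cauchy_Schwarz_ineq:
  assumes "x \<in> X" "y \<in> X"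
  shows "(ip x y)\<^sup>2 \<le> ip x x * ip y y"
proof -
  have q: "0 \<le> ip x x + 2 * t * ip x y + t\<^sup>2 * ip y y" for t
  proof -
    have "0 \<le> ip (x + t *\<^sub>R y) (x + t *\<^sub>R y)"
      using assms by (intro ip_nonneg) simp
    also have "\<dots> = ip x x + 2 * t * ip x y + t\<^sup>2 * ip y y"
      using assms ip_sym[of y x]
      by (simp add: ip_add_left ip_add_right ip_scale_left ip_scale_right power2_eq_square algebra_simps)
    finally show ?thesis .
  qed
  show ?thesis
  proof (cases "ip y y = 0")
    case True
    have "ip x y = 0"
    proof (rule ccontr)
      assume "ip x y \<noteq> 0"
      then show False using q[of "- (ip x x + 1) / (2 * ip x y)"] True by (simp add: field_simps)
    qed
    then show ?thesis using True by simp
  next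
    case False
    then have "ip y y > 0" using ip_nonneg[OF assms(2)] by simp
    then show ?thesis using q[of "- ip x y / ip y y"]
      by (simp add: field_simps power2_eq_square)
  qed
qed

definition nrm :: "'a \<Rightarrow> real" where "nrm x = sqrt (ip x x)"

lemma nrm_nonneg: "x \<in> X \<Longrightarrow> 0 \<le> nrm x"
  by (simp add: nrm_def ip_nonneg)

lemma nrm_square: "x \<in> X \<Longrightarrow> (nrm x)\<^sup>2 = ip x x"
  by (simp add: nrm_def ip_nonneg)

lemma ip_le_nrm: "\<lbrakk>x \<in> X; y \<in> X\<rbrakk> \<Longrightarrow> \<bar>ip x y\<bar> \<le> nrm x * nrm y"
  unfolding nrm_def real_sqrt_mult[symmetric]
  using Cauchy_Schwarz_ineq real_le_rsqrt[of "\<bar>ip x y\<bar>"] by simp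

lemma nrm_scale: "x \<in> X \<Longrightarrow> nrm (r *\<^sub>R x) = \<bar>r\<bar> * nrm x"
  by (simp add: nrm_def ip_scale_left ip_scale_right real_sqrt_mult flip: mult.assoc power2_eq_square)

lemma nrm_triangle: "\<lbrakk>x \<in> X; y \<in> X\<rbrakk> \<Longrightarrow> nrm (x + y) \<le> nrm x + nrm y"
proof (rule power2_le_imp_le)
  assume xy: "x \<in> X" "y \<in> X"
  have "(nrm (x + y))\<^sup>2 = ip x x + 2 * ip x y + ip y y"
    using xy ip_sym[of y x] by (simp add: nrm_square ip_add_left ip_add_right)
  also have "\<dots> \<le> (nrm x + nrm y)\<^sup>2"
    using ip_le_nrm[OF xy] xy by (simp add: power2_sum nrm_square)
  finally show "(nrm (x + y))\<^sup>2 \<le> (nrm x + nrm y)\<^sup>2" .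
  show "0 \<le> nrm x + nrm y" using xy nrm_nonneg by simp
qed

lemma nrm_diff_triangle: "\<lbrakk>x \<in> X; y \<in> X\<rbrakk> \<Longrightarrow> nrm (x - y) \<le> nrm x + nrm y"
  using nrm_triangle[of x "- y"] nrm_scale[of y "-1"] by simp

text \<open>
  The supremum \<open>\<mu>\<close> of the Rayleigh quotient is attained. For a maximizing sequence \<open>u\<close> in the unit ball,
  the Cauchy-Schwarz inequality for the form \<open>\<langle>K x, y\<rangle>\<close> gives \<open>\<parallel>K x\<parallel>\<^sup>2 \<le> \<mu> \<langle>K x, x\<rangle>\<close>, so \<open>K u - \<mu> u\<close> tends to
  0. If \<open>K u\<close> tends to \<open>g\<close> along a subsequence, then \<open>K g - \<mu> g\<close> has norm 0. As the form may be
  degenerate, \<open>g\<close> itself need not be an eigenvector, but \<open>K g\<close> is one, because \<open>K\<close> kills elements of norm 0.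
  The eigenvectors in \<open>T\<close> are deflated: \<open>K\<close> preserves the orthogonal complement of \<open>T\<close>.
\<close>

lemma compact_symmetric_top_eigenvector:
  fixes K :: "'a \<Rightarrow> 'a" and T :: "'a set"
  assumes KX: "\<And>x. x \<in> X \<Longrightarrow> K x \<in> X"
    and K_add: "\<And>x y. x \<in> X \<Longrightarrow> y \<in> X \<Longrightarrow> K (x + y) = K x + K y"
    and K_scale: "\<And>x r. x \<in> X \<Longrightarrow> K (r *\<^sub>R x) = r *\<^sub>R K x"
    and K_sym: "\<And>x y. x \<in> X \<Longrightarrow> y \<in> X \<Longrightarrow> ip (K x) y = ip x (K y)"
    and K_nonneg: "\<And>x. x \<in> X \<Longrightarrow> 0 \<le> ip (K x) x"
    and K_bounded: "\<And>x. x \<in> X \<Longrightarrow> ip (K x) x \<le> C * ip x x"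
    and K_null: "\<And>x. x \<in> X \<Longrightarrow> ip x x = 0 \<Longrightarrow> K x = 0"
    and K_compact: "\<And>u :: nat \<Rightarrow> 'a. (\<And>n. u n \<in> X \<and> ip (u n) (u n) \<le> 1) \<Longrightarrow>
        \<exists>r g. strict_mono r \<and> g \<in> X \<and> (\<lambda>n. ip (K (u (r n)) - g) (K (u (r n)) - g)) \<longlonglongrightarrow> 0"
    and T: "T \<subseteq> X" "\<And>t. t \<in> T \<Longrightarrow> \<exists>\<nu>. K t = \<nu> *\<^sub>R t"
    and W: "W = {x \<in> X. \<forall>t\<in>T. ip x t = 0}"
    and x0: "x0 \<in> W" "ip (K x0) x0 > 0"
  obtains \<mu> \<phi> where "\<mu> > 0" "\<phi> \<in> W" "K \<phi> = \<mu> *\<^sub>R \<phi>" "ip \<phi> \<phi> > 0"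
    "\<And>x. x \<in> W \<Longrightarrow> ip (K x) x \<le> \<mu> * ip x x"
proof -
  have WX: "x \<in> X" if "x \<in> W" for x using that W by simp
  have subW: "subspace W"
    unfolding W subspace_def using T(1) by (auto simp: ip_zero_left ip_add_left ip_scale_left subset_iff)
  note cW = subspace_add[OF subW] subspace_diff[OF subW] subspace_scale[OF subW]
  have KW: "K x \<in> W" if "x \<in> W" for x
  proof -
    have "ip (K x) t = 0" if t: "t \<in> T" for t
    proof -
      obtain \<nu> where "K t = \<nu> *\<^sub>R t" using T(2)[OF t] by blast
      then show ?thesis
        using K_sym[of x t] ip_scale_right[of t x \<nu>] t \<open>x \<in> W\<close> T(1) W by (auto simp: subset_iff)
    qed
    then show ?thesis using W KX that by simp
  qed
  interpret B: pre_inner_space W "\<lambda>x y. ip (K x) y"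
  proof
    fix x y assume "x \<in> W" "y \<in> W"
    then show "ip (K x) y = ip (K y) x" using K_sym ip_sym KX WX by metis
  qed (use subW KX WX in \<open>auto simp: K_add K_scale ip_add_left ip_scale_left K_nonneg\<close>)
  define S where "S = {ip (K x) x | x. x \<in> W \<and> ip x x \<le> 1}"
  define \<mu> where "\<mu> = Sup S"
  have bdd: "bdd_above S"
  proof (rule bdd_aboveI[of _ "\<bar>C\<bar>"])
    fix s assume "s \<in> S"
    then obtain x where x: "s = ip (K x) x" "x \<in> W" "ip x x \<le> 1" unfolding S_def by blast
    have "s \<le> C * ip x x" using x K_bounded WX by simp
    also have "\<dots> \<le> \<bar>C\<bar> * 1" by (intro mult_mono) (use x WX ip_nonneg in auto)
    finally show "s \<le> \<bar>C\<bar>" by simp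
  qed
  have upper: "ip (K x) x \<le> \<mu> * ip x x" if x: "x \<in> W" for x
  proof (cases "ip x x = 0")
    case True
    then show ?thesis using K_null[OF WX[OF x]] ip_zero_left[OF WX[OF x]] by simp
  next
    case False
    then have pos: "ip x x > 0" using ip_nonneg[OF WX[OF x]] by simp
    define y where "y = (1 / nrm x) *\<^sub>R x"
    have n: "nrm x > 0" using pos by (simp add: nrm_def)
    have n2: "nrm x * nrm x = ip x x" using nrm_square[OF WX[OF x]] by (simp add: power2_eq_square)
    have "ip y y = 1" "ip (K y) y = ip (K x) x / ip x x"
      using x WX KX n pos n2
      by (simp_all add: y_def ip_scale_left ip_scale_right K_scale field_simps)
    moreover have "y \<in> W" using cW x y_def by simp
    ultimately have "ip (K x) x / ip x x \<in> S"
      unfolding S_def by (intro CollectI exI[of _ y]) simp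
    then have "ip (K x) x / ip x x \<le> \<mu>" unfolding \<mu>_def using bdd by (rule cSup_upper)
    then show ?thesis using pos by (simp add: field_simps)
  qed
  have \<mu>: "\<mu> > 0"
    using upper[OF x0(1)] x0(2) ip_nonneg[OF WX[OF x0(1)]]
    by (meson less_le_trans mult_nonpos_nonneg not_le)
  have K2: "ip (K x) (K x) \<le> \<mu> * ip (K x) x" if x: "x \<in> W" for x
  proof (cases "ip (K x) (K x) = 0")
    case True
    then show ?thesis using \<mu> K_nonneg[OF WX[OF x]] by simp
  next
    case False
    then have p: "ip (K x) (K x) > 0" using ip_nonneg[OF KX[OF WX[OF x]]] by simp
    have "(ip (K x) (K x))\<^sup>2 \<le> ip (K x) x * ip (K (K x)) (K x)"
      using B.Cauchy_Schwarz_ineq[OF x KW[OF x]] .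
    also have "\<dots> \<le> ip (K x) x * (\<mu> * ip (K x) (K x))"
      by (intro mult_left_mono upper KW x K_nonneg WX)
    finally show ?thesis using p by (simp add: power2_eq_square mult.commute)
  qed
  have Kn: "nrm (K x) \<le> \<mu> * nrm x" if x: "x \<in> W" for x
  proof (rule power2_le_imp_le)
    have "(nrm (K x))\<^sup>2 \<le> \<mu> * ip (K x) x" using K2[OF x] nrm_square KX WX x by simp
    also have "\<dots> \<le> \<mu> * (\<mu> * ip x x)" using upper[OF x] \<mu> by simp
    finally show "(nrm (K x))\<^sup>2 \<le> (\<mu> * nrm x)\<^sup>2"
      unfolding power_mult_distrib nrm_square[OF WX[OF x]] by (simp add: power2_eq_square mult.assoc)
    show "0 \<le> \<mu> * nrm x" using \<mu> nrm_nonneg WX x by simp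
  qed
  have "\<exists>x. x \<in> W \<and> ip x x \<le> 1 \<and> \<mu> - 1 / Suc n < ip (K x) x" for n :: nat
  proof -
    have "S \<noteq> {}" unfolding S_def using subspace_0[OF subW] ip_zero_left[of 0] by fastforce
    moreover have "\<mu> - 1 / Suc n < Sup S" unfolding \<mu>_def by simp
    ultimately obtain s where "s \<in> S" "\<mu> - 1 / Suc n < s" using less_cSupE by metis
    then show ?thesis unfolding S_def by blast
  qed
  then obtain u where u: "\<And>n. u n \<in> W" "\<And>n. ip (u n) (u n) \<le> 1" "\<And>n. \<mu> - 1 / Suc n < ip (K (u n)) (u n)"
    by metis
  obtain r g where r: "strict_mono r" and g: "g \<in> X"
      and lim: "(\<lambda>n. ip (K (u (r n)) - g) (K (u (r n)) - g)) \<longlonglongrightarrow> 0"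
    using K_compact[of u] u WX by blast
  define e where "e = (\<lambda>n. K (u (r n)) - g)"
  define d where "d = (\<lambda>n. K (u (r n)) - \<mu> *\<^sub>R u (r n))"
  have e_lim: "(\<lambda>n. nrm (e n)) \<longlonglongrightarrow> 0"
    unfolding nrm_def e_def using tendsto_real_sqrt[OF lim] by simp
  have eX: "e n \<in> X" for n unfolding e_def using KX WX u g by simp
  have inv: "(\<lambda>n. 1 / real (Suc (r n))) \<longlonglongrightarrow> 0"
    using LIMSEQ_subseq_LIMSEQ[OF LIMSEQ_inverse_real_of_nat r] by (simp add: o_def inverse_eq_divide)
  have dW: "d n \<in> W" for n unfolding d_def using cW KW u by simp
  have d_lim: "(\<lambda>n. nrm (d n)) \<longlonglongrightarrow> 0"
  proof -
    have "ip (d n) (d n) \<le> \<mu> * (1 / Suc (r n))" for n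
    proof -
      let ?u = "u (r n)"
      have uX: "?u \<in> X" "K ?u \<in> X" using u WX KX by auto
      have "ip (d n) (d n) = ip (K ?u) (K ?u) - 2 * \<mu> * ip (K ?u) ?u + \<mu>\<^sup>2 * ip ?u ?u"
        unfolding d_def using uX ip_sym[of ?u "K ?u"]
        by (simp add: ip_diff_left ip_diff_right ip_scale_left ip_scale_right power2_eq_square algebra_simps)
      also have "\<dots> \<le> \<mu> * ip (K ?u) ?u - 2 * \<mu> * ip (K ?u) ?u + \<mu>\<^sup>2 * 1"
        using K2[OF u(1)] u(2)[of "r n"] \<mu> by (intro add_mono diff_mono mult_left_mono) auto
      also have "\<dots> = \<mu> * (\<mu> - ip (K ?u) ?u)" by (simp add: power2_eq_square algebra_simps)
      also have "\<dots> \<le> \<mu> * (1 / Suc (r n))" using u(3)[of "r n"] \<mu> by (intro mult_left_mono) auto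
      finally show ?thesis .
    qed
    then have "(\<lambda>n. ip (d n) (d n)) \<longlonglongrightarrow> 0"
      using tendsto_sandwich[OF _ _ tendsto_const tendsto_mult_right_zero[OF inv, of \<mu>]]
        ip_nonneg WX dW by (simp add: eventually_sequentially)
    from tendsto_real_sqrt[OF this] show ?thesis by (simp add: nrm_def)
  qed
  have gW: "g \<in> W"
  proof -
    have "ip g t = 0" if t: "t \<in> T" for t
    proof -
      have tX: "t \<in> X" using t T by blast
      have "\<bar>ip g t\<bar> \<le> nrm (e n) * nrm t" for n
      proof -
        have "ip (K (u (r n))) t = 0" using KW u(1) W t by blast
        then have "ip g t = - ip (e n) t"
          unfolding e_def using g KX WX u tX by (simp add: ip_diff_left)
        then show ?thesis using ip_le_nrm[OF eX tX, of n] by simp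
      qed
      moreover have "(\<lambda>n. nrm (e n) * nrm t) \<longlonglongrightarrow> 0" using tendsto_mult_left_zero[OF e_lim] .
      ultimately have "\<bar>ip g t\<bar> \<le> 0" by (intro LIMSEQ_le_const[of _ 0]) auto
      then show ?thesis by simp
    qed
    then show ?thesis using W g by simp
  qed
  have eW: "e n \<in> W" for n unfolding e_def using cW KW u gW by simp
  have null: "nrm (K g - \<mu> *\<^sub>R g) = 0"
  proof -
    have "nrm (K g - \<mu> *\<^sub>R g) \<le> \<mu> * nrm (d n) + \<mu> * nrm (e n) + \<mu> * nrm (e n)" for n
    proof -
      have X: "g \<in> X" "u (r n) \<in> X" "K (u (r n)) \<in> X" "d n \<in> X" "e n \<in> X" "K (d n) \<in> X" "K (e n) \<in> X"
        using g u WX KX dW eX by auto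
      have Kdiff: "K (x - y) = K x - K y" if "x \<in> X" "y \<in> X" for x y
        using K_add[of x "-y"] K_scale[of y "-1"] that by simp
      have "K g - \<mu> *\<^sub>R g = (K (d n) - K (e n)) + \<mu> *\<^sub>R e n"
        unfolding d_def e_def using X by (simp add: Kdiff K_scale algebra_simps)
      then have "nrm (K g - \<mu> *\<^sub>R g) \<le> (nrm (K (d n)) + nrm (K (e n))) + nrm (\<mu> *\<^sub>R e n)"
        using nrm_triangle[of "K (d n) - K (e n)" "\<mu> *\<^sub>R e n"] nrm_diff_triangle[of "K (d n)" "K (e n)"] X
        by simp
      then show ?thesis using Kn[OF dW, of n] Kn[OF eW, of n] nrm_scale[OF X(5), of \<mu>] \<mu> by simp
    qed
    moreover have "(\<lambda>n. \<mu> * nrm (d n) + \<mu> * nrm (e n) + \<mu> * nrm (e n)) \<longlonglongrightarrow> 0"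
      using d_lim e_lim by (auto intro!: tendsto_eq_intros)
    ultimately have "nrm (K g - \<mu> *\<^sub>R g) \<le> 0" by (intro LIMSEQ_le_const) auto
    then show ?thesis using nrm_nonneg[of "K g - \<mu> *\<^sub>R g"] g KX by simp
  qed
  \<comment> \<open>\<open>K g - \<mu> g\<close> has norm 0, hence is mapped to 0 by \<open>K\<close>\<close>
  define \<phi> where "\<phi> = K g"
  have "K (K g + (-\<mu>) *\<^sub>R g) = 0"
    using null g KX by (intro K_null) (auto simp: nrm_def)
  then have "K \<phi> = \<mu> *\<^sub>R \<phi>"
    unfolding \<phi>_def using K_add[of "K g" "(-\<mu>) *\<^sub>R g"] K_scale[OF g, of "-\<mu>"] g KX by simp
  moreover have "\<phi> \<in> W" unfolding \<phi>_def using KW gW by simp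
  moreover have "ip \<phi> \<phi> > 0"
  proof -
    have "\<mu> \<le> nrm (e n) + nrm g + 1 / Suc (r n)" for n
    proof -
      have X: "g \<in> X" "u (r n) \<in> X" "K (u (r n)) \<in> X" "e n \<in> X" using g u WX KX eX by auto
      have "ip (K (u (r n))) (u (r n)) \<le> nrm (K (u (r n))) * nrm (u (r n))"
        using ip_le_nrm[OF X(3,2)] by simp
      also have "\<dots> \<le> nrm (K (u (r n))) * 1"
        using u(2) nrm_nonneg X by (intro mult_left_mono) (simp_all add: nrm_def)
      also have "\<dots> \<le> nrm (e n) + nrm g"
        using nrm_triangle[OF X(4,1)] by (simp add: e_def)
      finally show ?thesis using u(3)[of "r n"] by simp
    qed
    moreover have "(\<lambda>n. nrm (e n) + nrm g + 1 / Suc (r n)) \<longlonglongrightarrow> 0 + nrm g + 0"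
      by (intro tendsto_add e_lim inv tendsto_const)
    ultimately have "\<mu> \<le> nrm g" by (intro LIMSEQ_le_const[of _ "nrm g"]) auto
    then have g0: "nrm g > 0" using \<mu> by simp
    have "\<mu> * nrm g \<le> nrm (K g)"
      using nrm_diff_triangle[of "K g" "K g - \<mu> *\<^sub>R g"] null nrm_scale[OF g, of \<mu>] g KX \<mu> by simp
    moreover have "0 < \<mu> * nrm g" using g0 \<mu> by simp
    ultimately have "nrm (K g) > 0" by linarith
    then show ?thesis unfolding \<phi>_def nrm_def by simp
  qed
  ultimately show ?thesis using that \<mu> upper by blast
qed

end

lemma (in vector_space) functional_eq_0_on_span:
  assumes "x \<in> span S" "span S \<subseteq> V"
    and add: "\<And>x y. x \<in> V \<Longrightarrow> y \<in> V \<Longrightarrow> l (x + y) = l x + l y"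
    and scale: "\<And>c x. x \<in> V \<Longrightarrow> l (scale c x) = c * l x"
    and zero: "\<And>x. x \<in> S \<Longrightarrow> l x = (0 :: 'a)"
  shows "l x = 0"
proof -
  have V: "y \<in> V" if "y \<in> span S" for y using that assms(2) by blast
  have "l 0 = 0" using scale[of 0 0] V span_zero by simp
  then have "subspace {x \<in> span S. l x = 0}"
    unfolding subspace_def using add scale V by (auto simp: span_zero span_add span_scale)
  then have "span S \<subseteq> {x \<in> span S. l x = 0}"
    using zero span_base by (intro span_minimal) auto
  then show ?thesis using assms(1) by blast
qed

text \<open>
  Fewer linear equations than unknowns have a nonzero solution. Each step of the induction eliminates
  one vector \<open>s\<close> with \<open>l i s \<noteq> 0\<close> by projecting the others along \<open>s\<close> into the kernel of \<open>l i\<close>.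
\<close>

lemma (in vector_space) common_kernel_nonzero:
  fixes l :: "'i \<Rightarrow> 'b \<Rightarrow> 'a"
  assumes "finite I" "independent S" "finite S" "card I < card S"
    and "\<And>i x y. i \<in> I \<Longrightarrow> x \<in> span S \<Longrightarrow> y \<in> span S \<Longrightarrow> l i (x + y) = l i x + l i y"
    and "\<And>i c x. i \<in> I \<Longrightarrow> x \<in> span S \<Longrightarrow> l i (scale c x) = c * l i x"
  shows "\<exists>x\<in>span S. x \<noteq> 0 \<and> (\<forall>i\<in>I. l i x = 0)"
  using assms
proof (induction I arbitrary: S rule: finite_induct)
  case empty
  then have "S \<noteq> {}" by auto
  then obtain x where x: "x \<in> S" by blast
  then show ?case using empty dependent_zero span_base by (intro bexI[of _ x]) auto
next
  case (insert i I)
  show ?case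
  proof (cases "\<forall>x\<in>S. l i x = 0")
    case True
    have zero: "l i x = 0" if "x \<in> span S" for x
      using that True insert.prems by (intro functional_eq_0_on_span[of x S "span S" "l i"]) auto
    have "\<exists>x\<in>span S. x \<noteq> 0 \<and> (\<forall>i\<in>I. l i x = 0)"
      using insert by (intro insert.IH) auto
    then show ?thesis using zero by auto
  next
    case False
    then obtain s where s: "s \<in> S" "l i s \<noteq> 0" by blast
    define \<pi> where "\<pi> = (\<lambda>x. x + scale (- (l i x / l i s)) s)"
    define S' where "S' = \<pi> ` (S - {s})"
    have \<pi>_span: "\<pi> x \<in> span S" if "x \<in> span S" for x
      unfolding \<pi>_def using that s by (intro span_add span_scale) (auto intro: span_base)
    have S'S: "S' \<subseteq> span S" unfolding S'_def using \<pi>_span span_base by auto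
    have sub: "span S' \<subseteq> span S" using S'S by (simp add: span_minimal subspace_span)
    have inj: "inj_on \<pi> (S - {s})"
    proof (rule inj_onI, rule ccontr)
      fix x y assume xy: "x \<in> S - {s}" "y \<in> S - {s}" "\<pi> x = \<pi> y" "x \<noteq> y"
      then have "x = y + scale (l i x / l i s - l i y / l i s) s"
        by (simp add: \<pi>_def algebra_simps)
      moreover have "y + scale (l i x / l i s - l i y / l i s) s \<in> span (S - {x})"
        using xy s by (intro span_add span_scale span_base) auto
      ultimately have "x \<in> span (S - {x})" by simp
      then show False using insert.prems(1) xy dependent_def by blast
    qed
    have fin: "finite S'" and card: "card S' = card S - 1"
      unfolding S'_def using insert.prems(2) s card_image[OF inj] by auto
    have "independent S'"
    proof
      assume "dependent S'"
      then obtain z where z: "z \<in> S'" "z \<in> span (S' - {z})" unfolding dependent_def by blast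
      define R where "R = insert s (S' - {z})"
      have finR: "finite R" unfolding R_def using fin by simp
      have "card R \<le> Suc (card (S' - {z}))" unfolding R_def using fin by (simp add: card_insert_if)
      also have "\<dots> = card S - 1" using card_Suc_Diff1[OF fin z(1)] card by simp
      also have "\<dots> < card S" using insert.prems(2) s by (metis card_gt_0_iff diff_less empty_iff zero_less_one)
      finally have less: "card R < card S" .
      have "S \<subseteq> span R"
      proof
        fix x assume x: "x \<in> S"
        show "x \<in> span R"
        proof (cases "x = s")
          case False
          have "\<pi> x \<in> S'" unfolding S'_def using x False by simp
          then have "\<pi> x \<in> span (S' - {z})" using z(2) by (cases "\<pi> x = z") (auto intro: span_base)
          then have "\<pi> x \<in> span R" unfolding R_def using span_mono[of "S' - {z}" "insert s (S' - {z})"] by blast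
          moreover have "scale (l i x / l i s) s \<in> span R" unfolding R_def by (intro span_scale span_base) simp
          ultimately have "\<pi> x + scale (l i x / l i s) s \<in> span R" by (rule span_add)
          then show ?thesis by (simp add: \<pi>_def)
        qed (simp add: R_def span_base)
      qed
      then show False using independent_span_bound[OF finR insert.prems(1)] less by simp
    qed
    then have "\<exists>x\<in>span S'. x \<noteq> 0 \<and> (\<forall>i\<in>I. l i x = 0)"
      using insert.prems insert.hyps fin card sub s by (intro insert.IH) (auto simp: subset_iff)
    then obtain x where x: "x \<in> span S'" "x \<noteq> 0" "\<forall>i\<in>I. l i x = 0" by blast
    have "l i z = 0" if z: "z \<in> S'" for z
    proof -
      obtain y where "y \<in> S" "z = \<pi> y" using z unfolding S'_def by blast
      then show ?thesis unfolding \<pi>_def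
        using s insert.prems(4)[of i y "scale (- (l i y / l i s)) s"] insert.prems(5)[of i s "- (l i y / l i s)"]
        by (simp add: span_base span_scale span_neg)
    qed
    then have "l i y = 0" if "y \<in> span S'" for y
      using that sub insert.prems(4,5) by (intro functional_eq_0_on_span[of y S' "span S" "l i"]) auto
    then show ?thesis using x sub by auto
  qed
qed

section \<open>Integration by parts and trace inequalities on an interval\<close>

text \<open>
  \<open>f\<close> is continuously differentiable on \<open>[0,l]\<close> with derivative \<open>g\<close>.
\<close>

definition C1_deriv :: "real \<Rightarrow> (real \<Rightarrow> complex) \<Rightarrow> (real \<Rightarrow> complex) \<Rightarrow> bool" where
  "C1_deriv l f g \<longleftrightarrow> (\<forall>x\<in>{0..l}. (f has_vector_derivative g x) (at x within {0..l})) \<and> continuous_on {0..l} g"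

lemma L2_on_absolutely_integrable:
  assumes "L2_on {a..b} h"
  shows "h absolutely_integrable_on {a..b}"
proof -
  have "integrable (lebesgue_on {a..b}) (\<lambda>x. 1 + (cmod (h x))\<^sup>2)"
    using assms by (auto simp: L2_on_def integrable_restrict_space)
  then have "integrable (lebesgue_on {a..b}) h"
  proof (rule Bochner_Integration.integrable_bound)
    show "h \<in> borel_measurable (lebesgue_on {a..b})" using assms by (simp add: L2_on_def)
    have "cmod (h x) \<le> norm (1 + (cmod (h x))\<^sup>2)" for x
    proof -
      have "0 \<le> (cmod (h x) - 1)\<^sup>2" by simp
      then show ?thesis by (simp add: power2_diff) (smt (verit) norm_ge_zero)
    qed
    then show "AE x in lebesgue_on {a..b}. cmod (h x) \<le> norm (1 + (cmod (h x))\<^sup>2)" by simp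
  qed
  then show ?thesis by (simp add: integrable_restrict_space set_integrable_def)
qed

lemma continuous_on_norm_le:
  fixes f :: "real \<Rightarrow> 'a::real_normed_vector"
  assumes "continuous_on {a..b} f"
  obtains M where "M \<ge> 0" "\<And>x. x \<in> {a..b} \<Longrightarrow> norm (f x) \<le> M"
proof -
  have "bounded (f ` {a..b})" by (intro compact_imp_bounded compact_continuous_image assms compact_Icc)
  then obtain M where "\<And>x. x \<in> {a..b} \<Longrightarrow> norm (f x) \<le> M" unfolding bounded_iff by blast
  then show ?thesis using that[of "max 0 M"] by fastforce
qed

lemma absolutely_integrable_inner_continuous:
  fixes h \<phi> :: "real \<Rightarrow> complex"
  assumes "h absolutely_integrable_on {a..b}" "continuous_on {a..b} \<phi>"
  shows "(\<lambda>x. h x \<bullet> \<phi> x) absolutely_integrable_on {a..b}"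
proof -
  have "(\<lambda>x. \<phi> x \<bullet> h x) absolutely_integrable_on {a..b}"
  proof (rule absolutely_integrable_bounded_measurable_product[of "(\<bullet>)" \<phi>])
    show "bilinear ((\<bullet>) :: complex \<Rightarrow> complex \<Rightarrow> real)"
      by (simp add: bilinear_conv_bounded_bilinear bounded_bilinear_inner)
    show "\<phi> \<in> borel_measurable (lebesgue_on {a..b})"
      using assms by (intro continuous_imp_measurable_on_sets_lebesgue) auto
    show "bounded (\<phi> ` {a..b})"
      by (intro compact_imp_bounded compact_continuous_image assms compact_Icc)
  qed (use assms in auto)
  then show ?thesis by (simp add: inner_commute)
qed

lemma C1_deriv_continuous: "C1_deriv l f g \<Longrightarrow> continuous_on {0..l} f" "C1_deriv l f g \<Longrightarrow> continuous_on {0..l} g"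
  unfolding C1_deriv_def by (blast intro: continuous_on_vector_derivative)+

lemma H2_derivs_C1: "H2_derivs l f g h \<Longrightarrow> C1_deriv l f g"
proof -
  assume A: "H2_derivs l f g h"
  then have "h integrable_on {0..l}"
    unfolding H2_derivs_def using L2_on_absolutely_integrable set_lebesgue_integral_eq_integral(1) by blast
  then have "continuous_on {0..l} (\<lambda>x. g 0 + integral {0..x} h)"
    by (intro continuous_intros indefinite_integral_continuous_1)
  moreover have "g 0 + integral {0..x} h = g x" if "x \<in> {0..l}" for x
    using A that unfolding H2_derivs_def by metis
  ultimately have "continuous_on {0..l} g" by (rule continuous_on_eq)
  then show ?thesis using A unfolding C1_deriv_def H2_derivs_def by blast
qed

lemma C1_deriv_increment:
  assumes "C1_deriv l f g" "0 \<le> x" "x \<le> y" "y \<le> l"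
  shows "(g has_integral (f y - f x)) {x..y}"
proof (rule fundamental_theorem_of_calculus[OF assms(3)])
  fix s assume "s \<in> {x..y}"
  then have "(f has_vector_derivative g s) (at s within {0..l})"
    using assms unfolding C1_deriv_def by auto
  then show "(f has_vector_derivative g s) (at s within {x..y})"
    by (rule has_vector_derivative_within_subset) (use assms in auto)
qed

text \<open>
  Here \<open>g\<close> is only absolutely continuous, so the product rule holds only almost everywhere and
  the fundamental theorem does not apply to it. Instead let \<open>\<Phi> x\<close> be the difference of the two sides on
  \<open>[0,x]\<close>. Then \<open>\<Phi> y - \<Phi> x\<close> is at most a constant times \<open>y - x\<close> times \<open>\<integral> |h|\<close> over \<open>[x,y]\<close>, and the last
  factor tends to 0 as \<open>y\<close> tends to \<open>x\<close>; so \<open>\<Phi>\<close> has derivative 0 everywhere and is constant.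
\<close>

lemma integration_by_parts_absolutely_continuous:
  assumes l: "0 < l" and h: "h absolutely_integrable_on {0..l}"
    and g: "\<And>x. x \<in> {0..l} \<Longrightarrow> g x = g 0 + integral {0..x} h"
    and \<phi>: "C1_deriv l \<phi> \<phi>'"
  shows "integral {0..l} (\<lambda>x. h x \<bullet> \<phi> x) = g l \<bullet> \<phi> l - g 0 \<bullet> \<phi> 0 - integral {0..l} (\<lambda>x. g x \<bullet> \<phi>' x)"
proof -
  have \<phi>c: "continuous_on {0..l} \<phi>" "continuous_on {0..l} \<phi>'" using C1_deriv_continuous[OF \<phi>] by auto
  have hI: "h integrable_on {0..l}" and hN: "(\<lambda>x. norm (h x)) integrable_on {0..l}"
    using h unfolding absolutely_integrable_on_def by auto
  have h\<phi>: "(\<lambda>x. h x \<bullet> \<phi> x) integrable_on {0..l}"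
    using absolutely_integrable_inner_continuous[OF h \<phi>c(1)] set_lebesgue_integral_eq_integral(1) by blast
  have gc: "continuous_on {0..l} g"
    by (rule continuous_on_eq[of _ "\<lambda>x. g 0 + integral {0..x} h"])
       (intro continuous_intros indefinite_integral_continuous_1 hI, metis g)
  have g\<phi>: "(\<lambda>x. g x \<bullet> \<phi>' x) integrable_on {0..l}"
    by (intro integrable_continuous_real continuous_intros gc \<phi>c)
  obtain M where M: "M \<ge> 0" "\<And>x. x \<in> {0..l} \<Longrightarrow> norm (\<phi>' x) \<le> M"
    using continuous_on_norm_le[OF \<phi>c(2)] by blast
  define N where "N = (\<lambda>x. integral {0..x} (\<lambda>s. norm (h s)))"
  define \<Phi> where "\<Phi> = (\<lambda>x. integral {0..x} (\<lambda>s. h s \<bullet> \<phi> s) + integral {0..x} (\<lambda>s. g s \<bullet> \<phi>' s) - g x \<bullet> \<phi> x)"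
  have Nc: "continuous_on {0..l} N" unfolding N_def by (rule indefinite_integral_continuous_1[OF hN])
  have split: "integral {0..y} k = integral {0..x} k + integral {x..y} k"
    if "k integrable_on {0..l}" "0 \<le> x" "x \<le> y" "y \<le> l" for x y and k :: "real \<Rightarrow> 'b::banach"
    using Henstock_Kurzweil_Integration.integral_combine[of 0 x y k] integrable_subinterval_real[OF that(1), of 0 y] that
    by simp
  have sub: "k integrable_on {x..y}" if "k integrable_on {0..l}" "0 \<le> x" "y \<le> l" for x y and k :: "real \<Rightarrow> 'b::banach"
    using integrable_subinterval_real[OF that(1), of x y] that by simp
  \<comment> \<open>\<open>\<Phi> y - \<Phi> x\<close> is the integral over \<open>[x,y]\<close> of \<open>h s \<bullet> (\<phi> s - \<phi> y) + (g s - g x) \<bullet> \<phi>' s\<close>\<close>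
  have est: "\<bar>\<Phi> y - \<Phi> x\<bar> \<le> 2 * M * (y - x) * (N y - N x)" if xy: "0 \<le> x" "x \<le> y" "y \<le> l" for x y
  proof -
    have d: "N y - N x = integral {x..y} (\<lambda>s. norm (h s))" unfolding N_def using split[OF hN xy] by simp
    have dg: "g y - g x = integral {x..y} h" using g[of x] g[of y] split[OF hI xy] xy by simp
    have i1: "(\<lambda>s. h s \<bullet> (\<phi> s - \<phi> y)) integrable_on {x..y}"
      and v1: "integral {x..y} (\<lambda>s. h s \<bullet> (\<phi> s - \<phi> y)) = integral {x..y} (\<lambda>s. h s \<bullet> \<phi> s) - (g y - g x) \<bullet> \<phi> y"
    proof -
      have "((\<lambda>s. h s \<bullet> \<phi> y) has_integral (integral {x..y} h \<bullet> \<phi> y)) {x..y}"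
        using has_integral_linear[OF integrable_integral[OF sub[OF hI xy(1,3)]] bounded_linear_inner_left[of "\<phi> y"]]
        by (simp add: o_def)
      from has_integral_diff[OF integrable_integral[OF sub[OF h\<phi> xy(1,3)]] this]
      have *: "((\<lambda>s. h s \<bullet> (\<phi> s - \<phi> y)) has_integral (integral {x..y} (\<lambda>s. h s \<bullet> \<phi> s) - (g y - g x) \<bullet> \<phi> y)) {x..y}"
        by (simp add: inner_diff_right dg)
      then show "(\<lambda>s. h s \<bullet> (\<phi> s - \<phi> y)) integrable_on {x..y}" by blast
      from * show "integral {x..y} (\<lambda>s. h s \<bullet> (\<phi> s - \<phi> y)) = integral {x..y} (\<lambda>s. h s \<bullet> \<phi> s) - (g y - g x) \<bullet> \<phi> y"
        by (rule integral_unique)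
    qed
    have i2: "(\<lambda>s. (g s - g x) \<bullet> \<phi>' s) integrable_on {x..y}"
      and v2: "integral {x..y} (\<lambda>s. (g s - g x) \<bullet> \<phi>' s) = integral {x..y} (\<lambda>s. g s \<bullet> \<phi>' s) - g x \<bullet> (\<phi> y - \<phi> x)"
    proof -
      have "((\<lambda>s. g x \<bullet> \<phi>' s) has_integral (g x \<bullet> (\<phi> y - \<phi> x))) {x..y}"
        using has_integral_linear[OF C1_deriv_increment[OF \<phi> xy] bounded_linear_inner_right[of "g x"]]
        by (simp add: o_def)
      from has_integral_diff[OF integrable_integral[OF sub[OF g\<phi> xy(1,3)]] this]
      have *: "((\<lambda>s. (g s - g x) \<bullet> \<phi>' s) has_integral (integral {x..y} (\<lambda>s. g s \<bullet> \<phi>' s) - g x \<bullet> (\<phi> y - \<phi> x))) {x..y}"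
        by (simp add: inner_diff_left)
      then show "(\<lambda>s. (g s - g x) \<bullet> \<phi>' s) integrable_on {x..y}" by blast
      from * show "integral {x..y} (\<lambda>s. (g s - g x) \<bullet> \<phi>' s) = integral {x..y} (\<lambda>s. g s \<bullet> \<phi>' s) - g x \<bullet> (\<phi> y - \<phi> x)"
        by (rule integral_unique)
    qed
    have "\<Phi> y - \<Phi> x = integral {x..y} (\<lambda>s. h s \<bullet> (\<phi> s - \<phi> y)) + integral {x..y} (\<lambda>s. (g s - g x) \<bullet> \<phi>' s)"
      unfolding \<Phi>_def v1 v2 using split[OF h\<phi> xy] split[OF g\<phi> xy]
      by (simp add: inner_diff_left inner_diff_right algebra_simps)
    moreover have "\<bar>integral {x..y} (\<lambda>s. h s \<bullet> (\<phi> s - \<phi> y))\<bar> \<le> M * (y - x) * (N y - N x)"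
    proof -
      have "norm (integral {x..y} (\<lambda>s. h s \<bullet> (\<phi> s - \<phi> y))) \<le> integral {x..y} (\<lambda>s. (M * (y - x)) * norm (h s))"
      proof (rule integral_norm_bound_integral[OF i1])
        show "(\<lambda>s. (M * (y - x)) * norm (h s)) integrable_on {x..y}"
          by (rule integrable_on_mult_right, rule sub[OF hN xy(1,3)])
        fix s assume s: "s \<in> {x..y}"
        have "norm (\<phi> y - \<phi> s) \<le> M * (y - s)"
        proof -
          have s': "0 \<le> s" "s \<le> y" using s xy by auto
          have "norm (\<phi> y - \<phi> s) \<le> M * measure lborel {s..y}"
            using has_integral_bound_real[OF M(1) finite.emptyI C1_deriv_increment[OF \<phi> s' xy(3)]] M(2) s xy by auto
          then show ?thesis using s by simp
        qed
        also have "\<dots> \<le> M * (y - x)" using s M by (intro mult_left_mono) auto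
        finally have "norm (\<phi> s - \<phi> y) \<le> M * (y - x)" by (simp add: norm_minus_commute)
        then have "norm (h s) * norm (\<phi> s - \<phi> y) \<le> norm (h s) * (M * (y - x))"
          by (intro mult_left_mono) auto
        then show "norm (h s \<bullet> (\<phi> s - \<phi> y)) \<le> (M * (y - x)) * norm (h s)"
          using Cauchy_Schwarz_ineq2[of "h s" "\<phi> s - \<phi> y"] by (simp add: mult.commute)
      qed
      then show ?thesis by (simp add: d)
    qed
    moreover have "\<bar>integral {x..y} (\<lambda>s. (g s - g x) \<bullet> \<phi>' s)\<bar> \<le> M * (y - x) * (N y - N x)"
    proof -
      have "norm (integral {x..y} (\<lambda>s. (g s - g x) \<bullet> \<phi>' s)) \<le> integral {x..y} (\<lambda>s. M * (N y - N x))"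
      proof (rule integral_norm_bound_integral[OF i2])
        fix s assume s: "s \<in> {x..y}"
        have s': "0 \<le> x" "x \<le> s" "s \<le> l" using s xy by auto
        have "g s - g x = integral {x..s} h" using g[of x] g[of s] split[OF hI s'] s' by simp
        also have "norm \<dots> \<le> integral {x..s} (\<lambda>s. norm (h s))"
          by (rule integral_norm_bound_integral[OF sub[OF hI s'(1,3)] sub[OF hN s'(1,3)]]) simp
        also have "\<dots> \<le> integral {x..y} (\<lambda>s. norm (h s))"
          using s by (intro integral_subset_le sub[OF hN s'(1,3)] sub[OF hN xy(1,3)]) auto
        finally have "norm (g s - g x) \<le> N y - N x" by (simp add: d)
        then have "norm (g s - g x) * norm (\<phi>' s) \<le> (N y - N x) * M"
          using M(2)[of s] s xy order_trans[OF norm_ge_zero \<open>norm (g s - g x) \<le> N y - N x\<close>]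
          by (intro mult_mono) auto
        then show "norm ((g s - g x) \<bullet> \<phi>' s) \<le> M * (N y - N x)"
          using Cauchy_Schwarz_ineq2[of "g s - g x" "\<phi>' s"] by (simp add: mult.commute)
      qed auto
      also have "\<dots> = M * (y - x) * (N y - N x)" using xy by simp
      finally show ?thesis by simp
    qed
    ultimately show ?thesis by linarith
  qed
  have "(\<Phi> has_derivative (\<lambda>_. 0)) (at x within {0..l})" if x: "x \<in> {0..l}" for x
    unfolding has_derivative_within_alt
  proof (intro conjI allI impI bounded_linear_zero)
    fix e :: real assume e: "0 < e"
    then have "e / (2 * M + 1) > 0" using M by simp
    then obtain \<delta> where \<delta>: "\<delta> > 0" "\<And>y. y \<in> {0..l} \<Longrightarrow> dist y x < \<delta> \<Longrightarrow> dist (N y) (N x) < e / (2 * M + 1)"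
      using Nc x unfolding continuous_on_iff by metis
    have "norm (\<Phi> y - \<Phi> x - 0) \<le> e * norm (y - x)" if y: "y \<in> {0..l}" "norm (y - x) < \<delta>" for y
    proof -
      have "\<bar>N y - N x\<bar> \<le> e / (2 * M + 1)" using \<delta>(2)[of y] y by (simp add: dist_norm)
      then have "(2 * M) * \<bar>N y - N x\<bar> \<le> (2 * M + 1) * (e / (2 * M + 1))"
        using M e by (intro mult_mono) auto
      also have "\<dots> = e" using M by simp
      finally have "2 * M * \<bar>N y - N x\<bar> * \<bar>y - x\<bar> \<le> e * \<bar>y - x\<bar>" by (intro mult_right_mono) auto
      moreover have "\<bar>\<Phi> y - \<Phi> x\<bar> \<le> 2 * M * \<bar>N y - N x\<bar> * \<bar>y - x\<bar>"
      proof (cases "x \<le> y")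
        case True
        then have "2 * M * (y - x) * (N y - N x) \<le> 2 * M * \<bar>N y - N x\<bar> * \<bar>y - x\<bar>"
          using M by (simp add: mult.assoc mult_left_mono mult.commute mult_right_mono)
        then show ?thesis using est[of x y] True x y by simp
      next
        case False
        then have "2 * M * (x - y) * (N x - N y) \<le> 2 * M * \<bar>N y - N x\<bar> * \<bar>y - x\<bar>"
          using M by (simp add: mult.assoc mult_left_mono mult.commute mult_right_mono)
        then show ?thesis using est[of y x] False x y by (simp add: abs_minus_commute)
      qed
      ultimately show ?thesis by simp
    qed
    then show "\<exists>d>0. \<forall>y\<in>{0..l}. norm (y - x) < d \<longrightarrow> norm (\<Phi> y - \<Phi> x - 0) \<le> e * norm (y - x)"
      using \<delta>(1) by blast
  qed
  then have "\<Phi> l = \<Phi> 0"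
    using has_derivative_zero_constant[of "{0..l}" \<Phi>] l by (metis atLeastAtMost_iff convex_real_interval(5) less_imp_le order_refl)
  then show ?thesis unfolding \<Phi>_def by simp
qed

lemma C1_integrable_products:
  assumes "continuous_on {0..l} f" "continuous_on {0..l} (g :: real \<Rightarrow> complex)"
  shows "(\<lambda>x. f x \<bullet> g x) integrable_on {0..l}"
  by (intro integrable_continuous_real continuous_intros assms)

text \<open>
  Integrate the derivative of \<open>|f|\<^sup>2\<close> times a linear weight that is \<open>0\<close> at one end and \<open>\<plusminus>1\<close> at the other.
\<close>

lemma C1_trace_bound:
  assumes l: "0 < l" and f: "C1_deriv l f g" and e: "0 < e" and b: "b = 0 \<or> b = l"
  shows "(cmod (f b))\<^sup>2 \<le> (1 / l + 1 / e) * integral {0..l} (\<lambda>x. f x \<bullet> f x) + e * integral {0..l} (\<lambda>x. g x \<bullet> g x)"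
proof -
  \<comment> \<open>the weight \<open>(x - a) / l\<close> vanishes at the end \<open>a\<close> opposite to \<open>b\<close>\<close>
  define a where "a = l - b"
  have fc: "continuous_on {0..l} f" "continuous_on {0..l} g" using C1_deriv_continuous[OF f] by auto
  note I = C1_integrable_products[OF fc(1) fc(1)] C1_integrable_products[OF fc(2) fc(2)]
  have "((\<lambda>x. (1 / l) * (f x \<bullet> f x) + (x - a) / l * (2 * (f x \<bullet> g x))) has_integral
      ((l - a) / l * (f l \<bullet> f l) - (0 - a) / l * (f 0 \<bullet> f 0))) {0..l}"
  proof (rule fundamental_theorem_of_calculus)
    fix x assume "x \<in> {0..l}"
    then have "(f has_vector_derivative g x) (at x within {0..l})" using f unfolding C1_deriv_def by blast
    then have d: "(f has_derivative (\<lambda>h. h *\<^sub>R g x)) (at x within {0..l})" by (simp add: has_vector_derivative_def)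
    show "((\<lambda>x. (x - a) / l * (f x \<bullet> f x)) has_vector_derivative
        (1 / l) * (f x \<bullet> f x) + (x - a) / l * (2 * (f x \<bullet> g x))) (at x within {0..l})"
      unfolding has_vector_derivative_def using l
      by (auto intro!: derivative_eq_intros d simp: fun_eq_iff inner_commute algebra_simps divide_simps)
  qed (use l in simp)
  also have "(l - a) / l * (f l \<bullet> f l) - (0 - a) / l * (f 0 \<bullet> f 0) = (cmod (f b))\<^sup>2"
    using b l by (auto simp: a_def power2_norm_eq_inner)
  finally have *: "((\<lambda>x. (1 / l) * (f x \<bullet> f x) + (x - a) / l * (2 * (f x \<bullet> g x))) has_integral (cmod (f b))\<^sup>2) {0..l}" .
  have **: "((\<lambda>x. (1 / l + 1 / e) * (f x \<bullet> f x) + e * (g x \<bullet> g x)) has_integral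
     ((1 / l + 1 / e) * integral {0..l} (\<lambda>x. f x \<bullet> f x) + e * integral {0..l} (\<lambda>x. g x \<bullet> g x))) {0..l}"
    by (intro has_integral_add has_integral_mult_right integrable_integral I)
  show ?thesis
  proof (rule has_integral_le[OF * **])
    fix x assume x: "x \<in> {0..l}"
    have "\<bar>(x - a) / l\<bar> \<le> 1" using x b l by (auto simp: a_def)
    then have "\<bar>(x - a) / l * (2 * (f x \<bullet> g x))\<bar> \<le> 1 * \<bar>2 * (f x \<bullet> g x)\<bar>"
      unfolding abs_mult[of "(x - a) / l"] by (intro mult_right_mono) auto
    also have "\<dots> \<le> 2 * (norm (f x) * norm (g x))" using Cauchy_Schwarz_ineq2[of "f x" "g x"] by simp
    also have "\<dots> \<le> (1 / e) * (norm (f x))\<^sup>2 + e * (norm (g x))\<^sup>2"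
    proof -
      have "0 \<le> (norm (f x) - e * norm (g x))\<^sup>2 / e" using e by simp
      also have "\<dots> = (1 / e) * (norm (f x))\<^sup>2 + e * (norm (g x))\<^sup>2 - 2 * (norm (f x) * norm (g x))"
        using e by (simp add: power2_eq_square field_simps)
      finally show ?thesis by simp
    qed
    finally have "(x - a) / l * (2 * (f x \<bullet> g x)) \<le> (1 / e) * (f x \<bullet> f x) + e * (g x \<bullet> g x)"
      unfolding power2_norm_eq_inner by linarith
    then show "(1 / l) * (f x \<bullet> f x) + (x - a) / l * (2 * (f x \<bullet> g x)) \<le> (1 / l + 1 / e) * (f x \<bullet> f x) + e * (g x \<bullet> g x)"
      unfolding distrib_right by linarith
  qed
qed

text \<open>
  With \<open>m\<close> the mean of \<open>g\<close> over \<open>[x,y]\<close>, this is \<open>\<integral> |g - m|\<^sup>2 \<ge> 0\<close>.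
\<close>

lemma C1_Hoelder:
  assumes f: "C1_deriv l f g" and xy: "0 \<le> x" "x \<le> y" "y \<le> l"
  shows "(cmod (f y - f x))\<^sup>2 \<le> (y - x) * integral {0..l} (\<lambda>x. g x \<bullet> g x)"
proof (cases "x = y")
  case False
  then have d: "y - x > 0" using xy by simp
  have gc: "continuous_on {0..l} g" using C1_deriv_continuous[OF f] by auto
  then have gc': "continuous_on {x..y} g" by (rule continuous_on_subset) (use xy in auto)
  define m where "m = (1 / (y - x)) *\<^sub>R (f y - f x)"
  have I: "(\<lambda>s. g s \<bullet> g s) integrable_on {x..y}" by (intro integrable_continuous_real continuous_intros gc')
  have "((\<lambda>s. g s \<bullet> g s - 2 * (m \<bullet> g s) + m \<bullet> m) has_integral
      (integral {x..y} (\<lambda>s. g s \<bullet> g s) - 2 * (m \<bullet> (f y - f x)) + (y - x) * (m \<bullet> m))) {x..y}"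
    using has_integral_linear[OF C1_deriv_increment[OF f xy] bounded_linear_inner_right[of m]]
      has_integral_const_real[of "m \<bullet> m" x y] d
    by (intro has_integral_add has_integral_diff has_integral_mult_right integrable_integral I) (auto simp: o_def)
  then have "0 \<le> integral {x..y} (\<lambda>s. g s \<bullet> g s) - 2 * (m \<bullet> (f y - f x)) + (y - x) * (m \<bullet> m)"
  proof (rule has_integral_nonneg)
    fix s
    have "0 \<le> (g s - m) \<bullet> (g s - m)" by simp
    then show "0 \<le> g s \<bullet> g s - 2 * (m \<bullet> g s) + m \<bullet> m"
      by (simp add: inner_diff_left inner_diff_right inner_commute)
  qed
  also have "\<dots> = integral {x..y} (\<lambda>s. g s \<bullet> g s) - (cmod (f y - f x))\<^sup>2 / (y - x)"
    using d by (simp add: m_def power2_norm_eq_inner divide_simps)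
  finally have "(cmod (f y - f x))\<^sup>2 \<le> (y - x) * integral {x..y} (\<lambda>s. g s \<bullet> g s)"
    using d by (simp add: field_simps)
  also have "\<dots> \<le> (y - x) * integral {0..l} (\<lambda>s. g s \<bullet> g s)"
    using d xy I C1_integrable_products[OF gc gc] by (intro mult_left_mono integral_subset_le) auto
  finally show ?thesis .
qed simp

section \<open>Second order equations with a bounded measurable coefficient\<close>

lemma AE_lebesgue_on_integral_cong:
  fixes f g :: "real \<Rightarrow> 'b::euclidean_space"
  assumes "AE x in lebesgue_on {0..l}. f x = g x" "y \<le> l"
  shows "integral {0..y} f = integral {0..y} g"
proof -
  have "AE x in lebesgue. x \<in> {0..l} \<longrightarrow> f x = g x"
    using assms by (simp add: AE_restrict_space_iff)
  then obtain N where "negligible N" "{x. \<not> (x \<in> {0..l} \<longrightarrow> f x = g x)} \<subseteq> N"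
    unfolding eventually_ae_filter_negligible by blast
  then show ?thesis using assms(2) by (intro integral_spike[of N]) auto
qed

lemma L2_on_integrable: "L2_on {a..b} h \<Longrightarrow> h integrable_on {a..b}"
  using L2_on_absolutely_integrable set_lebesgue_integral_eq_integral(1) by blast

lemma L2_on_bounded:
  assumes "h \<in> borel_measurable (lebesgue_on {a..b})" "\<And>x. x \<in> {a..b} \<Longrightarrow> cmod (h x) \<le> B"
  shows "L2_on {a..b} h"
proof -
  interpret finite_measure "lebesgue_on {a..b}" by (rule finite_measure_lebesgue_on) auto
  have "integrable (lebesgue_on {a..b}) (\<lambda>x. (cmod (h x))\<^sup>2)"
  proof (rule integrable_const_bound[of _ "B\<^sup>2"])
    show "AE x in lebesgue_on {a..b}. norm ((cmod (h x))\<^sup>2) \<le> B\<^sup>2"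
      using assms(2) by (intro AE_I2) (simp add: power_mono)
    show "(\<lambda>x. (cmod (h x))\<^sup>2) \<in> borel_measurable (lebesgue_on {a..b})"
      using assms(1) by measurable
  qed
  then show ?thesis using assms(1) by (simp add: L2_on_def)
qed

lemma L2_on_potential_times_continuous:
  assumes p: "p \<in> borel_measurable (lebesgue_on {0..l})" "\<And>x. x \<in> {0..l} \<Longrightarrow> \<bar>p x\<bar> \<le> C"
    and u: "continuous_on {0..l} u" and w: "continuous_on {0..l} w"
  shows "L2_on {0..l} (\<lambda>x. of_real (p x) * u x - w x)"
proof -
  obtain M where M: "M \<ge> 0" "\<And>x. x \<in> {0..l} \<Longrightarrow> norm (u x) \<le> M" using continuous_on_norm_le[OF u] by blast
  obtain N where N: "N \<ge> 0" "\<And>x. x \<in> {0..l} \<Longrightarrow> norm (w x) \<le> N" using continuous_on_norm_le[OF w] by blast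
  have [measurable]: "u \<in> borel_measurable (lebesgue_on {0..l})" "w \<in> borel_measurable (lebesgue_on {0..l})"
    using u w by (auto intro: continuous_imp_measurable_on_sets_lebesgue)
  have "cmod (of_real (p x) * u x - w x) \<le> C * M + N" if x: "x \<in> {0..l}" for x
  proof -
    have "cmod (of_real (p x) * u x - w x) \<le> \<bar>p x\<bar> * cmod (u x) + cmod (w x)"
      using norm_triangle_ineq4[of "of_real (p x) * u x" "w x"] by (simp add: norm_mult)
    also have "\<dots> \<le> C * M + N"
      using p(2)[OF x] M N x by (intro add_mono mult_mono) auto
    finally show ?thesis .
  qed
  moreover have "(\<lambda>x. of_real (p x) * u x - w x) \<in> borel_measurable (lebesgue_on {0..l})"
    using p(1) by measurable
  ultimately show ?thesis by (rule L2_on_bounded[rotated])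
qed

text \<open>
  In the norm \<open>sup |k t| exp (- \<kappa> t)\<close> integration from 0 has norm at most \<open>1/\<kappa>\<close>. With a large \<open>\<kappa>\<close>, the
  integral equations below become contractions on the whole interval.
\<close>

lemma exp_weighted_integral_bound:
  fixes k :: "real \<Rightarrow> complex"
  assumes "0 \<le> s" "\<kappa> > 0" "A \<ge> 0" "k integrable_on {0..s}" "\<And>t. t \<in> {0..s} \<Longrightarrow> cmod (k t) \<le> A * exp (\<kappa> * t)"
  shows "cmod (integral {0..s} k) \<le> A / \<kappa> * exp (\<kappa> * s)"
proof -
  have "((\<lambda>t. A * exp (\<kappa> * t)) has_integral (A / \<kappa> * exp (\<kappa> * s) - A / \<kappa> * exp (\<kappa> * 0))) {0..s}"
    by (rule fundamental_theorem_of_calculus)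
       (use assms in \<open>auto intro!: derivative_eq_intros simp flip: has_real_derivative_iff_has_vector_derivative\<close>)
  then have i: "(\<lambda>t. A * exp (\<kappa> * t)) integrable_on {0..s}"
    and v: "integral {0..s} (\<lambda>t. A * exp (\<kappa> * t)) = A / \<kappa> * exp (\<kappa> * s) - A / \<kappa> * exp (\<kappa> * 0)"
    by (auto simp: has_integral_iff)
  have "cmod (integral {0..s} k) \<le> integral {0..s} (\<lambda>t. A * exp (\<kappa> * t))"
    by (rule integral_norm_bound_integral[OF assms(4) i assms(5)])
  also have "\<dots> \<le> A / \<kappa> * exp (\<kappa> * s)" unfolding v using assms by simp
  finally show ?thesis .
qed

text \<open>
  If \<open>M\<close> is the maximum of \<open>|u| exp (- \<kappa> x)\<close>, two integrations of \<open>u'' = p u\<close> give \<open>M \<le> C M / \<kappa>\<^sup>2 \<le> M/2\<close>.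
\<close>

lemma ODE_zero_unique:
  assumes l: "0 < l" and C: "C \<ge> 0" "\<And>x. x \<in> {0..l} \<Longrightarrow> \<bar>p x\<bar> \<le> C"
    and p: "p \<in> borel_measurable (lebesgue_on {0..l})"
    and u: "H2_derivs l u g h" "u 0 = 0" "g 0 = 0"
    and h: "AE x in lebesgue_on {0..l}. h x = of_real (p x) * u x"
    and x: "x \<in> {0..l}"
  shows "u x = 0"
proof -
  define \<kappa> where "\<kappa> = 2 * C + 1"
  have \<kappa>: "\<kappa> \<ge> 1" "C \<le> \<kappa> / 2" using C(1) by (auto simp: \<kappa>_def)
  have c1: "C1_deriv l u g" using H2_derivs_C1[OF u(1)] .
  have uc: "continuous_on {0..l} u" and gc: "continuous_on {0..l} g" using C1_deriv_continuous[OF c1] by auto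
  have "continuous_on {0..l} (\<lambda>x. exp (- \<kappa> * x) * cmod (u x))" by (intro continuous_intros uc)
  then obtain z where z: "z \<in> {0..l}" "\<And>y. y \<in> {0..l} \<Longrightarrow> exp (- \<kappa> * y) * cmod (u y) \<le> exp (- \<kappa> * z) * cmod (u z)"
    using continuous_attains_sup[OF compact_Icc, of 0 l] l by force
  define M where "M = exp (- \<kappa> * z) * cmod (u z)"
  have uM: "cmod (u y) \<le> M * exp (\<kappa> * y)" if y: "y \<in> {0..l}" for y
    using z(2)[OF y] unfolding M_def[symmetric] by (simp add: exp_minus field_simps)
  have M0: "M \<ge> 0" by (simp add: M_def)
  have I: "(\<lambda>x. of_real (p x) * u x) integrable_on {0..l}"
    using L2_on_integrable[OF L2_on_potential_times_continuous[OF p C(2) uc continuous_on_const[of _ 0]]]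
    by simp
  have gM: "cmod (g s) \<le> (C * M / \<kappa>) * exp (\<kappa> * s)" if s: "s \<in> {0..l}" for s
  proof -
    have "g s = g 0 + integral {0..s} h" using u(1) s unfolding H2_derivs_def by blast
    then have "g s = integral {0..s} (\<lambda>x. of_real (p x) * u x)"
      using AE_lebesgue_on_integral_cong[OF h, of s] s u(3) by simp
    also have "cmod \<dots> \<le> (C * M / \<kappa>) * exp (\<kappa> * s)"
    proof (rule exp_weighted_integral_bound)
      show "(\<lambda>x. of_real (p x) * u x) integrable_on {0..s}"
        using integrable_subinterval_real[OF I] s by simp
      fix t assume t: "t \<in> {0..s}"
      then have "\<bar>p t\<bar> * cmod (u t) \<le> C * (M * exp (\<kappa> * t))"
        using uM[of t] C s by (intro mult_mono) auto
      then show "cmod (of_real (p t) * u t) \<le> C * M * exp (\<kappa> * t)" by (simp add: norm_mult mult.assoc)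
    qed (use \<kappa> C M0 s in auto)
    finally show ?thesis .
  qed
  have "u z = u z - u 0" using u(2) by simp
  also have "\<dots> = integral {0..z} g"
    using C1_deriv_increment[OF c1, of 0 z] z(1) by (auto simp: has_integral_iff)
  also have "cmod \<dots> \<le> (C * M / \<kappa>) / \<kappa> * exp (\<kappa> * z)"
  proof (rule exp_weighted_integral_bound)
    show "g integrable_on {0..z}"
      using integrable_subinterval_real[OF integrable_continuous_real[OF gc]] z by simp
    show "cmod (g t) \<le> C * M / \<kappa> * exp (\<kappa> * t)" if "t \<in> {0..z}" for t using gM[of t] that z by simp
  qed (use \<kappa> C M0 z in auto)
  finally have "M * exp (\<kappa> * z) \<le> (C * M / \<kappa>) / \<kappa> * exp (\<kappa> * z)"
    unfolding M_def by (simp add: exp_minus field_simps)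
  then have "M \<le> (C * M / \<kappa>) / \<kappa>" by (rule mult_right_le_imp_le) simp
  also have "\<dots> \<le> M / 2"
  proof -
    have "(C * M / \<kappa>) / \<kappa> \<le> (C * M / \<kappa>) / 1"
      using \<kappa> C M0 by (intro divide_left_mono) auto
    also have "\<dots> \<le> M / 2" using mult_right_mono[OF \<kappa>(2) M0] \<kappa>(1) by (simp add: field_simps)
    finally show ?thesis .
  qed
  finally have "M = 0" using M0 by simp
  then show ?thesis using uM[OF x] by simp
qed

text \<open>
  Integrating \<open>u'' = p u - w\<close> twice gives a fixed point equation. The unknown of the fixed point
  theorem is \<open>v t = exp (- \<kappa> t) u t\<close>, which makes the map a contraction in the supremum norm. To work
  in the complete space of bounded continuous functions on the real line, functions on
  \<open>[0,l]\<close> are extended by precomposition with the retraction \<open>c\<close>.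
\<close>

lemma ODE_exists:
  fixes p :: "real \<Rightarrow> real" and w :: "real \<Rightarrow> complex" and a b :: complex
  assumes l: "0 < l" and C: "C \<ge> 0" "\<And>x. x \<in> {0..l} \<Longrightarrow> \<bar>p x\<bar> \<le> C"
    and p: "p \<in> borel_measurable (lebesgue_on {0..l})" and w: "continuous_on {0..l} w"
  shows "\<exists>u g. H2_derivs l u g (\<lambda>x. of_real (p x) * u x - w x) \<and> u 0 = a \<and> g 0 = b"
proof -
  define \<kappa> where "\<kappa> = 2 * C + 1"
  have \<kappa>: "\<kappa> \<ge> 1" "C \<le> \<kappa> / 2" using C(1) by (auto simp: \<kappa>_def)
  define U where "U = (\<lambda>(v :: real \<Rightarrow>\<^sub>C complex) t. of_real (exp (\<kappa> * t)) * apply_bcontfun v t)"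
  define G where "G = (\<lambda>v t. of_real (p t) * U v t - w t)"
  define S where "S = (\<lambda>v s. b + integral {0..s} (G v))"
  define F where "F = (\<lambda>v x. a + integral {0..x} (S v))"
  define c where "c = (\<lambda>x::real. max 0 (min l x))"
  define T where "T = (\<lambda>v. Bcontfun (\<lambda>x. of_real (exp (- \<kappa> * c x)) * F v (c x)))"
  have c: "c x \<in> {0..l}" "x \<in> {0..l} \<Longrightarrow> c x = x" for x using l by (auto simp: c_def)
  have Uc: "continuous_on A (U v)" for v A unfolding U_def by (intro continuous_intros) auto
  have GL2: "L2_on {0..l} (G v)" for v
    unfolding G_def by (rule L2_on_potential_times_continuous[OF p C(2) Uc w])
  then have GI: "G v integrable_on {0..l}" for v
    using L2_on_integrable by blast
  have Sc: "continuous_on {0..l} (S v)" for v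
    unfolding S_def by (intro continuous_intros indefinite_integral_continuous_1 GI)
  have Fc: "continuous_on {0..l} (F v)" for v
    unfolding F_def by (intro continuous_intros indefinite_integral_continuous_1 integrable_continuous_real Sc)
  have T: "apply_bcontfun (T v) = (\<lambda>x. of_real (exp (- \<kappa> * c x)) * F v (c x))" for v
    unfolding T_def
  proof (rule Bcontfun_inverse)
    have E: "continuous_on {0..l} (\<lambda>y. of_real (exp (- \<kappa> * y)) * F v y)"
      by (intro continuous_intros Fc)
    obtain M where M: "\<And>y. y \<in> {0..l} \<Longrightarrow> norm (of_real (exp (- \<kappa> * y)) * F v y) \<le> M"
      using continuous_on_norm_le[OF E] by blast
    have "continuous_on UNIV c" unfolding c_def by (intro continuous_intros)
    then show "(\<lambda>x. of_real (exp (- \<kappa> * c x)) * F v (c x)) \<in> bcontfun"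
      using c M by (intro bcontfun_normI continuous_on_compose2[OF E]) auto
  qed
  have "dist (T v1) (T v2) \<le> (1/2) * dist v1 v2" for v1 v2
  proof (rule dist_bound)
    fix x
    define D where "D = dist v1 v2"
    have D0: "D \<ge> 0" by (simp add: D_def)
    define y where "y = c x"
    have y: "y \<in> {0..l}" using c y_def by simp
    have Sdiff: "cmod (S v1 s - S v2 s) \<le> (C * D / \<kappa>) * exp (\<kappa> * s)" if s: "s \<in> {0..l}" for s
    proof -
      have I: "G v integrable_on {0..s}" for v using integrable_subinterval_real[OF GI] s by simp
      have "S v1 s - S v2 s = integral {0..s} (\<lambda>t. G v1 t - G v2 t)"
        unfolding S_def by (simp add: Henstock_Kurzweil_Integration.integral_diff[OF I I])
      also have "cmod \<dots> \<le> (C * D / \<kappa>) * exp (\<kappa> * s)"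
      proof (rule exp_weighted_integral_bound)
        show "(\<lambda>t. G v1 t - G v2 t) integrable_on {0..s}" by (intro integrable_diff I)
        fix t assume t: "t \<in> {0..s}"
        have "G v1 t - G v2 t = of_real (p t) * (of_real (exp (\<kappa> * t)) * (apply_bcontfun v1 t - apply_bcontfun v2 t))"
          by (simp add: G_def U_def algebra_simps)
        also have "cmod \<dots> = \<bar>p t\<bar> * (exp (\<kappa> * t) * dist (apply_bcontfun v1 t) (apply_bcontfun v2 t))"
          by (simp add: norm_mult dist_norm)
        also have "\<dots> \<le> C * (exp (\<kappa> * t) * D)"
          unfolding D_def using C s t by (intro mult_mono dist_bounded mult_nonneg_nonneg) auto
        finally show "cmod (G v1 t - G v2 t) \<le> C * D * exp (\<kappa> * t)" by (simp add: mult_ac)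
      qed (use \<kappa> C D0 s in auto)
      finally show ?thesis .
    qed
    have SI: "S v integrable_on {0..y}" for v
      using integrable_subinterval_real[OF integrable_continuous_real[OF Sc]] y by simp
    have "F v1 y - F v2 y = integral {0..y} (\<lambda>t. S v1 t - S v2 t)"
      unfolding F_def by (simp add: Henstock_Kurzweil_Integration.integral_diff[OF SI SI])
    also have "cmod \<dots> \<le> (C * D / \<kappa>) / \<kappa> * exp (\<kappa> * y)"
      by (rule exp_weighted_integral_bound) (use \<kappa> C D0 y Sdiff SI in \<open>auto intro!: integrable_diff\<close>)
    also have "\<dots> \<le> (1/2 * D) * exp (\<kappa> * y)"
    proof (rule mult_right_mono)
      have "(C * D / \<kappa>) / \<kappa> \<le> (C * D / \<kappa>) / 1"
        using \<kappa> C D0 by (intro divide_left_mono) auto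
      also have "\<dots> \<le> 1/2 * D" using mult_right_mono[OF \<kappa>(2) D0] \<kappa>(1) by (simp add: field_simps)
      finally show "(C * D / \<kappa>) / \<kappa> \<le> 1/2 * D" .
    qed simp
    finally have "exp (- \<kappa> * y) * cmod (F v1 y - F v2 y) \<le> exp (- \<kappa> * y) * ((1/2 * D) * exp (\<kappa> * y))"
      by (intro mult_left_mono) auto
    also have "\<dots> = 1/2 * D" by (simp add: exp_minus field_simps)
    finally have le: "exp (- \<kappa> * y) * cmod (F v1 y - F v2 y) \<le> 1/2 * D" .
    have "dist (apply_bcontfun (T v1) x) (apply_bcontfun (T v2) x) = cmod (of_real (exp (- \<kappa> * y)) * (F v1 y - F v2 y))"
      unfolding T y_def[symmetric] by (simp add: dist_norm algebra_simps)
    also have "\<dots> = exp (- \<kappa> * y) * cmod (F v1 y - F v2 y)"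
      by (simp add: norm_mult)
    finally show "dist (apply_bcontfun (T v1) x) (apply_bcontfun (T v2) x) \<le> 1/2 * dist v1 v2"
      using le unfolding D_def by simp
  qed
  then have "\<exists>!v. T v = v" by (intro banach_fix_type[of "1/2"]) auto
  then obtain v where v: "T v = v" by blast
  have FU: "F v x = U v x" if x: "x \<in> {0..l}" for x
  proof -
    have "apply_bcontfun v x = of_real (exp (- \<kappa> * x)) * F v x"
      using fun_cong[OF T[of v], of x] v c(2)[OF x] by simp
    then have "U v x = of_real (exp (\<kappa> * x) * exp (- \<kappa> * x)) * F v x"
      unfolding U_def by (simp only: of_real_mult mult.assoc)
    then show ?thesis by (simp flip: exp_add)
  qed
  have "H2_derivs l (F v) (S v) (G v)"
    unfolding H2_derivs_def
  proof (intro conjI ballI GL2)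
    fix x assume x: "x \<in> {0..l}"
    show "(F v has_vector_derivative S v x) (at x within {0..l})"
      unfolding F_def using integral_has_vector_derivative[OF Sc x]
      by (auto intro!: derivative_eq_intros)
    show "S v x = S v 0 + integral {0..x} (G v)" by (simp add: S_def)
  qed
  moreover have "L2_on {0..l} (\<lambda>x. of_real (p x) * F v x - w x)"
    by (rule L2_on_potential_times_continuous[OF p C(2) Fc w])
  moreover have "integral {0..x} (G v) = integral {0..x} (\<lambda>x. of_real (p x) * F v x - w x)" if "x \<in> {0..l}" for x
    using FU that by (intro Henstock_Kurzweil_Integration.integral_cong) (simp add: G_def)
  ultimately have "H2_derivs l (F v) (S v) (\<lambda>x. of_real (p x) * F v x - w x)"
    unfolding H2_derivs_def by metis
  moreover have "F v 0 = a" "S v 0 = b" by (simp_all add: F_def S_def)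
  ultimately show ?thesis by blast
qed

section \<open>The energy form of a metric graph\<close>

lemma gscale_of_real: "gscale (of_real r) f = r *\<^sub>R f"
  by (simp add: gscale_def scaleR_fun_def scaleR_conv_of_real)

lemma scaleR_graph_fun_apply [simp]: "(r *\<^sub>R f) e x = r *\<^sub>R (f :: 'e graph_fun) e x"
  by (simp add: scaleR_fun_def)

lemma H2_derivsD:
  assumes "H2_derivs l f g h"
  shows "x \<in> {0..l} \<Longrightarrow> (f has_vector_derivative g x) (at x within {0..l})"
    and "L2_on {0..l} h"
    and "x \<in> {0..l} \<Longrightarrow> g x = g 0 + integral {0..x} h"
  using assms unfolding H2_derivs_def by blast+

lemma H2_derivs_add:
  assumes "H2_derivs l f g h" "H2_derivs l f' g' h'"
  shows "H2_derivs l (f + f') (\<lambda>x. g x + g' x) (\<lambda>x. h x + h' x)"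
proof -
  note I = L2_on_integrable[of 0 l h] L2_on_integrable[of 0 l h']
  have sub: "k integrable_on {0..x}" if "k integrable_on {0..l}" "x \<in> {0..l}" for x and k :: "real \<Rightarrow> complex"
    using integrable_subinterval_real[OF that(1), of 0 x] that(2) by simp
  have "L2_on {0..l} (\<lambda>x. h x + h' x)"
  proof -
    have m: "h \<in> borel_measurable (lebesgue_on {0..l})" "h' \<in> borel_measurable (lebesgue_on {0..l})"
      and i: "integrable (lebesgue_on {0..l}) (\<lambda>x. (cmod (h x))\<^sup>2)" "integrable (lebesgue_on {0..l}) (\<lambda>x. (cmod (h' x))\<^sup>2)"
      using assms[THEN H2_derivsD(2)] by (auto simp: L2_on_def)
    have "integrable (lebesgue_on {0..l}) (\<lambda>x. (cmod (h x + h' x))\<^sup>2)"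
    proof (rule Bochner_Integration.integrable_bound)
      show "integrable (lebesgue_on {0..l}) (\<lambda>x. 2 * (cmod (h x))\<^sup>2 + 2 * (cmod (h' x))\<^sup>2)"
        using i by simp
      show "(\<lambda>x. (cmod (h x + h' x))\<^sup>2) \<in> borel_measurable (lebesgue_on {0..l})"
        using m by measurable
      have "norm ((cmod (a + b))\<^sup>2) \<le> norm (2 * (cmod a)\<^sup>2 + 2 * (cmod b)\<^sup>2)" for a b :: complex
      proof -
        have "(cmod (a + b))\<^sup>2 \<le> (cmod a + cmod b)\<^sup>2" by (intro power_mono norm_triangle_ineq) simp
        also have "\<dots> \<le> 2 * (cmod a)\<^sup>2 + 2 * (cmod b)\<^sup>2"
          using zero_le_power2[of "cmod a - cmod b"] by (simp add: power2_sum power2_diff)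
        finally show ?thesis by simp
      qed
      then show "AE x in lebesgue_on {0..l}. norm ((cmod (h x + h' x))\<^sup>2) \<le> norm (2 * (cmod (h x))\<^sup>2 + 2 * (cmod (h' x))\<^sup>2)"
        by simp
    qed
    then show ?thesis using m by (simp add: L2_on_def)
  qed
  moreover have "g x + g' x = g 0 + g' 0 + integral {0..x} (\<lambda>x. h x + h' x)" if x: "x \<in> {0..l}" for x
  proof -
    have "g x = g 0 + integral {0..x} h" "g' x = g' 0 + integral {0..x} h'"
      using assms x unfolding H2_derivs_def by blast+
    moreover have "integral {0..x} (\<lambda>x. h x + h' x) = integral {0..x} h + integral {0..x} h'"
      by (rule Henstock_Kurzweil_Integration.integral_add[OF sub[OF I(1) x] sub[OF I(2) x]])
         (rule assms[THEN H2_derivsD(2)])+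
    ultimately show ?thesis by simp
  qed
  moreover have "((f + f') has_vector_derivative g x + g' x) (at x within {0..l})" if "x \<in> {0..l}" for x
    unfolding plus_fun_def by (intro has_vector_derivative_add assms[THEN H2_derivsD(1)] that)
  ultimately show ?thesis unfolding H2_derivs_def by blast
qed

lemma H2_derivs_scale:
  assumes "H2_derivs l f g h"
  shows "H2_derivs l (\<lambda>x. c * f x) (\<lambda>x. c * g x) (\<lambda>x. c * h x)"
proof -
  have "L2_on {0..l} (\<lambda>x. c * h x)"
    using H2_derivsD(2)[OF assms] by (auto simp: L2_on_def norm_mult power_mult_distrib)
  moreover have "c * g x = c * g 0 + integral {0..x} (\<lambda>x. c * h x)" if "x \<in> {0..l}" for x
  proof -
    have "c * g x = c * (g 0 + integral {0..x} h)" using H2_derivsD(3)[OF assms that] by (rule arg_cong)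
    then show ?thesis by (simp only: distrib_left integral_mult_right)
  qed
  moreover have "((\<lambda>x. c * f x) has_vector_derivative c * g x) (at x within {0..l})" if "x \<in> {0..l}" for x
    by (intro has_vector_derivative_mult_right H2_derivsD(1)[OF assms] that)
  ultimately show ?thesis unfolding H2_derivs_def by blast
qed

lemma H2_derivs_cong:
  assumes "H2_derivs l f g h" "0 \<le> l" "\<And>x. x \<in> {0..l} \<Longrightarrow> f x = f' x" "\<And>x. x \<in> {0..l} \<Longrightarrow> g x = g' x"
  shows "H2_derivs l f' g' h"
  unfolding H2_derivs_def
proof (intro conjI ballI)
  show "L2_on {0..l} h" using H2_derivsD(2)[OF assms(1)] .
  fix x assume x: "x \<in> {0..l}"
  have "(f has_vector_derivative g' x) (at x within {0..l})" using H2_derivsD(1)[OF assms(1) x] assms(4)[OF x] by simp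
  then show "(f' has_vector_derivative g' x) (at x within {0..l})"
    by (rule has_vector_derivative_transform[rotated 2]) (use assms x in auto)
  show "g' x = g' 0 + integral {0..x} h"
    using H2_derivsD(3)[OF assms(1) x] unfolding assms(4)[OF x, symmetric] using assms(4)[of 0] assms(2) by simp
qed

lemma H2_derivs_vector_derivative:
  assumes "0 < l" "H2_derivs l f g h" "x \<in> {0..l}"
  shows "vector_derivative f (at x within {0..l}) = g x"
  using assms(1,3) H2_derivsD(1)[OF assms(2,3)]
  by (intro vector_derivative_within_closed_interval[of 0 l]) auto

text \<open>
  The derivative used in \<open>bd_derivs\<close>, as a function on the graph.
\<close>

definition edge_deriv :: "('v::finite, 'e::finite) metric_graph \<Rightarrow> 'e graph_fun \<Rightarrow> 'e graph_fun" where
  "edge_deriv G f e x = vector_derivative (f e) (at x within {0..len G e})"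

text \<open>
  The boundary values at all ends, of which \<open>bd_values\<close> selects those at one vertex. The next
  definition does the same for \<open>bd_derivs\<close>.
\<close>

definition trace_vec :: "('v::finite, 'e::finite) metric_graph \<Rightarrow> 'e graph_fun \<Rightarrow> 'e end_vec" where
  "trace_vec G f = (\<chi> p. f (fst p) (if snd p then len G (fst p) else 0))"

definition normal_deriv_vec :: "('v::finite, 'e::finite) metric_graph \<Rightarrow> 'e graph_fun \<Rightarrow> 'e end_vec" where
  "normal_deriv_vec G f = (\<chi> p. if snd p then - edge_deriv G f (fst p) (len G (fst p)) else edge_deriv G f (fst p) 0)"

lemma bd_values_eq: "bd_values G f v = at_vertex G v (trace_vec G f)"
  by (simp add: bd_values_def trace_vec_def case_prod_unfold)

lemma bd_derivs_eq: "bd_derivs G f v = at_vertex G v (normal_deriv_vec G f)"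
  unfolding bd_derivs_def normal_deriv_vec_def edge_deriv_def case_prod_unfold ..

lemma sum_over_ends: "(\<Sum>p\<in>UNIV. k p) = (\<Sum>e\<in>UNIV. k (e, False) + k (e, True))"
  for k :: "'e::finite \<times> bool \<Rightarrow> 'b::comm_monoid_add"
proof -
  have "(\<Sum>p\<in>UNIV. k p) = (\<Sum>p\<in>UNIV \<times> UNIV. k p)" by simp
  also have "\<dots> = (\<Sum>e\<in>UNIV. \<Sum>b\<in>UNIV. k (e, b))" by (simp add: sum.cartesian_product)
  finally show ?thesis by (simp add: UNIV_bool)
qed

locale graph_potential =
  fixes G :: "('v::finite, 'e::finite) metric_graph" and q :: "'e \<Rightarrow> real \<Rightarrow> real"
  assumes compact_graph: "compact_metric_graph G" and potential: "real_Linf_potential G q"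
begin

lemma len_pos: "0 < len G e" and len_nonneg: "0 \<le> len G e"
  using compact_graph by (auto simp: compact_metric_graph_def less_imp_le)

definition cont_funs :: "'e graph_fun set" where
  "cont_funs = {f. \<forall>e. continuous_on {0..len G e} (f e)}"

definition ip :: "'e graph_fun \<Rightarrow> 'e graph_fun \<Rightarrow> real" where
  "ip f g = (\<Sum>e\<in>UNIV. integral {0..len G e} (\<lambda>x. f e x \<bullet> g e x))"

lemma cont_funs_integrable: "f \<in> cont_funs \<Longrightarrow> g \<in> cont_funs \<Longrightarrow> (\<lambda>x. f e x \<bullet> g e x) integrable_on {0..len G e}"
  by (intro C1_integrable_products) (auto simp: cont_funs_def)

lemma subspace_cont_funs: "subspace cont_funs"
  unfolding subspace_def cont_funs_def by (auto intro!: continuous_intros simp: scaleR_fun_def)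

sublocale L2: pre_inner_space cont_funs ip
proof
  fix f g k :: "'e graph_fun" and r :: real
  assume cont_funs: "f \<in> cont_funs" "g \<in> cont_funs"
  show "ip (f + g) k = ip f k + ip g k" if "k \<in> cont_funs"
    using cont_funs that by (simp add: ip_def inner_add_left Henstock_Kurzweil_Integration.integral_add cont_funs_integrable sum.distrib)
  show "ip (r *\<^sub>R f) g = r * ip f g" by (simp add: ip_def sum_distrib_left)
  show "ip f g = ip g f" by (simp add: ip_def inner_commute)
  show "0 \<le> ip f f" unfolding ip_def
    by (intro sum_nonneg Henstock_Kurzweil_Integration.integral_nonneg cont_funs_integrable cont_funs) simp
qed (rule subspace_cont_funs)

lemma ip_eq_0:
  assumes "f \<in> cont_funs" "ip f f = 0" "x \<in> {0..len G e}"
  shows "f e x = 0"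
proof -
  have "integral {0..len G e} (\<lambda>x. f e x \<bullet> f e x) = 0"
    using assms(2) unfolding ip_def
    by (subst (asm) sum_nonneg_eq_0_iff)
       (auto intro!: Henstock_Kurzweil_Integration.integral_nonneg cont_funs_integrable assms)
  then have "((\<lambda>x. f e x \<bullet> f e x) has_integral 0) {0..len G e}"
    using cont_funs_integrable[OF assms(1,1), of e] by (metis integrable_integral)
  moreover have "continuous_on {0..len G e} (\<lambda>x. f e x \<bullet> f e x)"
    using assms(1) by (auto simp: cont_funs_def intro!: continuous_intros)
  ultimately have "f e x \<bullet> f e x = 0"
    using has_integral_0_cbox_imp_0[of 0 "len G e" "\<lambda>x. f e x \<bullet> f e x" x] assms(3) len_pos[of e] by auto
  then show ?thesis by simp
qed

lemma H2_graph_derivs: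
  assumes "f \<in> H2_graph G"
  obtains h where "\<And>e. H2_derivs (len G e) (f e) (edge_deriv G f e) (h e)"
proof -
  have "\<exists>h. H2_derivs (len G e) (f e) (edge_deriv G f e) h" for e
  proof -
    obtain g h where gh: "H2_derivs (len G e) (f e) g h" using assms unfolding H2_graph_def by blast
    then have "H2_derivs (len G e) (f e) (edge_deriv G f e) h"
      by (rule H2_derivs_cong) (auto simp: len_nonneg edge_deriv_def H2_derivs_vector_derivative[OF len_pos gh])
    then show ?thesis by blast
  qed
  then show ?thesis using that by metis
qed

lemma edge_deriv_eq:
  assumes "H2_derivs (len G e) (f e) g h" "x \<in> {0..len G e}"
  shows "edge_deriv G f e x = g x"
  using H2_derivs_vector_derivative[OF len_pos assms] by (simp add: edge_deriv_def)

lemma H2_graph_C1: "f \<in> H2_graph G \<Longrightarrow> C1_deriv (len G e) (f e) (edge_deriv G f e)"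
  using H2_graph_derivs H2_derivs_C1 by metis

lemma H2_graph_cont_funs: "f \<in> H2_graph G \<Longrightarrow> f \<in> cont_funs" "f \<in> H2_graph G \<Longrightarrow> edge_deriv G f \<in> cont_funs"
  unfolding cont_funs_def using H2_graph_C1 C1_deriv_continuous by blast+

lemma H2_graph_add [simp]:
  assumes "f \<in> H2_graph G" "g \<in> H2_graph G" shows "f + g \<in> H2_graph G"
proof -
  obtain h k where "\<And>e. H2_derivs (len G e) (f e) (edge_deriv G f e) (h e)"
    "\<And>e. H2_derivs (len G e) (g e) (edge_deriv G g e) (k e)"
    using H2_graph_derivs assms by metis
  then have "H2_derivs (len G e) ((f + g) e) (\<lambda>x. edge_deriv G f e x + edge_deriv G g e x) (\<lambda>x. h e x + k e x)" for e
    using H2_derivs_add by simp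
  then show ?thesis using assms unfolding H2_graph_def by auto
qed

lemma H2_graph_gscale [simp]:
  assumes "f \<in> H2_graph G" shows "gscale c f \<in> H2_graph G"
proof -
  obtain h where "\<And>e. H2_derivs (len G e) (f e) (edge_deriv G f e) (h e)"
    using H2_graph_derivs assms by metis
  then have "H2_derivs (len G e) (gscale c f e) (\<lambda>x. c * edge_deriv G f e x) (\<lambda>x. c * h e x)" for e
    using H2_derivs_scale[of "len G e" "f e" _ _ c] by (simp add: gscale_def)
  then show ?thesis using assms unfolding H2_graph_def by (auto simp: gscale_def)
qed

lemma H2_graph_scaleR [simp]: "f \<in> H2_graph G \<Longrightarrow> r *\<^sub>R f \<in> H2_graph G"
  using H2_graph_gscale[of f "of_real r"] by (simp add: gscale_of_real)

lemma H2_graph_zero [simp]: "0 \<in> H2_graph G"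
proof -
  have "H2_derivs l (0 :: real \<Rightarrow> complex) (\<lambda>_. 0) (\<lambda>_. 0)" for l
    by (simp add: H2_derivs_def L2_on_def zero_fun_def)
  then show ?thesis unfolding H2_graph_def by auto
qed

lemma edge_deriv_add:
  assumes "f \<in> H2_graph G" "g \<in> H2_graph G" "x \<in> {0..len G e}"
  shows "edge_deriv G (f + g) e x = edge_deriv G f e x + edge_deriv G g e x"
proof -
  obtain h k where "\<And>e. H2_derivs (len G e) (f e) (edge_deriv G f e) (h e)"
    "\<And>e. H2_derivs (len G e) (g e) (edge_deriv G g e) (k e)"
    using H2_graph_derivs assms by metis
  then have "H2_derivs (len G e) ((f + g) e) (\<lambda>x. edge_deriv G f e x + edge_deriv G g e x) (\<lambda>x. h e x + k e x)"
    using H2_derivs_add by simp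
  then show ?thesis by (rule edge_deriv_eq[OF _ assms(3)])
qed

lemma edge_deriv_gscale:
  assumes "f \<in> H2_graph G" "x \<in> {0..len G e}"
  shows "edge_deriv G (gscale c f) e x = c * edge_deriv G f e x"
proof -
  obtain h where "\<And>e. H2_derivs (len G e) (f e) (edge_deriv G f e) (h e)"
    using H2_graph_derivs assms by metis
  then have "H2_derivs (len G e) (gscale c f e) (\<lambda>x. c * edge_deriv G f e x) (\<lambda>x. c * h e x)"
    using H2_derivs_scale[of "len G e" "f e" _ _ c] by (simp add: gscale_def)
  then show ?thesis by (rule edge_deriv_eq[OF _ assms(2)])
qed

lemma edge_deriv_scaleR:
  assumes "f \<in> H2_graph G" "x \<in> {0..len G e}"
  shows "edge_deriv G (r *\<^sub>R f) e x = r *\<^sub>R edge_deriv G f e x"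
  using edge_deriv_gscale[OF assms, of "of_real r"] by (simp add: gscale_of_real scaleR_conv_of_real)

lemma trace_vec_add: "trace_vec G (f + g) = trace_vec G f + trace_vec G g"
  and trace_vec_gscale: "trace_vec G (gscale c f) = c *s trace_vec G f"
  and trace_vec_scaleR: "trace_vec G (r *\<^sub>R f) = r *\<^sub>R trace_vec G f"
  by (simp_all add: trace_vec_def vec_eq_iff gscale_def)

lemma normal_deriv_vec_add:
  "f \<in> H2_graph G \<Longrightarrow> g \<in> H2_graph G \<Longrightarrow> normal_deriv_vec G (f + g) = normal_deriv_vec G f + normal_deriv_vec G g"
  by (simp add: normal_deriv_vec_def vec_eq_iff edge_deriv_add len_nonneg)

lemma normal_deriv_vec_gscale:
  "f \<in> H2_graph G \<Longrightarrow> normal_deriv_vec G (gscale c f) = c *s normal_deriv_vec G f"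
  by (simp add: normal_deriv_vec_def vec_eq_iff edge_deriv_gscale len_nonneg)

lemma normal_deriv_vec_scaleR:
  "f \<in> H2_graph G \<Longrightarrow> normal_deriv_vec G (r *\<^sub>R f) = r *\<^sub>R normal_deriv_vec G f"
  by (simp add: normal_deriv_vec_def vec_eq_iff edge_deriv_scaleR len_nonneg)

text \<open>
  The potential is bounded almost everywhere only. It is replaced by an equivalent one, \<open>bounded_q\<close>, that is bounded
  everywhere, so that the differential equation can be solved by successive
  approximation.
\<close>

definition q_bound :: real where
  "q_bound = (SOME C. 0 \<le> C \<and> (\<forall>e. AE x in lebesgue_on {0..len G e}. \<bar>q e x\<bar> \<le> C))"

lemma q_bound: "0 \<le> q_bound" "AE x in lebesgue_on {0..len G e}. \<bar>q e x\<bar> \<le> q_bound"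
proof -
  obtain C where C: "\<And>e. AE x in lebesgue_on {0..len G e}. \<bar>q e x\<bar> \<le> C e"
    using potential unfolding real_Linf_potential_def by metis
  have le: "C e \<le> (\<Sum>e\<in>UNIV. \<bar>C e\<bar>)" for e
    using member_le_sum[of e UNIV "\<lambda>e. \<bar>C e\<bar>"] by force
  have "\<exists>C. 0 \<le> C \<and> (\<forall>e. AE x in lebesgue_on {0..len G e}. \<bar>q e x\<bar> \<le> C)"
  proof (intro exI[of _ "\<Sum>e\<in>UNIV. \<bar>C e\<bar>"] conjI allI)
    fix e show "AE x in lebesgue_on {0..len G e}. \<bar>q e x\<bar> \<le> (\<Sum>e\<in>UNIV. \<bar>C e\<bar>)"
      using C[of e] by (rule AE_mp) (use le[of e] in auto)
  qed (simp add: sum_nonneg)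
  from someI_ex[OF this] show "0 \<le> q_bound" "AE x in lebesgue_on {0..len G e}. \<bar>q e x\<bar> \<le> q_bound"
    unfolding q_bound_def by blast+
qed

definition bounded_q :: "'e \<Rightarrow> real \<Rightarrow> real" where
  "bounded_q e x = (if \<bar>q e x\<bar> \<le> q_bound then q e x else 0)"

lemma bounded_q: "\<bar>bounded_q e x\<bar> \<le> q_bound" "AE x in lebesgue_on {0..len G e}. bounded_q e x = q e x"
  "bounded_q e \<in> borel_measurable (lebesgue_on {0..len G e})"
proof -
  show "\<bar>bounded_q e x\<bar> \<le> q_bound" using q_bound(1) by (simp add: bounded_q_def)
  show "AE x in lebesgue_on {0..len G e}. bounded_q e x = q e x"
    using q_bound(2)[of e] by (rule AE_mp) (auto simp: bounded_q_def)
  have [measurable]: "q e \<in> borel_measurable (lebesgue_on {0..len G e})"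
    using potential by (simp add: real_Linf_potential_def)
  show "bounded_q e \<in> borel_measurable (lebesgue_on {0..len G e})"
    unfolding bounded_q_def by measurable
qed

definition q_times :: "'e graph_fun \<Rightarrow> 'e graph_fun" where
  "q_times f e x = of_real (bounded_q e x) * f e x"

lemma q_times_L2: "f \<in> cont_funs \<Longrightarrow> L2_on {0..len G e} (q_times f e)"
  using L2_on_potential_times_continuous[OF bounded_q(3) bounded_q(1), of e "f e" "\<lambda>_. 0"]
  unfolding cont_funs_def q_times_def[abs_def] by simp

lemma L2_inner_integrable:
  "L2_on {0..len G e} h \<Longrightarrow> f \<in> cont_funs \<Longrightarrow> (\<lambda>x. h x \<bullet> f e x) integrable_on {0..len G e}"
  unfolding cont_funs_def
  by (rule set_lebesgue_integral_eq_integral(1)[OF absolutely_integrable_inner_continuous[OF L2_on_absolutely_integrable]])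
     auto

definition energy :: "'e graph_fun \<Rightarrow> 'e graph_fun \<Rightarrow> real" where
  "energy f g = ip (edge_deriv G f) (edge_deriv G g) + ip (q_times f) g"

lemma energy_add:
  assumes "f \<in> H2_graph G" "g \<in> H2_graph G" "k \<in> H2_graph G"
  shows "energy (f + g) k = energy f k + energy g k"
proof -
  have "ip (edge_deriv G (f + g)) (edge_deriv G k) = ip (edge_deriv G f + edge_deriv G g) (edge_deriv G k)"
    unfolding ip_def using assms
    by (intro sum.cong Henstock_Kurzweil_Integration.integral_cong refl) (simp add: edge_deriv_add)
  moreover have "ip (q_times (f + g)) k = ip (q_times f) k + ip (q_times g) k"
    unfolding ip_def sum.distrib[symmetric]
    using assms H2_graph_cont_funs
    by (intro sum.cong refl)
       (simp add: Henstock_Kurzweil_Integration.integral_add[symmetric] L2_inner_integrable q_times_L2 inner_add_left[symmetric],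
        simp add: q_times_def distrib_left)
  ultimately show ?thesis using assms H2_graph_cont_funs by (simp add: energy_def L2.ip_add_left)
qed

lemma energy_scale:
  assumes "f \<in> H2_graph G" "g \<in> H2_graph G"
  shows "energy (r *\<^sub>R f) g = r * energy f g"
proof -
  have "ip (edge_deriv G (r *\<^sub>R f)) (edge_deriv G g) = ip (r *\<^sub>R edge_deriv G f) (edge_deriv G g)"
    unfolding ip_def using assms
    by (intro sum.cong Henstock_Kurzweil_Integration.integral_cong refl) (simp add: edge_deriv_scaleR)
  moreover have "q_times (r *\<^sub>R f) = r *\<^sub>R q_times f"
    by (simp add: q_times_def fun_eq_iff)
  moreover have "ip (r *\<^sub>R q_times f) g = r * ip (q_times f) g" by (simp add: ip_def sum_distrib_left)
  ultimately show ?thesis using assms H2_graph_cont_funs by (simp add: energy_def L2.ip_scale_left distrib_left)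
qed

lemma energy_sym:
  assumes "f \<in> H2_graph G" "g \<in> H2_graph G"
  shows "energy f g = energy g f"
proof -
  have "ip (q_times f) g = ip (q_times g) f"
    unfolding ip_def q_times_def by (simp add: inner_mult_left inner_complex_def algebra_simps)
  then show ?thesis using assms H2_graph_cont_funs L2.ip_sym by (simp add: energy_def)
qed

lemma energy_lower_bound:
  assumes "f \<in> H2_graph G"
  shows "energy f f \<ge> ip (edge_deriv G f) (edge_deriv G f) - q_bound * ip f f"
proof -
  have "- q_bound * ip f f \<le> ip (q_times f) f"
    unfolding ip_def sum_distrib_left
  proof (intro sum_mono)
    fix e
    have "integral {0..len G e} (\<lambda>x. (- q_bound) * (f e x \<bullet> f e x)) \<le> integral {0..len G e} (\<lambda>x. q_times f e x \<bullet> f e x)"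
    proof (rule integral_le)
      fix x
      have "(- q_bound) * (f e x \<bullet> f e x) \<le> bounded_q e x * (f e x \<bullet> f e x)"
        using bounded_q(1)[of e x] by (intro mult_right_mono) auto
      then show "(- q_bound) * (f e x \<bullet> f e x) \<le> q_times f e x \<bullet> f e x"
        by (simp add: q_times_def inner_complex_def algebra_simps)
    next
      show "(\<lambda>x. (- q_bound) * (f e x \<bullet> f e x)) integrable_on {0..len G e}"
        using assms by (intro integrable_on_mult_right cont_funs_integrable H2_graph_cont_funs)
      show "(\<lambda>x. q_times f e x \<bullet> f e x) integrable_on {0..len G e}"
        using assms by (intro L2_inner_integrable q_times_L2 H2_graph_cont_funs)
    qed
    then show "- q_bound * integral {0..len G e} (\<lambda>x. f e x \<bullet> f e x) \<le> integral {0..len G e} (\<lambda>x. q_times f e x \<bullet> f e x)"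
      by simp
  qed
  then show ?thesis by (simp add: energy_def)
qed

text \<open>
  The derivatives in \<open>normal_deriv_vec\<close> point into the edges, which gives both boundary terms of each
  edge the same sign.
\<close>

lemma Green_formula:
  assumes h: "\<And>e. H2_derivs (len G e) (f e) (edge_deriv G f e) (h e)" and \<phi>: "\<phi> \<in> H2_graph G"
  shows "ip h \<phi> = - (normal_deriv_vec G f \<bullet> trace_vec G \<phi>) - ip (edge_deriv G f) (edge_deriv G \<phi>)"
proof -
  have *: "integral {0..len G e} (\<lambda>x. h e x \<bullet> \<phi> e x) =
      edge_deriv G f e (len G e) \<bullet> \<phi> e (len G e) - edge_deriv G f e 0 \<bullet> \<phi> e 0
      - integral {0..len G e} (\<lambda>x. edge_deriv G f e x \<bullet> edge_deriv G \<phi> e x)" for e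
  proof (rule integration_by_parts_absolutely_continuous[OF len_pos])
    show "h e absolutely_integrable_on {0..len G e}"
      using H2_derivsD(2)[OF h] by (rule L2_on_absolutely_integrable)
    show "edge_deriv G f e x = edge_deriv G f e 0 + integral {0..x} (h e)" if "x \<in> {0..len G e}" for x
      using H2_derivsD(3)[OF h that] .
  qed (rule H2_graph_C1[OF \<phi>])
  show ?thesis
    unfolding ip_def inner_vec_def sum_over_ends *
    by (simp add: normal_deriv_vec_def trace_vec_def sum_subtractf sum.distrib)
qed

text \<open>
  Boundary values cost an arbitrarily small multiple of \<open>\<integral> |f'|\<^sup>2\<close>. This is what keeps the form bounded below, whatever
  the sign of the boundary term.
\<close>

lemma trace_vec_bound:
  assumes f: "f \<in> H2_graph G" and \<epsilon>: "0 < \<epsilon>"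
  shows "(norm (trace_vec G f))\<^sup>2 \<le> 2 * ((\<Sum>e\<in>UNIV. 1 / len G e) + 1 / \<epsilon>) * ip f f + 2 * \<epsilon> * ip (edge_deriv G f) (edge_deriv G f)"
proof -
  define L where "L = (\<Sum>e\<in>UNIV. 1 / len G e)"
  define I where "I = (\<lambda>e. integral {0..len G e} (\<lambda>x. f e x \<bullet> f e x))"
  define D where "D = (\<lambda>e. integral {0..len G e} (\<lambda>x. edge_deriv G f e x \<bullet> edge_deriv G f e x))"
  have I0: "0 \<le> I e" for e
    unfolding I_def by (intro Henstock_Kurzweil_Integration.integral_nonneg cont_funs_integrable H2_graph_cont_funs f) simp
  have L: "1 / len G e \<le> L" for e
    unfolding L_def by (intro member_le_sum) (auto simp: len_nonneg)
  have b: "(cmod (f e x))\<^sup>2 \<le> (L + 1 / \<epsilon>) * I e + \<epsilon> * D e" if "x = 0 \<or> x = len G e" for e x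
  proof -
    have "(cmod (f e x))\<^sup>2 \<le> (1 / len G e + 1 / \<epsilon>) * I e + \<epsilon> * D e"
      unfolding I_def D_def by (rule C1_trace_bound[OF len_pos H2_graph_C1[OF f] \<epsilon> that])
    also have "\<dots> \<le> (L + 1 / \<epsilon>) * I e + \<epsilon> * D e"
      using L[of e] I0[of e] by (intro add_right_mono mult_right_mono) auto
    finally show ?thesis .
  qed
  have "(norm (trace_vec G f))\<^sup>2 = (\<Sum>e\<in>UNIV. (cmod (f e 0))\<^sup>2 + (cmod (f e (len G e)))\<^sup>2)"
    unfolding power2_norm_eq_inner inner_vec_def sum_over_ends by (simp add: trace_vec_def)
  also have "\<dots> \<le> (\<Sum>e\<in>UNIV. 2 * ((L + 1 / \<epsilon>) * I e + \<epsilon> * D e))"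
  proof (rule sum_mono)
    fix e show "(cmod (f e 0))\<^sup>2 + (cmod (f e (len G e)))\<^sup>2 \<le> 2 * ((L + 1 / \<epsilon>) * I e + \<epsilon> * D e)"
      using b[of 0 e] b[of "len G e" e] by simp
  qed
  also have "\<dots> = 2 * (L + 1 / \<epsilon>) * ip f f + 2 * \<epsilon> * ip (edge_deriv G f) (edge_deriv G f)"
    by (simp add: ip_def I_def D_def sum.distrib sum_distrib_left algebra_simps)
  finally show ?thesis unfolding L_def .
qed

end

section \<open>The quadratic form of a boundary condition\<close>

text \<open>
  Linearity is part of this: an adjoint relation with respect to a nondegenerate form implies
  it.
\<close>

definition hermitian_op :: "(complex ^ 'n \<Rightarrow> complex ^ 'n) \<Rightarrow> bool" where
  "hermitian_op T \<longleftrightarrow> (\<forall>x y. cdot (T x) y = cdot x (T y))"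

lemma Re_cdot: "Re (cdot x y) = x \<bullet> y"
  by (simp add: cdot_def inner_vec_def inner_complex_def)

lemma cdot_diff_left: "cdot (x - y) z = cdot x z - cdot y z"
  by (simp add: cdot_def algebra_simps sum_subtractf)

lemma cdot_add_left: "cdot (x + y) z = cdot x z + cdot y z"
  by (simp add: cdot_def algebra_simps sum.distrib)

lemma cdot_mult_left: "cdot (c *s x) z = cnj c * cdot x z"
  by (simp add: cdot_def sum_distrib_left mult.assoc)

lemma cdot_eqI: "(\<And>z. cdot x z = cdot y z) \<Longrightarrow> x = y"
proof -
  assume "\<And>z. cdot x z = cdot y z"
  then have "(x - y) \<bullet> (x - y) = 0" by (simp add: cdot_diff_left flip: Re_cdot)
  then show ?thesis by simp
qed

lemma hermitian_op_add: "hermitian_op T \<Longrightarrow> T (x + y) = T x + T y"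
  unfolding hermitian_op_def by (rule cdot_eqI) (simp add: cdot_add_left)

lemma hermitian_op_mult: "hermitian_op T \<Longrightarrow> T (c *s x) = c *s T x"
  unfolding hermitian_op_def by (rule cdot_eqI) (simp add: cdot_mult_left)

lemma hermitian_op_scaleR:
  fixes T :: "complex ^ 'n \<Rightarrow> complex ^ 'n"
  assumes "hermitian_op T"
  shows "T (r *\<^sub>R x) = r *\<^sub>R T x"
proof -
  have "r *\<^sub>R y = of_real r *s y" for y :: "complex ^ 'n"
    by (simp add: vec_eq_iff scaleR_conv_of_real[symmetric])
  then show ?thesis using hermitian_op_mult[OF assms] by simp
qed

lemma hermitian_op_zero: "hermitian_op T \<Longrightarrow> T 0 = 0"
  using hermitian_op_scaleR[of T 0 0] by simp

lemma hermitian_op_diff: "hermitian_op T \<Longrightarrow> T (x - y) = T x - T y"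
  using hermitian_op_add[of T x "- y"] hermitian_op_scaleR[of T "-1" y] by simp

lemma hermitian_op_inner: "hermitian_op T \<Longrightarrow> T x \<bullet> y = x \<bullet> T y"
  unfolding hermitian_op_def Re_cdot[symmetric] by simp

lemma hermitian_op_linear: "hermitian_op T \<Longrightarrow> linear T"
  by (intro linearI) (auto simp: hermitian_op_add hermitian_op_scaleR)

lemma hermitian_op_form_bound:
  fixes T :: "complex ^ 'n::finite \<Rightarrow> complex ^ 'n"
  assumes "hermitian_op T"
  obtains K where "K > 0" "\<And>x. \<bar>x \<bullet> T x\<bar> \<le> K * (norm x)\<^sup>2"
proof -
  obtain K where K: "K > 0" "\<And>x. norm (T x) \<le> K * norm x"
    using linear_bounded_pos[OF hermitian_op_linear[OF assms]] by blast
  have "\<bar>x \<bullet> T x\<bar> \<le> K * (norm x)\<^sup>2" for x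
  proof -
    have "\<bar>x \<bullet> T x\<bar> \<le> norm x * norm (T x)" by (rule Cauchy_Schwarz_ineq2)
    also have "\<dots> \<le> norm x * (K * norm x)" by (intro mult_left_mono K) simp
    finally show ?thesis by (simp add: power2_eq_square mult_ac)
  qed
  then show ?thesis using K that by blast
qed

text \<open>
  The vertex conditions \<open>B\<close> enter only through the equivalent condition on the vector \<open>F\<close> of all
  boundary values and the vector \<open>F'\<close> of all derivatives.
\<close>

locale graph_operator = graph_potential G q
  for G :: "('v::finite, 'e::finite) metric_graph" and q :: "'e \<Rightarrow> real \<Rightarrow> real" +
  fixes B :: "'v \<Rightarrow> 'e vertex_cond" and P A :: "'e end_vec \<Rightarrow> 'e end_vec"
  assumes P: "hermitian_op P" and P_idem: "\<And>x. P (P x) = P x" and A: "hermitian_op A"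
    and PA: "\<And>x. P (A x) = 0"
    and B_iff: "\<And>F F'. (\<forall>v. B v (at_vertex G v F) (at_vertex G v F')) \<longleftrightarrow> P F = 0 \<and> F' - P F' = A F"
begin

text \<open>
  The quadratic form of the operator. Its domain is cut down to \<open>H\<^sup>2\<close> functions: these
  include all eigenfunctions and test functions, and their derivatives are continuous.
\<close>

definition form :: "'e graph_fun \<Rightarrow> 'e graph_fun \<Rightarrow> real" where
  "form f g = energy f g + trace_vec G f \<bullet> A (trace_vec G g)"

definition form_domain :: "'e graph_fun set" where
  "form_domain = {f \<in> H2_graph G. P (trace_vec G f) = 0}"

lemma form_domain_cont_funs: "f \<in> form_domain \<Longrightarrow> f \<in> cont_funs" and form_domain_H2: "f \<in> form_domain \<Longrightarrow> f \<in> H2_graph G"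
  by (auto simp: form_domain_def H2_graph_cont_funs)

lemma trace_vec_zero: "trace_vec G 0 = 0"
  by (simp add: trace_vec_def vec_eq_iff)

lemma subspace_form_domain: "subspace form_domain"
  unfolding subspace_def form_domain_def
  by (auto simp: trace_vec_add trace_vec_scaleR trace_vec_zero hermitian_op_add[OF P] hermitian_op_scaleR[OF P]
      hermitian_op_zero[OF P])

lemma form_bounded_below:
  obtains c where "\<And>f. f \<in> H2_graph G \<Longrightarrow> form f f \<ge> (1/2) * ip (edge_deriv G f) (edge_deriv G f) - c * ip f f"
proof -
  obtain K where K: "K > 0" "\<And>x. \<bar>x \<bullet> A x\<bar> \<le> K * (norm x)\<^sup>2"
    using hermitian_op_form_bound[OF A] by blast
  \<comment> \<open>\<open>A\<close> costs at most \<open>K\<close> times the square of the trace, hence \<open>2 \<epsilon> K = 1/2\<close> of \<open>\<parallel>f'\<parallel>\<^sup>2\<close>\<close>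
  define \<epsilon> where "\<epsilon> = 1 / (4 * K)"
  have \<epsilon>: "\<epsilon> > 0" using K by (simp add: \<epsilon>_def)
  define L where "L = (\<Sum>e\<in>UNIV. 1 / len G e) + 1 / \<epsilon>"
  have "form f f \<ge> (1/2) * ip (edge_deriv G f) (edge_deriv G f) - (q_bound + K * (2 * L)) * ip f f" if f: "f \<in> H2_graph G" for f
  proof -
    have "\<bar>trace_vec G f \<bullet> A (trace_vec G f)\<bar> \<le> K * (norm (trace_vec G f))\<^sup>2" by (rule K)
    also have "\<dots> \<le> K * (2 * L * ip f f + 2 * \<epsilon> * ip (edge_deriv G f) (edge_deriv G f))"
      unfolding L_def using trace_vec_bound[OF f \<epsilon>] K by (intro mult_left_mono) auto
    also have "\<dots> = K * (2 * L) * ip f f + (1/2) * ip (edge_deriv G f) (edge_deriv G f)"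
      using K by (simp add: \<epsilon>_def field_simps)
    finally show ?thesis using energy_lower_bound[OF f] by (simp add: form_def algebra_simps)
  qed
  then show ?thesis using that by blast
qed

text \<open>
  A constant such that the form plus \<open>shift\<close> times the inner product dominates \<open>\<parallel>f\<parallel>\<^sup>2\<close> plus half of
  \<open>\<parallel>f'\<parallel>\<^sup>2\<close>.
\<close>

definition shift :: real where
  "shift = (SOME c. \<forall>f\<in>H2_graph G. form f f \<ge> (1/2) * ip (edge_deriv G f) (edge_deriv G f) - (c - 1) * ip f f)"

definition shifted_form :: "'e graph_fun \<Rightarrow> 'e graph_fun \<Rightarrow> real" where
  "shifted_form f g = form f g + shift * ip f g"

lemma shifted_form_coercive:
  assumes "f \<in> H2_graph G"
  shows "shifted_form f f \<ge> (1/2) * ip (edge_deriv G f) (edge_deriv G f) + ip f f"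
proof -
  obtain c where c: "\<And>f. f \<in> H2_graph G \<Longrightarrow> form f f \<ge> (1/2) * ip (edge_deriv G f) (edge_deriv G f) - c * ip f f"
    using form_bounded_below by blast
  have "\<exists>c. \<forall>f\<in>H2_graph G. form f f \<ge> (1/2) * ip (edge_deriv G f) (edge_deriv G f) - (c - 1) * ip f f"
    by (intro exI[of _ "c + 1"]) (use c in simp)
  from someI_ex[OF this] have "form f f \<ge> (1/2) * ip (edge_deriv G f) (edge_deriv G f) - (shift - 1) * ip f f"
    unfolding shift_def using assms by blast
  then show ?thesis by (simp add: shifted_form_def algebra_simps)
qed

lemma ip_deriv_nonneg: "f \<in> H2_graph G \<Longrightarrow> 0 \<le> ip (edge_deriv G f) (edge_deriv G f)"
  by (intro L2.ip_nonneg H2_graph_cont_funs)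

sublocale form_space: pre_inner_space form_domain shifted_form
proof
  fix f g :: "'e graph_fun" and r :: real
  assume f: "f \<in> form_domain" and g: "g \<in> form_domain"
  show "shifted_form (f + g) k = shifted_form f k + shifted_form g k" if "k \<in> form_domain" for k
    using f g that form_domain_cont_funs form_domain_H2
    by (simp add: shifted_form_def form_def energy_add L2.ip_add_left trace_vec_add inner_add_left algebra_simps)
  show "shifted_form (r *\<^sub>R f) g = r * shifted_form f g"
    using f g form_domain_cont_funs form_domain_H2
    by (simp add: shifted_form_def form_def energy_scale L2.ip_scale_left trace_vec_scaleR algebra_simps)
  show "shifted_form f g = shifted_form g f"
    using f g form_domain_cont_funs form_domain_H2 energy_sym[of f g] L2.ip_sym[of f g] hermitian_op_inner[OF A]
    by (simp add: shifted_form_def form_def inner_commute)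
  show "0 \<le> shifted_form f f"
    using shifted_form_coercive[OF form_domain_H2[OF f]] ip_deriv_nonneg[OF form_domain_H2[OF f]] L2.ip_nonneg[OF form_domain_cont_funs[OF f]] by simp
qed (rule subspace_form_domain)

lemma H2_graph_eq_0:
  assumes "f \<in> H2_graph G" "\<And>e x. x \<in> {0..len G e} \<Longrightarrow> f e x = 0"
  shows "f = 0"
proof (intro ext)
  fix e x show "f e x = 0 e x"
    using assms unfolding H2_graph_def by (cases "x \<in> {0..len G e}") auto
qed

lemma ip_pos: "f \<in> H2_graph G \<Longrightarrow> f \<noteq> 0 \<Longrightarrow> 0 < ip f f"
  using ip_eq_0[OF H2_graph_cont_funs(1)] H2_graph_eq_0[of f] L2.ip_nonneg[OF H2_graph_cont_funs(1), of f] by fastforce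

lemma shifted_form_pos: "f \<in> form_domain \<Longrightarrow> f \<noteq> 0 \<Longrightarrow> 0 < shifted_form f f"
  using shifted_form_coercive[OF form_domain_H2, of f] ip_deriv_nonneg[OF form_domain_H2, of f] ip_pos[OF form_domain_H2, of f] by simp

text \<open>
  An element of the form domain is determined by its pairings in the shifted form. This
  identifies the resolvent with the weak solution and makes it linear and symmetric.
\<close>

lemma weak_unique:
  assumes "f \<in> form_domain" "g \<in> form_domain" "\<And>\<phi>. \<phi> \<in> form_domain \<Longrightarrow> shifted_form f \<phi> = shifted_form g \<phi>"
  shows "f = g"
proof (rule ccontr)
  assume "f \<noteq> g"
  then have "0 < shifted_form (f - g) (f - g)" using shifted_form_pos[of "f - g"] assms by simp
  moreover have "shifted_form (f - g) (f - g) = 0"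
    using assms(1,2) assms(3)[of "f - g"] by (simp add: form_space.ip_diff_left)
  ultimately show False by simp
qed

definition boundary_cond :: "'e graph_fun \<Rightarrow> bool" where
  "boundary_cond f \<longleftrightarrow> P (trace_vec G f) = 0 \<and> normal_deriv_vec G f - P (normal_deriv_vec G f) = A (trace_vec G f)"

text \<open>
  \<open>f\<close> is in the domain of the operator and \<open>(H + shift) f = w\<close>.
\<close>

definition solves :: "'e graph_fun \<Rightarrow> 'e graph_fun \<Rightarrow> bool" where
  "solves f w \<longleftrightarrow> f \<in> H2_graph G \<and> boundary_cond f \<and>
     (\<forall>e. \<exists>h. H2_derivs (len G e) (f e) (edge_deriv G f e) h \<and>
        (AE x in lebesgue_on {0..len G e}. w e x = - h x + of_real (bounded_q e x + shift) * f e x))"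

lemma solves_form_domain: "solves f w \<Longrightarrow> f \<in> form_domain"
  by (simp add: solves_def boundary_cond_def form_domain_def)

lemma solves_iff_schroedinger:
  "solves f (w + shift *\<^sub>R f) \<longleftrightarrow> (f, w) \<in> schroedinger G q B"
proof -
  have boundary_cond: "(\<forall>v. B v (bd_values G f v) (bd_derivs G f v)) \<longleftrightarrow> boundary_cond f"
    unfolding bd_values_eq bd_derivs_eq B_iff boundary_cond_def ..
  have *: "(\<exists>h. H2_derivs (len G e) (f e) (edge_deriv G f e) h \<and>
        (AE x in lebesgue_on {0..len G e}. (w + shift *\<^sub>R f) e x = - h x + of_real (bounded_q e x + shift) * f e x)) \<longleftrightarrow>
      (\<exists>g h. H2_derivs (len G e) (f e) g h \<and>
        (AE x in lebesgue_on {0..len G e}. w e x = - h x + of_real (q e x) * f e x))" for e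
  proof -
    have AE: "(AE x in lebesgue_on {0..len G e}. (w + shift *\<^sub>R f) e x = - h x + of_real (bounded_q e x + shift) * f e x) \<longleftrightarrow>
       (AE x in lebesgue_on {0..len G e}. w e x = - h x + of_real (q e x) * f e x)" for h
      using bounded_q(2)[of e] by (intro iffI; elim AE_mp) (auto simp: algebra_simps scaleR_conv_of_real elim!: AE_mp)
    have "H2_derivs (len G e) (f e) (edge_deriv G f e) h" if gh: "H2_derivs (len G e) (f e) g h" for g h
      by (rule H2_derivs_cong[OF gh]) (auto simp: len_nonneg edge_deriv_eq[of e f g h, OF gh])
    then show ?thesis unfolding AE by blast
  qed
  show ?thesis unfolding solves_def schroedinger_def * by (simp add: boundary_cond)
qed

text \<open>
  Strong solutions are weak solutions: Green's formula leaves the boundary term \<open>\<langle>F', \<Phi>\<rangle>\<close>, where \<open>\<Phi>\<close> is the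
  trace of \<open>\<phi>\<close>. As \<open>P \<Phi> = 0\<close>, only \<open>F' - P F' = A F\<close> contributes.
\<close>

lemma solves_weak:
  assumes s: "solves f w" and w: "w \<in> cont_funs" and \<phi>: "\<phi> \<in> form_domain"
  shows "shifted_form f \<phi> = ip w \<phi>"
proof -
  have f: "f \<in> form_domain" "f \<in> H2_graph G" "f \<in> cont_funs" using solves_form_domain[OF s] form_domain_H2 form_domain_cont_funs by auto
  have \<phi>': "\<phi> \<in> H2_graph G" "\<phi> \<in> cont_funs" using \<phi> form_domain_H2 form_domain_cont_funs by auto
  obtain h where h: "\<And>e. H2_derivs (len G e) (f e) (edge_deriv G f e) (h e)"
    and AE: "\<And>e. AE x in lebesgue_on {0..len G e}. w e x = - h e x + of_real (bounded_q e x + shift) * f e x"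
  proof -
    have "\<forall>e. \<exists>h. H2_derivs (len G e) (f e) (edge_deriv G f e) h \<and>
        (AE x in lebesgue_on {0..len G e}. w e x = - h x + of_real (bounded_q e x + shift) * f e x)"
      using s unfolding solves_def by blast
    from choice[OF this] show ?thesis using that by blast
  qed
  have "ip w \<phi> = - ip h \<phi> + ip (q_times f) \<phi> + shift * ip f \<phi>"
  proof -
    have "integral {0..len G e} (\<lambda>x. w e x \<bullet> \<phi> e x) =
        - integral {0..len G e} (\<lambda>x. h e x \<bullet> \<phi> e x) + integral {0..len G e} (\<lambda>x. q_times f e x \<bullet> \<phi> e x)
        + shift * integral {0..len G e} (\<lambda>x. f e x \<bullet> \<phi> e x)" for e
    proof -
      have expand: "(- a + of_real (r + t) * b) \<bullet> p = - (a \<bullet> p) + (of_real r * b) \<bullet> p + t * (b \<bullet> p)"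
        for a b p :: complex and r t by (simp add: inner_complex_def algebra_simps)
      have "((\<lambda>x. - (h e x \<bullet> \<phi> e x) + q_times f e x \<bullet> \<phi> e x + shift * (f e x \<bullet> \<phi> e x)) has_integral
          (- integral {0..len G e} (\<lambda>x. h e x \<bullet> \<phi> e x) + integral {0..len G e} (\<lambda>x. q_times f e x \<bullet> \<phi> e x)
        + shift * integral {0..len G e} (\<lambda>x. f e x \<bullet> \<phi> e x))) {0..len G e}"
      proof -
        have "(\<lambda>x. h e x \<bullet> \<phi> e x) integrable_on {0..len G e}" "(\<lambda>x. q_times f e x \<bullet> \<phi> e x) integrable_on {0..len G e}"
          "(\<lambda>x. f e x \<bullet> \<phi> e x) integrable_on {0..len G e}"
          using L2_inner_integrable[OF H2_derivsD(2)[OF h] \<phi>'(2)] L2_inner_integrable[OF q_times_L2[OF f(3)] \<phi>'(2)]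
            cont_funs_integrable[OF f(3) \<phi>'(2)] by blast+
        from this[THEN integrable_integral] show ?thesis
          by (intro has_integral_add has_integral_neg has_integral_mult_right)
      qed
      moreover have "integral {0..len G e} (\<lambda>x. w e x \<bullet> \<phi> e x) =
          integral {0..len G e} (\<lambda>x. - (h e x \<bullet> \<phi> e x) + q_times f e x \<bullet> \<phi> e x + shift * (f e x \<bullet> \<phi> e x))"
      proof (rule AE_lebesgue_on_integral_cong[OF _ order_refl])
        show "AE x in lebesgue_on {0..len G e}. w e x \<bullet> \<phi> e x =
            - (h e x \<bullet> \<phi> e x) + q_times f e x \<bullet> \<phi> e x + shift * (f e x \<bullet> \<phi> e x)"
          using AE[of e] by eventually_elim (simp only: q_times_def expand)
      qed
      ultimately show ?thesis by (simp add: has_integral_iff)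
    qed
    then show ?thesis by (simp add: ip_def sum.distrib sum_subtractf sum_distrib_left)
  qed
  also have "- ip h \<phi> = normal_deriv_vec G f \<bullet> trace_vec G \<phi> + ip (edge_deriv G f) (edge_deriv G \<phi>)"
    using Green_formula[OF h \<phi>'(1)] by simp
  also have "normal_deriv_vec G f \<bullet> trace_vec G \<phi> = trace_vec G f \<bullet> A (trace_vec G \<phi>)"
  proof -
    have "P (normal_deriv_vec G f) \<bullet> trace_vec G \<phi> = normal_deriv_vec G f \<bullet> P (trace_vec G \<phi>)"
      by (rule hermitian_op_inner[OF P])
    also have "\<dots> = 0" using \<phi> by (simp add: form_domain_def)
    finally have "normal_deriv_vec G f \<bullet> trace_vec G \<phi> = (normal_deriv_vec G f - P (normal_deriv_vec G f)) \<bullet> trace_vec G \<phi>"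
      by (simp add: inner_diff_left)
    also have "\<dots> = A (trace_vec G f) \<bullet> trace_vec G \<phi>" using s by (simp add: solves_def boundary_cond_def)
    finally show ?thesis by (simp add: hermitian_op_inner[OF A])
  qed
  finally show ?thesis by (simp add: shifted_form_def form_def energy_def)
qed

end

section \<open>The resolvent\<close>

context graph_operator begin

lemma solves_gscale:
  assumes "solves f w"
  shows "solves (gscale c f) (gscale c w)"
proof -
  have f: "f \<in> H2_graph G" using assms by (simp add: solves_def)
  have "boundary_cond (gscale c f)"
    using assms f unfolding solves_def boundary_cond_def
    by (simp add: trace_vec_gscale normal_deriv_vec_gscale hermitian_op_mult[OF P] hermitian_op_mult[OF A]
        flip: vector_ssub_ldistrib)
  moreover have "\<exists>h. H2_derivs (len G e) (gscale c f e) (edge_deriv G (gscale c f) e) h \<and>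
        (AE x in lebesgue_on {0..len G e}. gscale c w e x = - h x + of_real (bounded_q e x + shift) * gscale c f e x)" for e
  proof -
    obtain h where h: "H2_derivs (len G e) (f e) (edge_deriv G f e) h"
      "AE x in lebesgue_on {0..len G e}. w e x = - h x + of_real (bounded_q e x + shift) * f e x"
      using assms unfolding solves_def by blast
    have "H2_derivs (len G e) (gscale c f e) (edge_deriv G (gscale c f) e) (\<lambda>x. c * h x)"
      by (rule H2_derivs_cong[OF H2_derivs_scale[OF h(1), of c] len_nonneg])
         (auto simp: gscale_def edge_deriv_gscale[OF f, unfolded gscale_def])
    moreover have "AE x in lebesgue_on {0..len G e}. gscale c w e x = - (c * h x) + of_real (bounded_q e x + shift) * gscale c f e x"
      using h(2) by eventually_elim
        (simp only: gscale_def distrib_left mult_minus_right mult.left_commute)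
    ultimately show ?thesis by blast
  qed
  ultimately show ?thesis using f unfolding solves_def by simp
qed

lemma solves_scaleR: "solves f w \<Longrightarrow> solves (r *\<^sub>R f) (r *\<^sub>R w)"
  using solves_gscale[of f w "of_real r"] by (simp add: gscale_of_real)

lemma solves_add:
  assumes "solves f v" "solves g w"
  shows "solves (f + g) (v + w)"
proof -
  have f: "f \<in> H2_graph G" and g: "g \<in> H2_graph G" using assms by (simp_all add: solves_def)
  have "boundary_cond (f + g)"
    using assms f g unfolding solves_def boundary_cond_def
    by (simp add: trace_vec_add normal_deriv_vec_add hermitian_op_add[OF P] hermitian_op_add[OF A] add_diff_add)
  moreover have "\<exists>h. H2_derivs (len G e) ((f + g) e) (edge_deriv G (f + g) e) h \<and>
        (AE x in lebesgue_on {0..len G e}. (v + w) e x = - h x + of_real (bounded_q e x + shift) * (f + g) e x)" for e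
  proof -
    obtain h where h: "H2_derivs (len G e) (f e) (edge_deriv G f e) h"
      "AE x in lebesgue_on {0..len G e}. v e x = - h x + of_real (bounded_q e x + shift) * f e x"
      using assms(1) unfolding solves_def by blast
    obtain k where k: "H2_derivs (len G e) (g e) (edge_deriv G g e) k"
      "AE x in lebesgue_on {0..len G e}. w e x = - k x + of_real (bounded_q e x + shift) * g e x"
      using assms(2) unfolding solves_def by blast
    have "H2_derivs (len G e) ((f + g) e) (edge_deriv G (f + g) e) (\<lambda>x. h x + k x)"
      by (rule H2_derivs_cong[OF H2_derivs_add[OF h(1) k(1)] len_nonneg]) (auto simp: edge_deriv_add[OF f g])
    moreover have "AE x in lebesgue_on {0..len G e}. (v + w) e x = - (h x + k x) + of_real (bounded_q e x + shift) * (f + g) e x"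
      using h(2) k(2) by eventually_elim (simp only: plus_fun_apply distrib_left distrib_right minus_add_distrib ac_simps)
    ultimately show ?thesis by blast
  qed
  ultimately show ?thesis using f g unfolding solves_def by simp
qed

lemma edge_solutions:
  assumes "w \<in> cont_funs"
  obtains u u' :: "'e graph_fun" where
    "\<And>e. H2_derivs (len G e) (u e) (u' e) (\<lambda>x. of_real (bounded_q e x + shift) * u e x - w e x)"
    "\<And>e. u e 0 = a" "\<And>e. u' e 0 = b"
proof -
  have "\<exists>u g. H2_derivs (len G e) u g (\<lambda>x. of_real (bounded_q e x + shift) * u x - w e x) \<and> u 0 = a \<and> g 0 = b" for e
  proof (rule ODE_exists[OF len_pos])
    show "0 \<le> q_bound + \<bar>shift\<bar>" using q_bound(1) by simp
    show "\<bar>bounded_q e x + shift\<bar> \<le> q_bound + \<bar>shift\<bar>" for x using bounded_q(1)[of e x] by simp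
    show "(\<lambda>x. bounded_q e x + shift) \<in> borel_measurable (lebesgue_on {0..len G e})" using bounded_q(3)[of e] by measurable
    show "continuous_on {0..len G e} (w e)" using assms by (simp add: cont_funs_def)
  qed
  then have "\<forall>e. \<exists>ug. H2_derivs (len G e) (fst ug) (snd ug) (\<lambda>x. of_real (bounded_q e x + shift) * fst ug x - w e x) \<and>
      fst ug 0 = a \<and> snd ug 0 = b" by simp
  from choice[OF this] obtain ug where "\<And>e. H2_derivs (len G e) (fst (ug e)) (snd (ug e))
      (\<lambda>x. of_real (bounded_q e x + shift) * fst (ug e) x - w e x) \<and> fst (ug e) 0 = a \<and> snd (ug e) 0 = b" by blast
  then show ?thesis by (intro that[of "\<lambda>e. fst (ug e)" "\<lambda>e. snd (ug e)"]) auto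
qed

lemma homogeneous_edge_solutions:
  obtains u u' :: "'e graph_fun" where
    "\<And>e. H2_derivs (len G e) (u e) (u' e) (\<lambda>x. of_real (bounded_q e x + shift) * u e x)"
    "\<And>e. u e 0 = a" "\<And>e. u' e 0 = b"
proof -
  have 0: "(\<lambda>_ _. 0) \<in> cont_funs" by (simp add: cont_funs_def)
  obtain u u' where "\<And>e. H2_derivs (len G e) (u e) (u' e) (\<lambda>x. of_real (bounded_q e x + shift) * u e x - 0)"
    "\<And>e. u e 0 = a" "\<And>e. u' e 0 = b"
    by (rule edge_solutions[OF 0, where a = a and b = b]) (rule that; assumption)
  then show ?thesis unfolding diff_0_right by (rule that)
qed

text \<open>
  The two parts of the boundary condition lie in the orthogonal spaces \<open>ran P\<close> and \<open>ker P\<close>, so they can be added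
  to one equation in the space of all boundary vectors. The dimension of this space is the number of initial
  data, two for each edge.
\<close>

definition boundary_defect :: "'e graph_fun \<Rightarrow> 'e end_vec" where
  "boundary_defect f = P (trace_vec G f) + (normal_deriv_vec G f - P (normal_deriv_vec G f)) - A (trace_vec G f)"

lemma boundary_defect_eq_0_iff: "boundary_defect f = 0 \<longleftrightarrow> boundary_cond f"
proof
  assume 0: "boundary_defect f = 0"
  have "P (boundary_defect f) = P (trace_vec G f)"
    unfolding boundary_defect_def by (simp add: hermitian_op_add[OF P] hermitian_op_diff[OF P] P_idem PA)
  then have "P (trace_vec G f) = 0" using 0 hermitian_op_zero[OF P] by simp
  then show "boundary_cond f" using 0 unfolding boundary_defect_def boundary_cond_def by simp
qed (simp add: boundary_defect_def boundary_cond_def)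

lemma boundary_defect_add: "f \<in> H2_graph G \<Longrightarrow> g \<in> H2_graph G \<Longrightarrow> boundary_defect (f + g) = boundary_defect f + boundary_defect g"
  by (simp add: boundary_defect_def trace_vec_add normal_deriv_vec_add hermitian_op_add[OF P] hermitian_op_add[OF A])

lemma boundary_defect_scaleR: "f \<in> H2_graph G \<Longrightarrow> boundary_defect (r *\<^sub>R f) = r *\<^sub>R boundary_defect f"
  by (simp add: boundary_defect_def trace_vec_scaleR normal_deriv_vec_scaleR hermitian_op_scaleR[OF P] hermitian_op_scaleR[OF A]
      scaleR_add_right scaleR_diff_right)

definition restrict_graph :: "'e graph_fun \<Rightarrow> 'e graph_fun" where
  "restrict_graph f e x = (if x \<in> {0..len G e} then f e x else 0)"

lemma restrict_graph_H2:
  assumes "\<And>e. H2_derivs (len G e) (f e) (f' e) (h e)"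
  shows "restrict_graph f \<in> H2_graph G"
    "H2_derivs (len G e) (restrict_graph f e) (edge_deriv G (restrict_graph f) e) (h e)"
    "x \<in> {0..len G e} \<Longrightarrow> edge_deriv G (restrict_graph f) e x = f' e x"
proof -
  have H: "H2_derivs (len G e) (restrict_graph f e) (f' e) (h e)" for e
    by (rule H2_derivs_cong[OF assms len_nonneg]) (auto simp: restrict_graph_def)
  show "restrict_graph f \<in> H2_graph G"
    unfolding H2_graph_def using H by (auto simp: restrict_graph_def)
  show d: "edge_deriv G (restrict_graph f) e x = f' e x" if "x \<in> {0..len G e}" for e x
    by (rule edge_deriv_eq[of e "restrict_graph f" "f' e" "h e", OF H that])
  show "H2_derivs (len G e) (restrict_graph f e) (edge_deriv G (restrict_graph f) e) (h e)"
    by (rule H2_derivs_cong[OF H len_nonneg]) (auto simp: d)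
qed

text \<open>
  Add to a particular solution of the equation the solution \<open>s z\<close> of the homogeneous equation with initial data
  \<open>z\<close> (the component of \<open>z\<close> at \<open>(e, False)\<close> is the value and that at \<open>(e, True)\<close> the derivative at the
  start of \<open>e\<close>). The boundary defect of \<open>s z\<close> depends linearly on \<open>z\<close>, and injectively: a homogeneous solution that
  satisfies the boundary condition is 0 as the shifted form is positive. Hence \<open>z\<close> can be chosen to
  cancel the defect of the particular solution.
\<close>

lemma solves_exists:
  assumes w: "w \<in> cont_funs"
  shows "\<exists>f. solves f w"
proof -
  obtain y y' where
    y: "\<And>e. H2_derivs (len G e) (y e) (y' e) (\<lambda>x. of_real (bounded_q e x + shift) * y e x - w e x)"
      "\<And>e. y e 0 = 0" "\<And>e. y' e 0 = 0"
    by (rule edge_solutions[OF w, where a = 0 and b = 0]) (rule that; assumption)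
  obtain \<phi> \<phi>' where \<phi>: "\<And>e. H2_derivs (len G e) (\<phi> e) (\<phi>' e) (\<lambda>x. of_real (bounded_q e x + shift) * \<phi> e x)"
      "\<And>e. \<phi> e 0 = 1" "\<And>e. \<phi>' e 0 = 0"
    by (rule homogeneous_edge_solutions[where a = 1 and b = 0]) (rule that; assumption)
  obtain \<psi> \<psi>' where \<psi>: "\<And>e. H2_derivs (len G e) (\<psi> e) (\<psi>' e) (\<lambda>x. of_real (bounded_q e x + shift) * \<psi> e x)"
      "\<And>e. \<psi> e 0 = 0" "\<And>e. \<psi>' e 0 = 1"
    by (rule homogeneous_edge_solutions[where a = 0 and b = 1]) (rule that; assumption)
  define Y where "Y = restrict_graph y"
  have Y: "Y \<in> H2_graph G" "\<And>e. H2_derivs (len G e) (Y e) (edge_deriv G Y e) (\<lambda>x. of_real (bounded_q e x + shift) * y e x - w e x)"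
    unfolding Y_def by (rule restrict_graph_H2(1,2)[OF y(1)])+
  define s :: "'e end_vec \<Rightarrow> 'e graph_fun" where "s z = restrict_graph (\<lambda>e x. z $ (e, False) * \<phi> e x + z $ (e, True) * \<psi> e x)" for z
  have s0: "H2_derivs (len G e) (\<lambda>x. z $ (e, False) * \<phi> e x + z $ (e, True) * \<psi> e x)
      (\<lambda>x. z $ (e, False) * \<phi>' e x + z $ (e, True) * \<psi>' e x)
      (\<lambda>x. z $ (e, False) * (of_real (bounded_q e x + shift) * \<phi> e x) + z $ (e, True) * (of_real (bounded_q e x + shift) * \<psi> e x))" for z e
    using H2_derivs_add[OF H2_derivs_scale[OF \<phi>(1)] H2_derivs_scale[OF \<psi>(1)]] by (simp add: plus_fun_def)
  have s_H2: "s z \<in> H2_graph G" for z unfolding s_def by (rule restrict_graph_H2(1)[OF s0])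
  have s_der: "H2_derivs (len G e) (s z e) (edge_deriv G (s z) e)
      (\<lambda>x. z $ (e, False) * (of_real (bounded_q e x + shift) * \<phi> e x) + z $ (e, True) * (of_real (bounded_q e x + shift) * \<psi> e x))" for z e
    unfolding s_def by (rule restrict_graph_H2(2)[OF s0])
  have s_init: "s z e 0 = z $ (e, False)" "edge_deriv G (s z) e 0 = z $ (e, True)" for z e
  proof -
    show "s z e 0 = z $ (e, False)" using len_nonneg[of e] \<phi> \<psi> by (simp add: s_def restrict_graph_def)
    have "edge_deriv G (s z) e 0 = z $ (e, False) * \<phi>' e 0 + z $ (e, True) * \<psi>' e 0"
      unfolding s_def by (rule restrict_graph_H2(3)[OF s0]) (simp add: len_nonneg)
    then show "edge_deriv G (s z) e 0 = z $ (e, True)" using \<phi> \<psi> by simp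
  qed
  have s_lin: "s (z + z') = s z + s z'" "s (r *\<^sub>R z) = r *\<^sub>R s z" for z z' r
    by (auto simp: s_def restrict_graph_def fun_eq_iff distrib_right scaleR_add_right)
  define M where "M = (\<lambda>z. boundary_defect (s z))"
  have lin: "linear M"
    unfolding M_def by (intro linearI) (simp_all add: s_lin boundary_defect_add boundary_defect_scaleR s_H2)
  have "inj M"
    unfolding linear_injective_0[OF lin]
  proof (intro allI impI)
    fix z assume "M z = 0"
    then have "boundary_cond (s z)" by (simp add: M_def boundary_defect_eq_0_iff)
    then have s0: "solves (s z) 0"
      unfolding solves_def
    proof (intro conjI allI s_H2)
      fix e
      show "\<exists>h. H2_derivs (len G e) (s z e) (edge_deriv G (s z) e) h \<and>
        (AE x in lebesgue_on {0..len G e}. 0 e x = - h x + of_real (bounded_q e x + shift) * s z e x)"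
        using s_der[of e z]
        by (intro exI conjI, assumption) (auto intro!: AE_I2 simp: s_def restrict_graph_def algebra_simps)
    qed
    have "shifted_form (s z) (s z) = ip 0 (s z)"
      by (rule solves_weak[OF s0 _ solves_form_domain[OF s0]]) simp
    then have "s z = 0"
      using shifted_form_pos[OF solves_form_domain[OF s0]] L2.ip_zero_left[OF form_domain_cont_funs[OF solves_form_domain[OF s0]]] by fastforce
    moreover from this have "s 0 = s z" using s_lin(2)[of 0 z] by simp
    ultimately have "z $ (e, b) = 0" for e b
      using s_init[of z e] s_init[of 0 e] by (cases b) auto
    then show "z = 0" by (auto simp: vec_eq_iff)
  qed
  then have "surj M" using linear_injective_imp_surjective[OF lin] by simp
  then obtain z where z: "M z = - boundary_defect Y" by (metis surjD)
  have "solves (Y + s z) w"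
    unfolding solves_def
  proof (intro conjI allI)
    show H: "Y + s z \<in> H2_graph G" using Y s_H2 by simp
    show "boundary_cond (Y + s z)" using z Y s_H2 by (simp add: M_def boundary_defect_add flip: boundary_defect_eq_0_iff)
    fix e
    let ?h = "\<lambda>x. (of_real (bounded_q e x + shift) * y e x - w e x) +
       (z $ (e, False) * (of_real (bounded_q e x + shift) * \<phi> e x) + z $ (e, True) * (of_real (bounded_q e x + shift) * \<psi> e x))"
    have "H2_derivs (len G e) ((Y + s z) e) (edge_deriv G (Y + s z) e) ?h"
      using H2_derivs_cong[OF H2_derivs_add[OF Y(2) s_der, of e z] len_nonneg]
      by (simp add: edge_deriv_add[OF Y(1) s_H2])
    moreover have "AE x in lebesgue_on {0..len G e}. w e x = - ?h x + of_real (bounded_q e x + shift) * (Y + s z) e x"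
      by (intro AE_I2) (simp add: Y_def s_def restrict_graph_def algebra_simps)
    ultimately show "\<exists>h. H2_derivs (len G e) ((Y + s z) e) (edge_deriv G (Y + s z) e) h \<and>
        (AE x in lebesgue_on {0..len G e}. w e x = - h x + of_real (bounded_q e x + shift) * (Y + s z) e x)"
      by blast
  qed
  then show ?thesis by blast
qed

text \<open>
  \<open>(H + shift)\<^sup>-\<^sup>1\<close>; for continuous \<open>w\<close> the solution exists and is unique.
\<close>

definition resolvent :: "'e graph_fun \<Rightarrow> 'e graph_fun" where
  "resolvent w = (SOME f. solves f w)"

lemma solves_res: "w \<in> cont_funs \<Longrightarrow> solves (resolvent w) w"
  unfolding resolvent_def by (rule someI_ex[OF solves_exists])

lemma resolvent_form_domain: "w \<in> cont_funs \<Longrightarrow> resolvent w \<in> form_domain" and resolvent_weak: "w \<in> cont_funs \<Longrightarrow> \<phi> \<in> form_domain \<Longrightarrow> shifted_form (resolvent w) \<phi> = ip w \<phi>"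
  using solves_res solves_form_domain solves_weak by blast+

lemma resolvent_unique: "w \<in> cont_funs \<Longrightarrow> f \<in> form_domain \<Longrightarrow> (\<And>\<phi>. \<phi> \<in> form_domain \<Longrightarrow> shifted_form f \<phi> = ip w \<phi>) \<Longrightarrow> resolvent w = f"
  by (rule weak_unique[OF resolvent_form_domain]) (auto simp: resolvent_weak)

lemma resolvent_cont_funs: "w \<in> cont_funs \<Longrightarrow> resolvent w \<in> cont_funs"
  using resolvent_form_domain form_domain_cont_funs by blast

lemma resolvent_add: "v \<in> cont_funs \<Longrightarrow> w \<in> cont_funs \<Longrightarrow> resolvent (v + w) = resolvent v + resolvent w"
  by (rule resolvent_unique) (auto simp: resolvent_form_domain form_space.ip_add_left resolvent_weak L2.ip_add_left form_domain_cont_funs)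

lemma resolvent_scale: "w \<in> cont_funs \<Longrightarrow> resolvent (r *\<^sub>R w) = r *\<^sub>R resolvent w"
  by (rule resolvent_unique) (auto simp: resolvent_form_domain form_space.ip_scale_left resolvent_weak L2.ip_scale_left form_domain_cont_funs)

lemma ip_resolvent: "v \<in> cont_funs \<Longrightarrow> w \<in> cont_funs \<Longrightarrow> ip v (resolvent w) = shifted_form (resolvent v) (resolvent w)"
  by (simp add: resolvent_weak resolvent_form_domain)

lemma resolvent_sym: "v \<in> cont_funs \<Longrightarrow> w \<in> cont_funs \<Longrightarrow> ip (resolvent v) w = ip v (resolvent w)"
  by (metis ip_resolvent L2.ip_sym resolvent_cont_funs form_space.ip_sym resolvent_form_domain)

lemma resolvent_nonneg: "w \<in> cont_funs \<Longrightarrow> 0 \<le> ip (resolvent w) w"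
  by (simp add: resolvent_sym ip_resolvent form_space.ip_nonneg resolvent_form_domain)

lemma resolvent_bounds:
  assumes w: "w \<in> cont_funs"
  shows "ip (resolvent w) (resolvent w) \<le> ip w w" "ip (edge_deriv G (resolvent w)) (edge_deriv G (resolvent w)) \<le> 2 * ip w w" "ip (resolvent w) w \<le> 1 * ip w w"
proof -
  let ?f = "resolvent w"
  note f = resolvent_cont_funs[OF w] form_domain_H2[OF resolvent_form_domain[OF w]]
  have c: "(1/2) * ip (edge_deriv G ?f) (edge_deriv G ?f) + ip ?f ?f \<le> ip w ?f"
    using shifted_form_coercive[OF f(2)] by (simp add: ip_resolvent w)
  have cs: "ip w ?f \<le> L2.nrm w * L2.nrm ?f" using L2.ip_le_nrm[OF w f(1)] by simp
  have n: "0 \<le> L2.nrm w" "0 \<le> L2.nrm ?f" using L2.nrm_nonneg w f by auto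
  have d: "0 \<le> ip (edge_deriv G ?f) (edge_deriv G ?f)" by (rule ip_deriv_nonneg[OF f(2)])
  have "L2.nrm ?f * L2.nrm ?f \<le> L2.nrm w * L2.nrm ?f"
    using c cs d L2.nrm_square[OF f(1)] by (simp add: power2_eq_square)
  then have le: "L2.nrm ?f \<le> L2.nrm w" using n by (cases "L2.nrm ?f = 0") auto
  show "ip ?f ?f \<le> ip w w"
    using power_mono[OF le n(2), of 2] L2.nrm_square w f by simp
  have "L2.nrm w * L2.nrm ?f \<le> L2.nrm w * L2.nrm w" using le n by (intro mult_left_mono) auto
  then have *: "ip w ?f \<le> ip w w" using cs L2.nrm_square[OF w] by (simp add: power2_eq_square)
  then show "ip (edge_deriv G ?f) (edge_deriv G ?f) \<le> 2 * ip w w" using c L2.ip_nonneg[OF f(1)] by simp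
  show "ip ?f w \<le> 1 * ip w w" using * L2.ip_sym[OF f(1) w] by simp
qed

lemma resolvent_null:
  assumes w: "w \<in> cont_funs" "ip w w = 0"
  shows "resolvent w = 0"
proof (rule ccontr)
  assume "resolvent w \<noteq> 0"
  then show False using ip_pos[OF form_domain_H2[OF resolvent_form_domain[OF w(1)]]] resolvent_bounds(1)[OF w(1)] w(2) by simp
qed

end

section \<open>Compactness and the spectral gap\<close>

context graph_operator begin

text \<open>
  The bound on \<open>\<integral> |f'|\<^sup>2\<close> makes the functions \<open>resolvent (u n)\<close> uniformly Hoelder continuous of order \<open>1/2\<close>, and
  the trace inequality makes them uniformly bounded. Parametrizing every edge by \<open>[0,1]\<close> turns the family over the
  edges into one vector-valued function, so that a single application of the Arzela-Ascoli theorem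
  suffices.
\<close>

lemma resolvent_compact:
  fixes u :: "nat \<Rightarrow> 'e graph_fun"
  assumes u: "\<And>n. u n \<in> cont_funs \<and> ip (u n) (u n) \<le> 1"
  shows "\<exists>r g. strict_mono r \<and> g \<in> cont_funs \<and> (\<lambda>n. ip (resolvent (u (r n)) - g) (resolvent (u (r n)) - g)) \<longlonglongrightarrow> 0"
proof -
  define f where "f = (\<lambda>n. resolvent (u n))"
  have fH: "f n \<in> H2_graph G" and fX: "f n \<in> cont_funs" for n
    unfolding f_def using u resolvent_form_domain form_domain_H2 resolvent_cont_funs by blast+
  have D: "ip (edge_deriv G (f n)) (edge_deriv G (f n)) \<le> 2" and I: "ip (f n) (f n) \<le> 1" for n
    unfolding f_def using resolvent_bounds(1,2)[of "u n"] u[of n] by auto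
  have edge: "integral {0..len G e} (\<lambda>x. g e x \<bullet> g e x) \<le> ip g g" if "g \<in> cont_funs" for g e
    unfolding ip_def
    by (rule member_le_sum) (auto intro!: Henstock_Kurzweil_Integration.integral_nonneg cont_funs_integrable that)
  have hoelder: "cmod (f n e y - f n e x) \<le> sqrt (2 * \<bar>y - x\<bar>)" if "x \<in> {0..len G e}" "y \<in> {0..len G e}" for n e x y
  proof -
    have le: "(cmod (f n e b - f n e a))\<^sup>2 \<le> 2 * (b - a)" if ab: "0 \<le> a" "a \<le> b" "b \<le> len G e" for a b
    proof -
      have "(cmod (f n e b - f n e a))\<^sup>2 \<le> (b - a) * integral {0..len G e} (\<lambda>x. edge_deriv G (f n) e x \<bullet> edge_deriv G (f n) e x)"
        by (rule C1_Hoelder[OF H2_graph_C1[OF fH] ab])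
      also have "\<dots> \<le> (b - a) * 2"
        using edge[OF H2_graph_cont_funs(2)[OF fH[of n]], of e] D[of n] ab by (intro mult_left_mono) auto
      finally show ?thesis by simp
    qed
    have "(cmod (f n e y - f n e x))\<^sup>2 \<le> 2 * \<bar>y - x\<bar>"
      using le[of x y] le[of y x] that by (cases "x \<le> y") (auto simp: norm_minus_commute)
    then show ?thesis by (rule real_le_rsqrt)
  qed
  define L where "L = (\<Sum>e\<in>UNIV. len G e)"
  have L: "len G e \<le> L" for e
    unfolding L_def by (intro member_le_sum) (auto simp: len_nonneg)
  have L0: "L > 0" using len_pos[of undefined] L[of undefined] by linarith
  define M where "M = sqrt (3 + (\<Sum>e\<in>UNIV. 1 / len G e)) + sqrt (2 * L)"
  have bound: "cmod (f n e x) \<le> M" if x: "x \<in> {0..len G e}" for n e x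
  proof -
    have "1 / len G e \<le> (\<Sum>e\<in>UNIV. 1 / len G e)" by (intro member_le_sum) (auto simp: len_nonneg)
    have "(cmod (f n e 0))\<^sup>2 \<le> (1 / len G e + 1 / 1) * integral {0..len G e} (\<lambda>x. f n e x \<bullet> f n e x)
        + 1 * integral {0..len G e} (\<lambda>x. edge_deriv G (f n) e x \<bullet> edge_deriv G (f n) e x)"
      by (rule C1_trace_bound[OF len_pos H2_graph_C1[OF fH]]) auto
    also have "\<dots> \<le> (1 / len G e + 1 / 1) * 1 + 1 * 2"
      using edge[OF H2_graph_cont_funs(2)[OF fH[of n]], of e] D[of n] edge[OF fX[of n], of e] I[of n] len_nonneg[of e]
      by (intro add_mono mult_left_mono) auto
    also have "\<dots> \<le> 3 + (\<Sum>e\<in>UNIV. 1 / len G e)"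
      using \<open>1 / len G e \<le> (\<Sum>e\<in>UNIV. 1 / len G e)\<close> by simp
    finally have "cmod (f n e 0) \<le> sqrt (3 + (\<Sum>e\<in>UNIV. 1 / len G e))" by (rule real_le_rsqrt)
    moreover have "cmod (f n e x - f n e 0) \<le> sqrt (2 * L)"
    proof -
      have "cmod (f n e x - f n e 0) \<le> sqrt (2 * \<bar>x - 0\<bar>)" by (rule hoelder) (use x len_nonneg[of e] in auto)
      also have "\<dots> \<le> sqrt (2 * L)" using x L[of e] by simp
      finally show ?thesis .
    qed
    ultimately show ?thesis
      unfolding M_def using norm_triangle_ineq[of "f n e 0" "f n e x - f n e 0"] by simp
  qed
  \<comment> \<open>edge \<open>e\<close> parametrized by \<open>[0,1]\<close>, for all edges simultaneously\<close>
  define F :: "nat \<Rightarrow> real \<Rightarrow> complex ^ 'e" where "F n t = (\<chi> e. f n e (t * len G e))" for n t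
  have tlen: "t * len G e \<in> {0..len G e}" if "t \<in> {0..1}" for t e
    using that len_pos[of e] by (auto intro: mult_left_le_one_le)
  have norm_le: "norm v \<le> real CARD('e) * K" if "\<And>e. cmod (v $ e) \<le> K" for v :: "complex ^ 'e" and K
  proof -
    have "norm v \<le> (\<Sum>e\<in>UNIV. norm (v $ e))" unfolding norm_vec_def by (rule L2_set_le_sum) simp
    also have "\<dots> \<le> real CARD('e) * K" by (rule sum_bounded_above) (rule that)
    finally show ?thesis .
  qed
  obtain g r where g: "continuous_on {0..1} g" and r: "strict_mono (r :: nat \<Rightarrow> nat)"
    and lim: "\<And>\<epsilon>. 0 < \<epsilon> \<Longrightarrow> \<exists>N. \<forall>n x. n \<ge> N \<and> x \<in> {0..1} \<longrightarrow> norm (F (r n) x - g x) < \<epsilon>"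
  proof (rule Arzela_Ascoli[of "{0..1::real}" F "real CARD('e) * M"])
    show "compact {0..1::real}" by simp
    show "norm (F n x) \<le> real CARD('e) * M" if "x \<in> {0..1}" for n x
      by (rule norm_le) (simp add: F_def bound tlen that del: atLeastAtMost_iff)
    fix x \<epsilon> :: real assume x: "x \<in> {0..1}" and \<epsilon>: "0 < \<epsilon>"
    define \<eta> where "\<eta> = \<epsilon> / (2 * real CARD('e))"
    have \<eta>: "\<eta> > 0" using \<epsilon> by (simp add: \<eta>_def)
    show "\<exists>d>0. \<forall>n y. y \<in> {0..1} \<and> norm (x - y) < d \<longrightarrow> norm (F n x - F n y) < \<epsilon>"
    proof (intro exI[of _ "\<eta>\<^sup>2 / (2 * L)"] conjI allI impI)
      show "0 < \<eta>\<^sup>2 / (2 * L)" using \<eta> L0 by simp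
      fix n y assume y: "y \<in> {0..1} \<and> norm (x - y) < \<eta>\<^sup>2 / (2 * L)"
      have "norm (F n x - F n y) \<le> real CARD('e) * \<eta>"
      proof (rule norm_le)
        fix e
        have "cmod ((F n x - F n y) $ e) \<le> sqrt (2 * \<bar>x * len G e - y * len G e\<bar>)"
          using hoelder[OF tlen tlen] x y by (simp add: F_def)
        also have "\<bar>x * len G e - y * len G e\<bar> = \<bar>x - y\<bar> * len G e"
          using len_nonneg[of e] by (simp add: abs_mult flip: left_diff_distrib)
        also have "sqrt (2 * (\<bar>x - y\<bar> * len G e)) \<le> sqrt (2 * (\<eta>\<^sup>2 / (2 * L) * L))"
          using y L[of e] len_nonneg[of e] L0 by (intro real_sqrt_le_mono mult_left_mono mult_mono) auto
        also have "\<dots> = \<eta>" using L0 \<eta> by simp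
        finally show "cmod ((F n x - F n y) $ e) \<le> \<eta>" .
      qed
      also have "\<dots> = \<epsilon> / 2" by (simp add: \<eta>_def)
      also have "\<dots> < \<epsilon>" using \<epsilon> by simp
      finally show "norm (F n x - F n y) < \<epsilon>" .
    qed
  qed blast
  define gg :: "'e graph_fun" where "gg e x = g (x / len G e) $ e" for e x
  have xdiv: "x / len G e \<in> {0..1}" if "x \<in> {0..len G e}" for x e
    using that len_pos[of e] by auto
  have ggX: "gg \<in> cont_funs"
    unfolding cont_funs_def
  proof (intro CollectI allI)
    fix e
    have "continuous_on {0..len G e} (\<lambda>x. g (x / len G e))"
      by (rule continuous_on_compose2[OF g]) (use len_pos[of e] xdiv[of _ e] in \<open>auto intro!: continuous_intros\<close>)
    then show "continuous_on {0..len G e} (gg e)"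
      unfolding gg_def by (intro continuous_intros)
  qed
  have "(\<lambda>n. ip (f (r n) - gg) (f (r n) - gg)) \<longlonglongrightarrow> 0"
  proof (rule LIMSEQ_I)
    fix \<epsilon> :: real assume \<epsilon>: "0 < \<epsilon>"
    define \<eta> where "\<eta> = sqrt (\<epsilon> / (2 * L))"
    have \<eta>: "\<eta> > 0" "\<eta>\<^sup>2 = \<epsilon> / (2 * L)" using \<epsilon> L0 by (auto simp: \<eta>_def)
    obtain N where N: "\<And>n x. n \<ge> N \<Longrightarrow> x \<in> {0..1} \<Longrightarrow> norm (F (r n) x - g x) < \<eta>"
      using lim[OF \<eta>(1)] by blast
    have "ip (f (r n) - gg) (f (r n) - gg) < \<epsilon>" if n: "n \<ge> N" for n
    proof -
      let ?d = "f (r n) - gg"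
      have dX: "?d \<in> cont_funs" using fX ggX by simp
      have pt: "?d e x \<bullet> ?d e x \<le> \<eta>\<^sup>2" if x: "x \<in> {0..len G e}" for e x
      proof -
        have "?d e x = (F (r n) (x / len G e) - g (x / len G e)) $ e"
          using len_pos[of e] by (simp add: F_def gg_def)
        then have "cmod (?d e x) \<le> norm (F (r n) (x / len G e) - g (x / len G e))"
          by (simp only: Finite_Cartesian_Product.norm_nth_le)
        also have "\<dots> \<le> \<eta>" using N[OF n xdiv[OF x]] by simp
        finally show ?thesis by (simp add: power_mono flip: power2_norm_eq_inner)
      qed
      have "ip ?d ?d \<le> (\<Sum>e\<in>UNIV. len G e * \<eta>\<^sup>2)"
        unfolding ip_def
      proof (rule sum_mono)
        fix e
        have "integral {0..len G e} (\<lambda>x. ?d e x \<bullet> ?d e x) \<le> integral {0..len G e} (\<lambda>x. \<eta>\<^sup>2)"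
          by (rule integral_le[OF cont_funs_integrable[OF dX dX]]) (use pt in auto)
        also have "\<dots> = len G e * \<eta>\<^sup>2" using len_nonneg[of e] by simp
        finally show "integral {0..len G e} (\<lambda>x. ?d e x \<bullet> ?d e x) \<le> len G e * \<eta>\<^sup>2" .
      qed
      also have "\<dots> = L * \<eta>\<^sup>2" by (simp add: L_def sum_distrib_right)
      also have "\<dots> = \<epsilon> / 2" using \<eta> L0 by simp
      finally show ?thesis using \<epsilon> by simp
    qed
    moreover have "0 \<le> ip (f (r n) - gg) (f (r n) - gg)" for n
      using fX ggX by (intro L2.ip_nonneg) simp
    ultimately show "\<exists>no. \<forall>n\<ge>no. norm (ip (f (r n) - gg) (f (r n) - gg) - 0) < \<epsilon>"
      by (intro exI[of _ N]) simp
  qed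
  then show ?thesis using r ggX unfolding f_def by blast
qed

abbreviation schroedinger_op :: "('e graph_fun \<times> 'e graph_fun) set" where
  "schroedinger_op \<equiv> schroedinger G q B"

lemma eigenspace_iff: "f \<in> eigenspace schroedinger_op \<theta> \<longleftrightarrow> solves f ((\<theta> + shift) *\<^sub>R f)"
  unfolding eigenspace_def solves_iff_schroedinger[symmetric]
  by (simp add: gscale_of_real scaleR_add_left)

lemma eigenspace_form_domain: "f \<in> eigenspace schroedinger_op \<theta> \<Longrightarrow> f \<in> form_domain"
  unfolding eigenspace_iff by (rule solves_form_domain)

lemma eigenspace_weak:
  assumes "f \<in> eigenspace schroedinger_op \<theta>" "\<phi> \<in> form_domain"
  shows "form f \<phi> = \<theta> * ip f \<phi>"
  using solves_weak[of f "(\<theta> + shift) *\<^sub>R f" \<phi>] assms form_domain_cont_funs[OF eigenspace_form_domain[OF assms(1)]] form_domain_cont_funs[OF assms(2)]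
  unfolding eigenspace_iff by (simp add: shifted_form_def L2.ip_scale_left L2.ip_add_left algebra_simps)

text \<open>
  On the orthogonal complement of the eigenspaces for \<open>S\<close>, the resolvent has a top eigenvector
  \<open>\<phi>\<close>, with eigenvalue \<open>\<mu>\<close>. It is an eigenfunction for \<open>1/\<mu> - shift\<close>, which is not in \<open>S\<close>, as \<open>\<phi>\<close> would
  otherwise be orthogonal to itself. With \<open>a\<close> for the shifted form and \<open>K\<close> for the resolvent,
  \<open>\<parallel>f\<parallel>\<^sup>4 = a(K f, f)\<^sup>2 \<le> a(K f, K f) a(f, f) = \<langle>f, K f\<rangle> a(f, f) \<le> \<mu> \<parallel>f\<parallel>\<^sup>2 a(f, f)\<close>.
\<close>

lemma spectral_gap:
  assumes f: "f \<in> form_domain" "f \<noteq> 0"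
    and orth: "\<And>\<theta> t. \<theta> \<in> S \<Longrightarrow> t \<in> eigenspace schroedinger_op \<theta> \<Longrightarrow> ip f t = 0"
  obtains \<theta> where "\<theta> \<notin> S" "form f f \<ge> \<theta> * ip f f"
proof -
  define T where "T = (\<Union>\<theta>\<in>S. eigenspace schroedinger_op \<theta>)"
  have TX: "T \<subseteq> cont_funs" unfolding T_def using eigenspace_form_domain form_domain_cont_funs by blast
  have T_eig: "\<exists>\<nu>. resolvent t = \<nu> *\<^sub>R t" if t: "t \<in> T" for t
  proof -
    obtain \<theta> where "t \<in> eigenspace schroedinger_op \<theta>" using t unfolding T_def by blast
    then have s: "solves t ((\<theta> + shift) *\<^sub>R t)" by (simp add: eigenspace_iff)
    have tF: "t \<in> form_domain" "t \<in> cont_funs" using solves_form_domain[OF s] form_domain_cont_funs by auto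
    have w: "shifted_form t \<phi> = (\<theta> + shift) * ip t \<phi>" if "\<phi> \<in> form_domain" for \<phi>
      using solves_weak[OF s _ that] tF form_domain_cont_funs[OF that] by (simp add: L2.ip_scale_left)
    show ?thesis
    proof (cases "\<theta> + shift = 0")
      case True
      then have "t = 0" using w[OF tF(1)] shifted_form_pos[OF tF(1)] by fastforce
      then show ?thesis using resolvent_scale[OF tF(2), of 0] by auto
    next
      case False
      have "resolvent t = (1 / (\<theta> + shift)) *\<^sub>R t"
        by (rule resolvent_unique) (use tF False w form_domain_cont_funs in \<open>auto simp: form_space.ip_scale_left\<close>)
      then show ?thesis by blast
    qed
  qed
  have fX: "f \<in> cont_funs" using form_domain_cont_funs f by blast
  have fp: "ip f f > 0" using ip_pos f form_domain_H2 by blast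
  have fW: "f \<in> {x \<in> cont_funs. \<forall>t\<in>T. ip x t = 0}" using fX orth unfolding T_def by blast
  have rp: "ip (resolvent f) f > 0"
  proof -
    have "resolvent f \<noteq> 0"
    proof
      assume "resolvent f = 0"
      then show False using resolvent_weak[OF fX f(1)] form_space.ip_zero_left[OF f(1)] fp by simp
    qed
    then show ?thesis using shifted_form_pos[OF resolvent_form_domain[OF fX]] by (simp add: resolvent_sym ip_resolvent fX)
  qed
  obtain \<mu> \<phi> where \<mu>: "\<mu> > 0" and \<phi>W: "\<phi> \<in> {x \<in> cont_funs. \<forall>t\<in>T. ip x t = 0}" and \<phi>: "resolvent \<phi> = \<mu> *\<^sub>R \<phi>" "ip \<phi> \<phi> > 0"
    and upper: "\<And>x. x \<in> {x \<in> cont_funs. \<forall>t\<in>T. ip x t = 0} \<Longrightarrow> ip (resolvent x) x \<le> \<mu> * ip x x"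
    by (rule L2.compact_symmetric_top_eigenvector[OF resolvent_cont_funs resolvent_add resolvent_scale resolvent_sym resolvent_nonneg resolvent_bounds(3) resolvent_null resolvent_compact TX T_eig refl fW rp])
       blast+
  have \<phi>cont_funs: "\<phi> \<in> cont_funs" using \<phi>W by simp
  have "solves (\<mu> *\<^sub>R \<phi>) \<phi>" using solves_res[OF \<phi>cont_funs] \<phi>(1) by simp
  then have "solves ((1 / \<mu>) *\<^sub>R (\<mu> *\<^sub>R \<phi>)) ((1 / \<mu>) *\<^sub>R \<phi>)" by (rule solves_scaleR)
  then have eig: "\<phi> \<in> eigenspace schroedinger_op (1 / \<mu> - shift)" using \<mu> by (simp add: eigenspace_iff)
  have "1 / \<mu> - shift \<notin> S"
  proof
    assume "1 / \<mu> - shift \<in> S"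
    then have "\<phi> \<in> T" unfolding T_def using eig by blast
    then show False using \<phi>W \<phi>(2) by auto
  qed
  moreover have "form f f \<ge> (1 / \<mu> - shift) * ip f f"
  proof -
    have "(ip f f)\<^sup>2 = (shifted_form (resolvent f) f)\<^sup>2" by (simp add: resolvent_weak fX f)
    also have "\<dots> \<le> shifted_form (resolvent f) (resolvent f) * shifted_form f f"
      by (rule form_space.Cauchy_Schwarz_ineq[OF resolvent_form_domain[OF fX] f(1)])
    also have "\<dots> \<le> (\<mu> * ip f f) * shifted_form f f"
      using upper[OF fW] form_space.ip_nonneg[OF f(1)] by (intro mult_right_mono) (simp_all add: resolvent_sym ip_resolvent fX)
    finally have "ip f f * ip f f \<le> ip f f * (\<mu> * shifted_form f f)" by (simp add: power2_eq_square mult_ac)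
    then have "ip f f \<le> \<mu> * shifted_form f f" using fp by simp
    then have "ip f f / \<mu> \<le> shifted_form f f" using \<mu> by (simp add: field_simps)
    then show ?thesis by (simp add: shifted_form_def algebra_simps)
  qed
  ultimately show ?thesis using that by blast
qed

end

section \<open>Counting eigenvalues\<close>

context graph_potential begin

text \<open>
  The complex inner product, antilinear in the first argument, recovered from its real part \<open>ip\<close>.
  Multiplicities are complex dimensions, so the orthogonality conditions have to be counted as
  complex linear equations.
\<close>

definition complex_ip :: "'e graph_fun \<Rightarrow> 'e graph_fun \<Rightarrow> complex" where
  "complex_ip f g = Complex (ip f g) (ip (gscale \<i> f) g)"

lemma cont_funs_gscale: "f \<in> cont_funs \<Longrightarrow> gscale c f \<in> cont_funs"
  by (auto simp: cont_funs_def gscale_def intro!: continuous_intros)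

lemma gscale_complex: "gscale c f = Re c *\<^sub>R f + Im c *\<^sub>R gscale \<i> f"
proof -
  have "c * z = Re c *\<^sub>R z + Im c *\<^sub>R (\<i> * z)" for z
    by (simp add: complex_eq_iff)
  then show ?thesis by (simp add: fun_eq_iff gscale_def)
qed

lemma ip_gscale_i: "ip f (gscale \<i> g) = - ip (gscale \<i> f) g" "ip (gscale \<i> f) (gscale \<i> g) = ip f g"
proof -
  have "integral {0..len G e} (\<lambda>x. f e x \<bullet> gscale \<i> g e x) = - integral {0..len G e} (\<lambda>x. gscale \<i> f e x \<bullet> g e x)" for e
    unfolding integral_neg[symmetric] by (intro Henstock_Kurzweil_Integration.integral_cong) (simp add: gscale_def inner_complex_def)
  then show "ip f (gscale \<i> g) = - ip (gscale \<i> f) g" by (simp add: ip_def sum_negf)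
  show "ip (gscale \<i> f) (gscale \<i> g) = ip f g"
    by (simp add: ip_def gscale_def inner_complex_def add.commute)
qed

lemma complex_ip_add: "f \<in> cont_funs \<Longrightarrow> g \<in> cont_funs \<Longrightarrow> k \<in> cont_funs \<Longrightarrow> complex_ip f (g + k) = complex_ip f g + complex_ip f k"
  by (simp add: complex_ip_def L2.ip_add_right cont_funs_gscale complex_eq_iff)

lemma complex_ip_gscale: "f \<in> cont_funs \<Longrightarrow> g \<in> cont_funs \<Longrightarrow> complex_ip f (gscale c g) = c * complex_ip f g"
  by (subst gscale_complex)
     (simp add: complex_ip_def L2.ip_add_right L2.ip_scale_right cont_funs_gscale ip_gscale_i L2.ip_minus_left complex_eq_iff)

lemma complex_ip_cnj: "f \<in> cont_funs \<Longrightarrow> g \<in> cont_funs \<Longrightarrow> complex_ip g f = cnj (complex_ip f g)"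
  using ip_gscale_i(1)[of f g] L2.ip_sym[of g f] L2.ip_sym[of "gscale \<i> g" f]
  by (simp add: complex_ip_def complex_eq_iff cont_funs_gscale)

lemma Re_complex_ip: "Re (complex_ip f g) = ip f g"
  by (simp add: complex_ip_def)

end

context graph_operator begin

lemma form_domain_gscale: "f \<in> form_domain \<Longrightarrow> gscale c f \<in> form_domain"
  by (simp add: form_domain_def trace_vec_gscale hermitian_op_mult[OF P])

lemma graph_subspace_form_domain: "graph_fun.subspace form_domain"
  using subspace_form_domain unfolding graph_fun.subspace_def by (auto simp: form_domain_gscale subspace_0 subspace_add)

lemma eigenspace_subspace: "graph_fun.subspace (eigenspace schroedinger_op \<theta>)"
proof -
  have "solves 0 ((\<theta> + shift) *\<^sub>R 0)"
    using solves_res[of 0] resolvent_null[of 0] L2.ip_zero_left[of 0] by simp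
  moreover have "solves (f + g) ((\<theta> + shift) *\<^sub>R (f + g))"
    if "solves f ((\<theta> + shift) *\<^sub>R f)" "solves g ((\<theta> + shift) *\<^sub>R g)" for f g
    using solves_add[OF that] by (simp add: scaleR_add_right)
  moreover have "solves (gscale c f) ((\<theta> + shift) *\<^sub>R gscale c f)" if "solves f ((\<theta> + shift) *\<^sub>R f)" for c f
  proof -
    have "gscale c ((\<theta> + shift) *\<^sub>R f) = (\<theta> + shift) *\<^sub>R gscale c f" by (simp add: gscale_def fun_eq_iff)
    then show ?thesis using solves_gscale[OF that, of c] by simp
  qed
  ultimately show ?thesis unfolding graph_fun.subspace_def by (simp add: eigenspace_iff)
qed

lemma eigenfunction_determined_by_initial_data:
  assumes f: "f \<in> eigenspace schroedinger_op \<theta>" and zero: "\<And>e. f e 0 = 0" "\<And>e. edge_deriv G f e 0 = 0"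
  shows "f = 0"
proof (rule H2_graph_eq_0[OF form_domain_H2[OF eigenspace_form_domain[OF f]]])
  fix e x assume x: "x \<in> {0..len G e}"
  obtain h where h: "H2_derivs (len G e) (f e) (edge_deriv G f e) h"
    "AE x in lebesgue_on {0..len G e}. ((\<theta> + shift) *\<^sub>R f) e x = - h x + of_real (bounded_q e x + shift) * f e x"
    using f unfolding eigenspace_iff solves_def by blast
  show "f e x = 0"
  proof (rule ODE_zero_unique[OF len_pos _ _ _ h(1) zero _ x])
    show "0 \<le> q_bound + \<bar>\<theta>\<bar>" using q_bound(1) by simp
    show "\<bar>bounded_q e x - \<theta>\<bar> \<le> q_bound + \<bar>\<theta>\<bar>" for x using bounded_q(1)[of e x] by simp
    show "(\<lambda>x. bounded_q e x - \<theta>) \<in> borel_measurable (lebesgue_on {0..len G e})" using bounded_q(3)[of e] by measurable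
    have *: "h' = of_real (r - \<theta>) * z" if "(\<theta> + shift) *\<^sub>R z = - h' + of_real (r + shift) * z" for h' z :: complex and r
      using that by (simp add: scaleR_conv_of_real algebra_simps)
    show "AE x in lebesgue_on {0..len G e}. h x = of_real (bounded_q e x - \<theta>) * f e x"
      using h(2) unfolding scaleR_graph_fun_apply by eventually_elim (rule *)
  qed
qed

text \<open>
  There are two initial data per edge, and a nonzero eigenfunction cannot have them all equal to 0. So more than
  \<open>2 card(edges)\<close> eigenfunctions are linearly dependent. Finiteness matters because \<open>eig_mult\<close> is a
  dimension with values in the natural numbers, which says nothing about infinite-dimensional spaces.
\<close>

lemma eigenspace_independent_finite:
  assumes S: "graph_fun.independent S" "S \<subseteq> eigenspace schroedinger_op \<theta>"
  shows "finite S"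
proof (rule ccontr)
  assume "infinite S"
  then obtain T where T: "finite T" "card T = Suc CARD('e \<times> bool)" "T \<subseteq> S"
    using infinite_arbitrarily_large by metis
  have indT: "graph_fun.independent T" using graph_fun.independent_mono[OF S(1) T(3)] .
  have span: "graph_fun.span T \<subseteq> eigenspace schroedinger_op \<theta>"
    using T S by (intro graph_fun.span_minimal eigenspace_subspace) auto
  then have H2: "f \<in> H2_graph G" if "f \<in> graph_fun.span T" for f
    using that eigenspace_form_domain form_domain_H2 by blast
  \<comment> \<open>the initial data at the start of the edges\<close>
  define l where "l = (\<lambda>p (f :: 'e graph_fun). if snd p then edge_deriv G f (fst p) 0 else f (fst p) 0)"
  have "\<exists>f\<in>graph_fun.span T. f \<noteq> 0 \<and> (\<forall>p\<in>UNIV. l p f = 0)"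
  proof (rule graph_fun.common_kernel_nonzero[OF _ indT T(1)])
    show "card (UNIV :: ('e \<times> bool) set) < card T" using T by simp
    show "l p (f + g) = l p f + l p g" if "f \<in> graph_fun.span T" "g \<in> graph_fun.span T" for p f g
      using that H2 by (simp add: l_def edge_deriv_add len_nonneg)
    show "l p (gscale c f) = c * l p f" if "f \<in> graph_fun.span T" for p c f
      using edge_deriv_gscale[OF H2[OF that]] len_nonneg by (simp add: l_def gscale_def)
  qed simp
  then obtain f where f: "f \<in> graph_fun.span T" "f \<noteq> 0" and l0: "\<And>p. l p f = 0" by blast
  have "f e 0 = 0" "edge_deriv G f e 0 = 0" for e
    using l0[of "(e, False)"] l0[of "(e, True)"] by (simp_all add: l_def)
  then show False using eigenfunction_determined_by_initial_data[of f \<theta>] f span by blast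
qed

lemma eigenspace_basis:
  obtains S where "S \<subseteq> eigenspace schroedinger_op \<theta>" "finite S" "graph_fun.independent S"
    "eigenspace schroedinger_op \<theta> \<subseteq> graph_fun.span S" "card S = eig_mult schroedinger_op \<theta>"
  using graph_fun.basis_exists[of "eigenspace schroedinger_op \<theta>"] eigenspace_independent_finite[of _ \<theta>]
  unfolding eig_mult_def graph_dim_def by metis

lemma eigenspaces_orthogonal:
  assumes f: "f \<in> eigenspace schroedinger_op \<theta>" and g: "g \<in> eigenspace schroedinger_op \<eta>" and ne: "\<theta> \<noteq> \<eta>"
  shows "ip f g = 0"
proof -
  have form_domain: "f \<in> form_domain" "g \<in> form_domain" using f g eigenspace_form_domain by auto
  have "form f g = form g f"
    using form_space.ip_sym[OF form_domain] L2.ip_sym[OF form_domain_cont_funs form_domain_cont_funs, OF form_domain] by (simp add: shifted_form_def)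
  then have "\<theta> * ip f g = \<eta> * ip f g"
    using eigenspace_weak[OF f form_domain(2)] eigenspace_weak[OF g form_domain(1)] L2.ip_sym[OF form_domain_cont_funs form_domain_cont_funs, OF form_domain] by simp
  then show ?thesis using ne by simp
qed

lemma eig_mult_0: "eig_mult schroedinger_op \<theta> = 0 \<Longrightarrow> t \<in> eigenspace schroedinger_op \<theta> \<Longrightarrow> t = 0"
  using eigenspace_basis[of \<theta>] by (metis card_0_eq graph_fun.span_empty singletonD subsetD)

lemma eigenvalue_lower_bound:
  assumes "eig_mult schroedinger_op \<theta> \<noteq> 0"
  shows "\<theta> \<ge> 1 - shift"
proof -
  obtain S where S: "S \<subseteq> eigenspace schroedinger_op \<theta>" "graph_fun.independent S" "card S = eig_mult schroedinger_op \<theta>"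
    using eigenspace_basis[of \<theta>] by metis
  then obtain f where f: "f \<in> S" using assms by fastforce
  then have f0: "f \<noteq> 0" using S(2) graph_fun.dependent_zero by blast
  have fE: "f \<in> eigenspace schroedinger_op \<theta>" using f S by blast
  note form_domain = eigenspace_form_domain[OF fE]
  have "ip f f \<le> shifted_form f f"
    using shifted_form_coercive[OF form_domain_H2[OF form_domain]] ip_deriv_nonneg[OF form_domain_H2[OF form_domain]] by simp
  also have "\<dots> = (\<theta> + shift) * ip f f"
    using eigenspace_weak[OF fE form_domain] by (simp add: shifted_form_def algebra_simps)
  finally have "1 * ip f f \<le> (\<theta> + shift) * ip f f" by simp
  then show ?thesis using ip_pos[OF form_domain_H2[OF form_domain] f0] by (subst (asm) mult_le_cancel_right) auto
qed

text \<open>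
  Bases of the eigenspaces for \<open>S\<close> have fewer elements together than \<open>V\<close>, so the orthogonality
  conditions are fewer equations than unknowns. That only finitely many eigenvalues lie in \<open>S\<close>
  is a consequence of the bound on the multiplicities.
\<close>

lemma exists_orthogonal_to_eigenspaces:
  assumes V: "finite V" "graph_fun.independent V" "V \<subseteq> form_domain"
    and few: "\<And>M. finite M \<Longrightarrow> M \<subseteq> S \<Longrightarrow> (\<Sum>\<theta>\<in>M. eig_mult schroedinger_op \<theta>) < card V"
  obtains f where "f \<in> graph_fun.span V" "f \<in> form_domain" "f \<noteq> 0"
    "\<And>\<theta> t. \<theta> \<in> S \<Longrightarrow> t \<in> eigenspace schroedinger_op \<theta> \<Longrightarrow> ip f t = 0"
proof -
  \<comment> \<open>the eigenvalues in \<open>S\<close>: a set of \<open>card V\<close> of them would contradict the bound on the multiplicities\<close>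
  define E where "E = {\<theta> \<in> S. eig_mult schroedinger_op \<theta> \<noteq> 0}"
  have "finite E"
  proof (rule ccontr)
    assume "infinite E"
    then obtain M where M: "finite M" "card M = card V" "M \<subseteq> E" using infinite_arbitrarily_large by metis
    have "card M = (\<Sum>\<theta>\<in>M. 1)" by simp
    also have "\<dots> \<le> (\<Sum>\<theta>\<in>M. eig_mult schroedinger_op \<theta>)" using M(3) unfolding E_def by (intro sum_mono) (auto simp: Suc_le_eq)
    finally show False using few[OF M(1)] M unfolding E_def by fastforce
  qed
  have "\<forall>\<theta>. \<exists>S. S \<subseteq> eigenspace schroedinger_op \<theta> \<and> finite S \<and> eigenspace schroedinger_op \<theta> \<subseteq> graph_fun.span S \<and> card S = eig_mult schroedinger_op \<theta>"
    using eigenspace_basis by metis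
  from choice[OF this] obtain b where b: "\<And>\<theta>. b \<theta> \<subseteq> eigenspace schroedinger_op \<theta>" "\<And>\<theta>. finite (b \<theta>)"
    "\<And>\<theta>. eigenspace schroedinger_op \<theta> \<subseteq> graph_fun.span (b \<theta>)" "\<And>\<theta>. card (b \<theta>) = eig_mult schroedinger_op \<theta>" by blast
  define T where "T = (\<Union>\<theta>\<in>E. b \<theta>)"
  have finT: "finite T" unfolding T_def using \<open>finite E\<close> b by blast
  have "card T \<le> (\<Sum>\<theta>\<in>E. card (b \<theta>))" unfolding T_def by (rule card_UN_le[OF \<open>finite E\<close>])
  also have "\<dots> < card V" using few[OF \<open>finite E\<close>] b(4) by (simp add: E_def)
  finally have card: "card T < card V" .
  have TX: "t \<in> cont_funs" if "t \<in> T" for t using that b(1) eigenspace_form_domain form_domain_cont_funs unfolding T_def by blast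
  have span: "graph_fun.span V \<subseteq> form_domain" using V by (intro graph_fun.span_minimal graph_subspace_form_domain)
  then have spanX: "f \<in> cont_funs" if "f \<in> graph_fun.span V" for f using that form_domain_cont_funs by blast
  have "\<exists>f\<in>graph_fun.span V. f \<noteq> 0 \<and> (\<forall>t\<in>T. complex_ip t f = 0)"
    by (rule graph_fun.common_kernel_nonzero[OF finT V(2,1) card]) (auto simp: complex_ip_add complex_ip_gscale TX spanX)
  then obtain f where f: "f \<in> graph_fun.span V" "f \<noteq> 0" and T0: "\<And>t. t \<in> T \<Longrightarrow> complex_ip t f = 0" by blast
  have fX: "f \<in> cont_funs" using spanX f by blast
  have "ip f t = 0" if \<theta>: "\<theta> \<in> S" and t: "t \<in> eigenspace schroedinger_op \<theta>" for \<theta> t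
  proof (cases "eig_mult schroedinger_op \<theta> = 0")
    case True
    then have "t = 0" using eig_mult_0 t by blast
    then show ?thesis using L2.ip_zero_left[OF fX] L2.ip_sym[of f 0] fX by simp
  next
    case False
    then have "\<theta> \<in> E" using \<theta> by (simp add: E_def)
    have "complex_ip f t = 0"
    proof (rule graph_fun.functional_eq_0_on_span[of t "b \<theta>" cont_funs "complex_ip f"])
      show "t \<in> graph_fun.span (b \<theta>)" using b(3) t by blast
      have "graph_fun.span (b \<theta>) \<subseteq> eigenspace schroedinger_op \<theta>"
        by (intro graph_fun.span_minimal b(1) eigenspace_subspace)
      then show "graph_fun.span (b \<theta>) \<subseteq> cont_funs" using eigenspace_form_domain form_domain_cont_funs by blast
      show "complex_ip f x = 0" if "x \<in> b \<theta>" for x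
      proof -
        have "x \<in> T" using that \<open>\<theta> \<in> E\<close> unfolding T_def by blast
        then show ?thesis using T0[of x] complex_ip_cnj[OF TX fX, of x] by simp
      qed
    qed (auto simp: complex_ip_add complex_ip_gscale fX)
    then show ?thesis using Re_complex_ip[of f t] by simp
  qed
  then show ?thesis using that f span by blast
qed

text \<open>
  With fewer than \<open>card V\<close> eigenvalues \<open>\<le> x\<close>, some nonzero \<open>f\<close> in the span of \<open>V\<close> is orthogonal to all their
  eigenfunctions, and the spectral gap lemma gives \<open>form f f > x \<parallel>f\<parallel>\<^sup>2\<close>.
\<close>

lemma eigenvalue_count_lower_bound:
  assumes V: "finite V" "graph_fun.independent V" "V \<subseteq> form_domain"
    and x: "\<And>f. f \<in> graph_fun.span V \<Longrightarrow> form f f \<le> x * ip f f"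
  shows "\<exists>M. finite M \<and> M \<subseteq> {..x} \<and> card V \<le> (\<Sum>\<theta>\<in>M. eig_mult schroedinger_op \<theta>)"
proof (rule ccontr)
  assume "\<not> ?thesis"
  then have few: "\<And>M. finite M \<Longrightarrow> M \<subseteq> {..x} \<Longrightarrow> (\<Sum>\<theta>\<in>M. eig_mult schroedinger_op \<theta>) < card V" by (meson not_le)
  obtain f where f: "f \<in> graph_fun.span V" "f \<in> form_domain" "f \<noteq> 0"
    "\<And>\<theta> t. \<theta> \<in> {..x} \<Longrightarrow> t \<in> eigenspace schroedinger_op \<theta> \<Longrightarrow> ip f t = 0"
    by (rule exists_orthogonal_to_eigenspaces[OF V, where S = "{..x}"], erule (1) few) (rule that; assumption)
  obtain \<theta> where "\<theta> \<notin> {..x}" "form f f \<ge> \<theta> * ip f f"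
    by (rule spectral_gap[OF f(2-4)])
  moreover have "0 < ip f f" using ip_pos f form_domain_H2 by blast
  ultimately have "x * ip f f < form f f" by (smt (verit) atMost_iff mult_strict_right_mono)
  then show False using x[OF f(1)] by simp
qed

text \<open>
  If the total multiplicity of all eigenvalues were less than \<open>card V\<close>, some nonzero \<open>f\<close> would be orthogonal
  to all eigenfunctions; but the spectral gap lemma for the set of all real numbers
  produces an eigenvalue outside this set.
\<close>

lemma eigenvalue_count_unbounded:
  assumes V: "finite V" "graph_fun.independent V" "V \<subseteq> form_domain"
  shows "\<exists>M. finite M \<and> card V \<le> (\<Sum>\<theta>\<in>M. eig_mult schroedinger_op \<theta>)"
proof (rule ccontr)
  assume "\<not> ?thesis"
  then have few: "\<And>M. finite M \<Longrightarrow> M \<subseteq> UNIV \<Longrightarrow> (\<Sum>\<theta>\<in>M. eig_mult schroedinger_op \<theta>) < card V" by (meson not_le)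
  obtain f where f: "f \<in> form_domain" "f \<noteq> 0" "\<And>\<theta> t. \<theta> \<in> UNIV \<Longrightarrow> t \<in> eigenspace schroedinger_op \<theta> \<Longrightarrow> ip f t = 0"
    by (rule exists_orthogonal_to_eigenspaces[OF V, where S = "UNIV"], erule (1) few) (rule that; assumption)
  obtain \<theta> :: real where "\<theta> \<notin> UNIV" by (rule spectral_gap[OF f])
  then show False by simp
qed

text \<open>
  \<open>V\<close> is the union of bases of the eigenspaces for \<open>M\<close>. Different eigenspaces are orthogonal, so
  \<open>V\<close> is independent, and for \<open>f = \<Sum> F \<theta>\<close> the form is \<open>\<Sum> \<theta> \<parallel>F \<theta>\<parallel>\<^sup>2 \<le> x \<parallel>f\<parallel>\<^sup>2\<close>.
\<close>

lemma spectral_subspace: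
  assumes M: "finite M" "M \<subseteq> {..x}"
  obtains V where "finite V" "graph_fun.independent V" "V \<subseteq> form_domain" "card V = (\<Sum>\<theta>\<in>M. eig_mult schroedinger_op \<theta>)"
    "\<And>f. f \<in> graph_fun.span V \<Longrightarrow> form f f \<le> x * ip f f"
proof -
  have "\<forall>\<theta>. \<exists>S. S \<subseteq> eigenspace schroedinger_op \<theta> \<and> finite S \<and> graph_fun.independent S \<and> card S = eig_mult schroedinger_op \<theta>"
    using eigenspace_basis by metis
  from choice[OF this] obtain b where b: "\<And>\<theta>. b \<theta> \<subseteq> eigenspace schroedinger_op \<theta>" "\<And>\<theta>. finite (b \<theta>)"
    "\<And>\<theta>. graph_fun.independent (b \<theta>)" "\<And>\<theta>. card (b \<theta>) = eig_mult schroedinger_op \<theta>" by blast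
  define V where "V = (\<Union>\<theta>\<in>M. b \<theta>)"
  have finV: "finite V" unfolding V_def using M b by blast
  have EX: "t \<in> form_domain" "t \<in> cont_funs" if "t \<in> eigenspace schroedinger_op \<theta>" for t \<theta> using that eigenspace_form_domain form_domain_cont_funs by blast+
  have disj: "b \<theta> \<inter> b \<eta> = {}" if "\<theta> \<noteq> \<eta>" for \<theta> \<eta>
  proof (rule ccontr)
    assume "b \<theta> \<inter> b \<eta> \<noteq> {}"
    then obtain t where t: "t \<in> b \<theta>" "t \<in> b \<eta>" by blast
    then have "ip t t = 0" using eigenspaces_orthogonal[OF _ _ that] b(1) by blast
    then have "t = 0" using ip_pos[of t] t b(1) EX form_domain_H2 by fastforce
    then show False using t b(3) graph_fun.dependent_zero by blast
  qed
  have card: "card V = (\<Sum>\<theta>\<in>M. eig_mult schroedinger_op \<theta>)"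
    unfolding V_def b(4)[symmetric] using M b disj by (intro card_UN_disjoint) auto
  have ip_sum: "ip (\<Sum>\<theta>\<in>M. F \<theta>) g = (\<Sum>\<theta>\<in>M. ip (F \<theta>) g)" if "\<And>\<theta>. F \<theta> \<in> cont_funs" "g \<in> cont_funs" for F g
    using M(1)
  proof (induction M rule: finite_induct)
    case (insert a N)
    have "(\<Sum>\<theta>\<in>N. F \<theta>) \<in> cont_funs" by (rule subspace_sum[OF subspace_cont_funs]) (rule that)
    then show ?case unfolding sum.insert[OF insert.hyps]
      using insert.IH L2.ip_add_left[OF that(1) _ that(2)] by metis
  next
    case empty
    show ?case unfolding sum.empty by (rule L2.ip_zero_left[OF that(2)])
  qed
  have orth: "ip (\<Sum>\<theta>\<in>M. F \<theta>) (F \<eta>) = ip (F \<eta>) (F \<eta>)" if F: "\<And>\<theta>. F \<theta> \<in> eigenspace schroedinger_op \<theta>" and "\<eta> \<in> M" for F \<eta>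
  proof -
    have "ip (\<Sum>\<theta>\<in>M. F \<theta>) (F \<eta>) = (\<Sum>\<theta>\<in>M. ip (F \<theta>) (F \<eta>))" using EX F by (intro ip_sum) blast+
    also have "\<dots> = (\<Sum>\<theta>\<in>M. if \<theta> = \<eta> then ip (F \<eta>) (F \<eta>) else 0)"
      using eigenspaces_orthogonal[OF F F] by (intro sum.cong) auto
    finally show ?thesis using M(1) that by simp
  qed
  have decomp: "(\<Sum>t\<in>V. gscale (u t) t) = (\<Sum>\<theta>\<in>M. \<Sum>t\<in>b \<theta>. gscale (u t) t)" for u
    unfolding V_def using M b disj by (intro sum.UNION_disjoint) auto
  have part: "(\<Sum>t\<in>b \<theta>. gscale (u t) t) \<in> eigenspace schroedinger_op \<theta>" for u \<theta>
    using b(1) by (intro graph_fun.subspace_sum graph_fun.subspace_scale eigenspace_subspace) auto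
  have "graph_fun.independent V"
  proof (rule graph_fun.independent_if_scalars_zero[OF finV])
    fix u t assume sum0: "(\<Sum>t\<in>V. gscale (u t) t) = 0" and "t \<in> V"
    then obtain \<theta> where \<theta>: "\<theta> \<in> M" "t \<in> b \<theta>" unfolding V_def by blast
    let ?F = "\<lambda>\<theta>. \<Sum>t\<in>b \<theta>. gscale (u t) t"
    have "ip (?F \<theta>) (?F \<theta>) = ip 0 (?F \<theta>)" using orth[of ?F, OF part \<theta>(1)] sum0 decomp by simp
    also have "\<dots> = 0" using L2.ip_zero_left EX part by blast
    finally have "?F \<theta> = 0" using ip_pos[OF form_domain_H2[OF EX(1)[OF part]]] by fastforce
    then show "u t = 0"
      by (rule graph_fun.independentD[OF b(3) b(2) subset_refl _ \<theta>(2)])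
  qed
  moreover have "V \<subseteq> form_domain" unfolding V_def using b(1) EX by blast
  moreover have "form f f \<le> x * ip f f" if f: "f \<in> graph_fun.span V" for f
  proof -
    obtain u where u: "f = (\<Sum>t\<in>V. gscale (u t) t)"
      using f unfolding graph_fun.span_finite[OF finV] by blast
    define F where "F = (\<lambda>\<theta>. \<Sum>t\<in>b \<theta>. gscale (u t) t)"
    have F: "F \<theta> \<in> eigenspace schroedinger_op \<theta>" for \<theta> unfolding F_def by (rule part)
    have fF: "f = (\<Sum>\<theta>\<in>M. F \<theta>)" unfolding u decomp F_def ..
    have fFD: "f \<in> form_domain" unfolding fF using EX F by (intro subspace_sum[OF subspace_form_domain]) blast
    have form_sum: "form (\<Sum>\<theta>\<in>N. F \<theta>) f = (\<Sum>\<theta>\<in>N. form (F \<theta>) f)" if "finite N" for N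
      using that
    proof (induction N rule: finite_induct)
      case empty
      have "form 0 f = 0"
        using form_space.ip_zero_left[OF fFD] L2.ip_zero_left[OF form_domain_cont_funs[OF fFD]] by (simp add: shifted_form_def)
      then show ?case unfolding sum.empty .
    next
      case (insert a N)
      have form_domain: "(\<Sum>\<theta>\<in>N. F \<theta>) \<in> form_domain" "F a \<in> form_domain"
        using EX(1)[OF F] by (auto intro!: subspace_sum[OF subspace_form_domain])
      have "form (F a + (\<Sum>\<theta>\<in>N. F \<theta>)) f = form (F a) f + (\<Sum>\<theta>\<in>N. form (F \<theta>) f)"
        using form_space.ip_add_left[OF form_domain(2,1) fFD] L2.ip_add_left[OF form_domain_cont_funs[OF form_domain(2)] form_domain_cont_funs[OF form_domain(1)] form_domain_cont_funs[OF fFD]] insert.IH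
        by (simp add: shifted_form_def algebra_simps)
      then show ?case unfolding sum.insert[OF insert.hyps] .
    qed
    have ipF: "ip (F \<theta>) f = ip (F \<theta>) (F \<theta>)" if "\<theta> \<in> M" for \<theta>
      using orth[of F, OF F that] L2.ip_sym[of f "F \<theta>"] form_domain_cont_funs[OF fFD] EX(2)[OF F] unfolding fF by simp
    have "form f f = (\<Sum>\<theta>\<in>M. form (F \<theta>) f)" using form_sum[OF M(1)] unfolding fF[symmetric] .
    also have "\<dots> = (\<Sum>\<theta>\<in>M. \<theta> * ip (F \<theta>) (F \<theta>))"
      using eigenspace_weak[OF F fFD] ipF by (intro sum.cong) auto
    also have "\<dots> \<le> (\<Sum>\<theta>\<in>M. x * ip (F \<theta>) (F \<theta>))"
      using M(2) by (intro sum_mono mult_right_mono L2.ip_nonneg EX(2)[OF F]) auto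
    also have "\<dots> = x * (\<Sum>\<theta>\<in>M. ip (F \<theta>) f)" using ipF by (simp add: sum_distrib_left)
    also have "(\<Sum>\<theta>\<in>M. ip (F \<theta>) f) = ip f f"
      using ip_sum[of F f, OF EX(2)[OF F] form_domain_cont_funs[OF fFD]] unfolding fF[symmetric] by simp
    finally show ?thesis .
  qed
  ultimately show ?thesis using that finV card by blast
qed

end

section \<open>Comparison of eigenvalues and the vertex conditions\<close>

lemma H2_derivs_of_C2:
  assumes "0 \<le> l" "\<And>x. x \<in> {0..l} \<Longrightarrow> (f has_vector_derivative g x) (at x within {0..l})"
    "\<And>x. x \<in> {0..l} \<Longrightarrow> (g has_vector_derivative h x) (at x within {0..l})" "continuous_on {0..l} h"
  shows "H2_derivs l f g h"
  unfolding H2_derivs_def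
proof (intro conjI ballI assms(2))
  obtain M where "\<And>x. x \<in> {0..l} \<Longrightarrow> cmod (h x) \<le> M" using continuous_on_norm_le[OF assms(4)] by blast
  then show "L2_on {0..l} h"
    using assms(4) by (intro L2_on_bounded continuous_imp_measurable_on_sets_lebesgue) auto
  fix x assume x: "x \<in> {0..l}"
  have "(h has_integral (g x - g 0)) {0..x}"
  proof (rule fundamental_theorem_of_calculus)
    show "(g has_vector_derivative h y) (at y within {0..x})" if "y \<in> {0..x}" for y
      using assms(3)[of y] that x by (auto intro: has_vector_derivative_within_subset)
  qed (use x in simp)
  then show "g x = g 0 + integral {0..x} h" by (simp add: has_integral_iff)
qed

context graph_potential begin

text \<open>
  The function \<open>x (l - x) x\<^sup>j\<close> on every edge of length \<open>l\<close>. It vanishes at all ends, so it is in the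
  form domain of every boundary condition, and these functions are linearly independent; they show that
  form domains are infinite-dimensional.
\<close>

definition bump :: "nat \<Rightarrow> 'e graph_fun" where
  "bump j e x = (if x \<in> {0..len G e} then of_real (len G e * x ^ Suc j - x ^ Suc (Suc j)) else 0)"

lemma bump_H2: "bump j \<in> H2_graph G"
  unfolding H2_graph_def
proof (intro CollectI allI conjI impI)
  fix e
  let ?l = "len G e"
  have "H2_derivs ?l (\<lambda>x. of_real (?l * x ^ Suc j - x ^ Suc (Suc j)))
     (\<lambda>x. of_real (?l * (real (Suc j) * x ^ j) - real (Suc (Suc j)) * x ^ Suc j))
     (\<lambda>x. of_real (?l * (real (Suc j) * (real j * x ^ (j - 1))) - real (Suc (Suc j)) * (real (Suc j) * x ^ j)))"
  proof (rule H2_derivs_of_C2[OF len_nonneg])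
    fix x
    show "((\<lambda>x. complex_of_real (?l * x ^ Suc j - x ^ Suc (Suc j))) has_vector_derivative
        of_real (?l * (real (Suc j) * x ^ j) - real (Suc (Suc j)) * x ^ Suc j)) (at x within {0..?l})"
      by (intro has_vector_derivative_of_real DERIV_diff DERIV_cmult)
         (rule DERIV_pow[THEN DERIV_cong], simp)+
    show "((\<lambda>x. complex_of_real (?l * (real (Suc j) * x ^ j) - real (Suc (Suc j)) * x ^ Suc j)) has_vector_derivative
        of_real (?l * (real (Suc j) * (real j * x ^ (j - 1))) - real (Suc (Suc j)) * (real (Suc j) * x ^ j))) (at x within {0..?l})"
      by (intro has_vector_derivative_of_real DERIV_diff DERIV_cmult)
         (rule DERIV_pow[THEN DERIV_cong], simp)+
  qed (intro continuous_intros)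
  then have "H2_derivs ?l (bump j e)
     (\<lambda>x. of_real (?l * (real (Suc j) * x ^ j) - real (Suc (Suc j)) * x ^ Suc j))
     (\<lambda>x. of_real (?l * (real (Suc j) * (real j * x ^ (j - 1))) - real (Suc (Suc j)) * (real (Suc j) * x ^ j)))"
    by (rule H2_derivs_cong) (auto simp: bump_def len_nonneg)
  then show "\<exists>g h. H2_derivs ?l (bump j e) g h" by blast
qed (auto simp: bump_def)

lemma bump_trace: "trace_vec G (bump j) = 0"
  by (simp add: vec_eq_iff trace_vec_def bump_def)

lemma bump_coefficients_zero:
  assumes "(\<Sum>j\<in>{..n}. gscale (c j) (bump j)) = 0" "j \<le> n"
  shows "c j = 0"
proof -
  define l where "l = len G undefined"
  have l: "0 < l" using len_pos by (simp add: l_def)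
  have "(\<Sum>j\<le>n. c j * of_real x ^ j) = 0" if x: "x \<in> {0<..<l}" for x
  proof -
    have apply_sum: "(\<Sum>j\<in>J. gscale (c j) (bump j)) e y = (\<Sum>j\<in>J. c j * bump j e y)" for J e y
      by (induction J rule: infinite_finite_induct) (auto simp: gscale_def)
    have "0 = (\<Sum>j\<le>n. c j * bump j undefined x)"
      using arg_cong[OF assms(1), of "\<lambda>k. k undefined x"] unfolding apply_sum zero_fun_apply by (rule sym)
    also have "\<dots> = (\<Sum>j\<le>n. of_real (x * (l - x)) * (c j * of_real x ^ j))"
    proof (intro sum.cong refl)
      fix j
      have "l * x ^ Suc j - x ^ Suc (Suc j) = x * (l - x) * x ^ j" by (simp add: algebra_simps)
      then have "bump j undefined x = of_real (x * (l - x) * x ^ j)"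
        using x by (simp only: bump_def l_def[symmetric]) simp
      then show "c j * bump j undefined x = of_real (x * (l - x)) * (c j * of_real x ^ j)" by simp
    qed
    also have "\<dots> = of_real (x * (l - x)) * (\<Sum>j\<le>n. c j * of_real x ^ j)" by (simp add: sum_distrib_left)
    finally show ?thesis using x by auto
  qed
  then have "of_real ` {0<..<l} \<subseteq> {z :: complex. (\<Sum>j\<le>n. c j * z ^ j) = 0}" by auto
  moreover have "infinite (complex_of_real ` {0<..<l})"
    using l infinite_Ioo[of 0 l] by (subst finite_image_iff) (auto simp: inj_on_def)
  ultimately have "infinite {z :: complex. (\<Sum>j\<le>n. c j * z ^ j) = 0}" using finite_subset by blast
  then show ?thesis using Transcendental.polyfun_rootbound[of c j n] assms(2) by blast
qed

lemma test_functions: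
  obtains V where "finite V" "graph_fun.independent V" "card V = k" "V \<subseteq> H2_graph G"
    "\<And>f. f \<in> V \<Longrightarrow> trace_vec G f = 0"
proof -
  have inj: "inj bump"
  proof (rule injI, rule ccontr)
    fix i j assume eq: "bump i = bump j" and ne: "i \<noteq> j"
    define c :: "nat \<Rightarrow> complex" where "c = (\<lambda>m. if m = i then 1 else if m = j then - 1 else 0)"
    have "(\<Sum>m\<in>{..i + j}. gscale (c m) (bump m)) = (\<Sum>m\<in>{i, j}. gscale (c m) (bump m))"
      by (rule sum.mono_neutral_right) (auto simp: c_def gscale_def fun_eq_iff)
    also have "\<dots> = gscale 1 (bump i) + gscale (- 1) (bump j)"
      using ne by (simp add: c_def)
    also have "\<dots> = 0" unfolding eq by (simp add: gscale_def fun_eq_iff)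
    finally have "c i = 0" by (rule bump_coefficients_zero) simp
    then show False by (simp add: c_def)
  qed
  have "graph_fun.independent (bump ` {..<k})"
  proof (rule graph_fun.independent_if_scalars_zero)
    fix u f assume sum: "(\<Sum>f\<in>bump ` {..<k}. gscale (u f) f) = 0" and "f \<in> bump ` {..<k}"
    then obtain j where j: "f = bump j" "j < k" by blast
    have "(\<Sum>f\<in>bump ` {..<k}. gscale (u f) f) = (\<Sum>j\<in>{..<k}. gscale (u (bump j)) (bump j))"
      by (rule sum.reindex_cong[of bump]) (use inj in \<open>auto intro: inj_on_subset\<close>)
    then have "(\<Sum>j\<in>{..k - 1}. gscale (u (bump j)) (bump j)) = 0"
      using sum j by (simp add: lessThan_Suc_atMost[symmetric])
    then have "u (bump j) = 0" by (rule bump_coefficients_zero) (use j in simp)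
    then show "u f = 0" using j by simp
  qed simp
  moreover have "card (bump ` {..<k}) = k" using inj by (simp add: card_image inj_on_subset)
  ultimately show ?thesis using that[of "bump ` {..<k}"] bump_H2 bump_trace by auto
qed

end

text \<open>
  Monotonicity of eigenvalues in the form. The space spanned by eigenfunctions of the first
  operator is a trial space for the second one, so every \<open>x\<close> with \<open>k\<close> eigenvalues of the first operator below it
  also has \<open>k\<close> eigenvalues of the second one below it. The infima over these \<open>x\<close> compare because the smaller
  set is nonempty and the larger one bounded below.
\<close>

lemma eigenvalue_comparison:
  assumes "graph_operator G q B\<^sub>1 P\<^sub>1 A\<^sub>1" "graph_operator G q B\<^sub>2 P\<^sub>2 A\<^sub>2"
    and dom: "\<And>F. P\<^sub>1 F = 0 \<Longrightarrow> P\<^sub>2 F = 0"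
    and le: "\<And>F. P\<^sub>1 F = 0 \<Longrightarrow> F \<bullet> A\<^sub>2 F \<le> F \<bullet> A\<^sub>1 F"
    and k: "1 \<le> k"
  shows "eigenvalue (schroedinger G q B\<^sub>2) k \<le> eigenvalue (schroedinger G q B\<^sub>1) k"
proof -
  interpret H1: graph_operator G q B\<^sub>1 P\<^sub>1 A\<^sub>1 by fact
  interpret H2: graph_operator G q B\<^sub>2 P\<^sub>2 A\<^sub>2 by fact
  let ?S1 = "{x. \<exists>M. finite M \<and> M \<subseteq> {..x} \<and> k \<le> (\<Sum>\<mu>\<in>M. eig_mult (schroedinger G q B\<^sub>1) \<mu>)}"
  let ?S2 = "{x. \<exists>M. finite M \<and> M \<subseteq> {..x} \<and> k \<le> (\<Sum>\<mu>\<in>M. eig_mult (schroedinger G q B\<^sub>2) \<mu>)}"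
  have form_domain: "H1.form_domain \<subseteq> H2.form_domain" unfolding H1.form_domain_def H2.form_domain_def using dom by auto
  have form: "H2.form f f \<le> H1.form f f" if "f \<in> H1.form_domain" for f
    using that le unfolding H1.form_def H2.form_def H1.form_domain_def by auto
  have "?S1 \<subseteq> ?S2"
  proof
    fix x assume "x \<in> ?S1"
    then obtain M where M: "finite M" "M \<subseteq> {..x}" "k \<le> (\<Sum>\<mu>\<in>M. eig_mult (schroedinger G q B\<^sub>1) \<mu>)" by blast
    obtain V where V: "finite V" "graph_fun.independent V" "V \<subseteq> H1.form_domain"
      "card V = (\<Sum>\<theta>\<in>M. eig_mult (schroedinger G q B\<^sub>1) \<theta>)"
      "\<And>f. f \<in> graph_fun.span V \<Longrightarrow> H1.form f f \<le> x * H1.ip f f"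
      by (rule H1.spectral_subspace[OF M(1,2)]) (rule that; assumption)
    have "graph_fun.span V \<subseteq> H1.form_domain" by (intro graph_fun.span_minimal V(3) H1.graph_subspace_form_domain)
    then have "H2.form f f \<le> x * H1.ip f f" if "f \<in> graph_fun.span V" for f
      using V(5)[OF that] form[of f] that by force
    then have "\<exists>M. finite M \<and> M \<subseteq> {..x} \<and> card V \<le> (\<Sum>\<theta>\<in>M. eig_mult (schroedinger G q B\<^sub>2) \<theta>)"
      using V form_domain by (intro H2.eigenvalue_count_lower_bound) auto
    then show "x \<in> ?S2" using M(3) V(4) by (auto intro: order_trans)
  qed
  moreover have "?S1 \<noteq> {}"
  proof -
    obtain V where V: "finite V" "graph_fun.independent V" "card V = k" "V \<subseteq> H2_graph G"
      "\<And>f. f \<in> V \<Longrightarrow> trace_vec G f = 0"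
      by (rule H1.test_functions) (rule that; assumption)
    have "V \<subseteq> H1.form_domain" unfolding H1.form_domain_def using V(4,5) hermitian_op_zero[OF H1.P] by auto
    from H1.eigenvalue_count_unbounded[OF V(1,2) this] obtain M where M: "finite M"
      "k \<le> (\<Sum>\<theta>\<in>M. eig_mult (schroedinger G q B\<^sub>1) \<theta>)" using V(3) by blast
    obtain x where "\<And>\<theta>. \<theta> \<in> M \<Longrightarrow> \<theta> \<le> x"
      using bdd_above_finite[OF M(1)] unfolding bdd_above_def by blast
    then show ?thesis using M by blast
  qed
  moreover have "bdd_below ?S2"
  proof (rule bdd_belowI[of _ "1 - H2.shift"])
    fix x assume "x \<in> ?S2"
    then obtain M where M: "finite M" "M \<subseteq> {..x}" "k \<le> (\<Sum>\<mu>\<in>M. eig_mult (schroedinger G q B\<^sub>2) \<mu>)" by blast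
    then have "(\<Sum>\<mu>\<in>M. eig_mult (schroedinger G q B\<^sub>2) \<mu>) \<noteq> 0" using k by linarith
    then obtain \<mu> where "\<mu> \<in> M" "eig_mult (schroedinger G q B\<^sub>2) \<mu> \<noteq> 0" by (meson sum.neutral)
    then show "1 - H2.shift \<le> x" using H2.eigenvalue_lower_bound[of \<mu>] M(2) by fastforce
  qed
  ultimately show ?thesis unfolding eigenvalue_def by (intro cInf_superset_mono)
qed

text \<open>
  A normal form for conditions at one vertex that covers the Dirichlet, Neumann and Robin parts of the general
  condition as well as \<open>\<delta>\<close> and \<open>\<delta>'\<close> conditions: \<open>P\<close> is the Dirichlet projection, and \<open>A\<close> the self-adjoint operator of the Robin part, extended by 0 to
  the Neumann part. Unlike the Robin operator it may be singular, which covers the \<open>\<delta>\<close> condition of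
  strength 0.
\<close>

definition form_cond :: "('v::finite, 'e::finite) metric_graph \<Rightarrow> 'v \<Rightarrow> ('e end_vec \<Rightarrow> 'e end_vec) \<Rightarrow>
    ('e end_vec \<Rightarrow> 'e end_vec) \<Rightarrow> 'e vertex_cond \<Rightarrow> bool" where
  "form_cond G v P A B \<longleftrightarrow> hermitian_op P \<and> (\<forall>x. P (P x) = P x) \<and> hermitian_op A \<and> (\<forall>x. P (A x) = 0) \<and>
     (\<forall>x. at_vertex G v (P x) = P x) \<and> (\<forall>x. at_vertex G v (A x) = A x) \<and>
     (\<forall>F F'. B F F' \<longleftrightarrow> P F = 0 \<and> at_vertex G v F' - P F' = A F)"

lemma hermitian_at_vertex: "hermitian_op (at_vertex G v)"
  unfolding hermitian_op_def cdot_def at_vertex_def by (auto intro!: sum.cong)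

lemma at_vertex_zero [simp]: "at_vertex G v 0 = 0"
  by (simp add: at_vertex_def vec_eq_iff)

lemma at_vertex_at_vertex: "at_vertex G v (at_vertex G w x) = (if v = w then at_vertex G v x else 0)"
  by (auto simp: at_vertex_def vec_eq_iff)

lemma vec_eq_iff_at_vertex: "x = y \<longleftrightarrow> (\<forall>v. at_vertex G v x = at_vertex G v y)"
proof
  assume eq: "\<forall>v. at_vertex G v x = at_vertex G v y"
  show "x = y"
    unfolding vec_eq_iff
  proof
    fix p
    show "x $ p = y $ p"
      using arg_cong[OF spec[OF eq, of "att G p"], of "\<lambda>z. z $ p"] by (simp add: at_vertex_def)
  qed
qed simp

lemma hermitian_absorb_at_vertex:
  assumes "hermitian_op T" "\<And>x. at_vertex G v (T x) = T x"
  shows "T (at_vertex G v x) = T x"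
proof (rule cdot_eqI)
  fix z
  have "cdot (T (at_vertex G v x)) z = cdot (at_vertex G v x) (T z)" using assms(1) by (simp add: hermitian_op_def)
  also have "\<dots> = cdot x (T z)" using hermitian_at_vertex[of G v] assms(2) by (simp add: hermitian_op_def)
  finally show "cdot (T (at_vertex G v x)) z = cdot (T x) z" using assms(1) by (simp add: hermitian_op_def)
qed

lemma at_vertex_sum:
  fixes T :: "'v::finite \<Rightarrow> 'e::finite end_vec"
  assumes "\<And>v. at_vertex G v (T v) = T v"
  shows "at_vertex G v (\<Sum>w\<in>UNIV. T w) = T v"
proof -
  have "at_vertex G v (\<Sum>w\<in>UNIV. T w) = (\<Sum>w\<in>UNIV. at_vertex G v (T w))"
    by (rule linear_sum[OF hermitian_op_linear[OF hermitian_at_vertex]])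
  also have "\<dots> = (\<Sum>w\<in>UNIV. if w = v then T v else 0)"
  proof (intro sum.cong refl)
    fix w
    have "at_vertex G v (T w) = at_vertex G v (at_vertex G w (T w))" unfolding assms ..
    also have "\<dots> = (if w = v then T v else 0)" unfolding at_vertex_at_vertex using assms[of v] by auto
    finally show "at_vertex G v (T w) = (if w = v then T v else 0)" .
  qed
  finally show ?thesis by simp
qed

lemma hermitian_op_sum:
  assumes "\<And>v. hermitian_op (T v)"
  shows "hermitian_op (\<lambda>x. \<Sum>v\<in>UNIV. T (v :: 'v::finite) x)"
proof -
  have l: "cdot (\<Sum>v\<in>UNIV. f v) y = (\<Sum>v\<in>UNIV. cdot (f v) y)" for f :: "'v \<Rightarrow> complex ^ 'n" and y
    unfolding cdot_def by (simp add: sum_distrib_right) (rule sum.swap)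
  have r: "cdot y (\<Sum>v\<in>UNIV. f v) = (\<Sum>v\<in>UNIV. cdot y (f v))" for f :: "'v \<Rightarrow> complex ^ 'n" and y
    unfolding cdot_def by (simp add: sum_distrib_left) (rule sum.swap)
  show ?thesis using assms unfolding hermitian_op_def l r by simp
qed

text \<open>
  The spaces of boundary vectors at different vertices are orthogonal and span all boundary vectors,
  so the conditions at the single vertices add up to one condition.
\<close>

lemma graph_operator_of_vertex_conditions:
  assumes "compact_metric_graph G" "real_Linf_potential G q" "\<And>v. form_cond G v (P v) (A v) (B v)"
  shows "graph_operator G q B (\<lambda>x. \<Sum>v\<in>UNIV. P v x) (\<lambda>x. \<Sum>v\<in>UNIV. A v x)"
proof
  note fc = assms(3)[unfolded form_cond_def]
  have herm: "hermitian_op (P v)" "hermitian_op (A v)" for v using fc by blast+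
  have atv: "at_vertex G v (P v x) = P v x" "at_vertex G v (A v x) = A v x" for v x using fc by blast+
  have Pv: "P v y = P v (at_vertex G v y)" for v y
    using hermitian_absorb_at_vertex[OF herm(1) atv(1)] by simp
  have sumP: "at_vertex G v (\<Sum>w\<in>UNIV. P w x) = P v x" and sumA: "at_vertex G v (\<Sum>w\<in>UNIV. A w x) = A v x" for v x
    by (rule at_vertex_sum, rule atv)+
  show "compact_metric_graph G" "real_Linf_potential G q" by fact+
  show "hermitian_op (\<lambda>x. \<Sum>v\<in>UNIV. P v x)" "hermitian_op (\<lambda>x. \<Sum>v\<in>UNIV. A v x)"
    by (intro hermitian_op_sum herm)+
  show "(\<Sum>v\<in>UNIV. P v (\<Sum>v\<in>UNIV. P v x)) = (\<Sum>v\<in>UNIV. P v x)" for x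
  proof (rule sum.cong[OF refl])
    fix v
    show "P v (\<Sum>v\<in>UNIV. P v x) = P v x" using Pv[of v "\<Sum>v\<in>UNIV. P v x"] fc unfolding sumP by simp
  qed
  show "(\<Sum>v\<in>UNIV. P v (\<Sum>v\<in>UNIV. A v x)) = 0" for x
  proof (rule sum.neutral, rule ballI)
    fix v
    show "P v (\<Sum>v\<in>UNIV. A v x) = 0" using Pv[of v "\<Sum>v\<in>UNIV. A v x"] fc unfolding sumA by simp
  qed
  fix F F'
  have "(\<forall>v. B v (at_vertex G v F) (at_vertex G v F')) \<longleftrightarrow>
      (\<forall>v. P v F = 0) \<and> (\<forall>v. at_vertex G v F' - P v F' = A v F)"
  proof -
    have "B v (at_vertex G v F) (at_vertex G v F') \<longleftrightarrow> P v F = 0 \<and> at_vertex G v F' - P v F' = A v F" for v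
      using fc[of v] hermitian_absorb_at_vertex[OF herm(1) atv(1)] hermitian_absorb_at_vertex[OF herm(2) atv(2)]
      by (simp add: at_vertex_at_vertex)
    then show ?thesis by blast
  qed
  also have "(\<forall>v. P v F = 0) \<longleftrightarrow> (\<Sum>v\<in>UNIV. P v F) = 0"
    unfolding vec_eq_iff_at_vertex[of "\<Sum>v\<in>UNIV. P v F" 0 G] sumP
    by simp
  also have "(\<forall>v. at_vertex G v F' - P v F' = A v F) \<longleftrightarrow> F' - (\<Sum>v\<in>UNIV. P v F') = (\<Sum>v\<in>UNIV. A v F)"
    unfolding vec_eq_iff_at_vertex[of "F' - (\<Sum>v\<in>UNIV. P v F')" _ G] sumA hermitian_op_diff[OF hermitian_at_vertex] sumP ..
  finally show "(\<forall>v. B v (at_vertex G v F) (at_vertex G v F')) \<longleftrightarrow>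
     (\<Sum>v\<in>UNIV. P v F) = 0 \<and> F' - (\<Sum>v\<in>UNIV. P v F') = (\<Sum>v\<in>UNIV. A v F)" .
qed

text \<open>
  Take \<open>PD\<close> for the Dirichlet projection and extend the Robin operator \<open>M\<close> by 0, that is to \<open>M PR\<close>. The Neumann and the
  Robin equation are the components of the one equation \<open>PN F' + PR F' = M PR F\<close> in orthogonal
  ranges.
\<close>

lemma local_selfadjoint_form_cond:
  assumes "local_selfadjoint_cond G v B"
  shows "\<exists>P A. form_cond G v P A B"
proof -
  obtain PD PN PR M where o: "orthogonal_projection PD" "orthogonal_projection PN" "orthogonal_projection PR"
    and or: "orthogonal_ranges PD PN" "orthogonal_ranges PD PR" "orthogonal_ranges PN PR"
    and sum: "\<And>x. PD *v x + PN *v x + PR *v x = at_vertex G v x"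
    and M: "selfadjoint_invertible_on_range PR M"
    and B: "\<And>F F'. B F F' \<longleftrightarrow> PD *v F = 0 \<and> PN *v F' = 0 \<and> PR *v F' = M *v (PR *v F)"
    using assms unfolding local_selfadjoint_cond_def by blast
  have herm: "hermitian_op ((*v) PD)" "hermitian_op ((*v) PN)" "hermitian_op ((*v) PR)"
    and idem: "\<And>x. PD *v (PD *v x) = PD *v x" "\<And>x. PN *v (PN *v x) = PN *v x" "\<And>x. PR *v (PR *v x) = PR *v x"
    using o by (auto simp: orthogonal_projection_def hermitian_op_def matrix_vector_mul_assoc)
  have prod0: "S *v (R *v x) = 0 \<and> R *v (S *v x) = 0"
    if "orthogonal_ranges R S" "hermitian_op ((*v) R)" "hermitian_op ((*v) S)" for R S :: "complex ^ ('b \<times> bool) ^ ('b \<times> bool)" and x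
  proof
    show "S *v (R *v x) = 0"
    proof (rule cdot_eqI)
      fix z show "cdot (S *v (R *v x)) z = cdot 0 z"
        using that by (simp add: hermitian_op_def orthogonal_ranges_def) (simp add: cdot_def)
    qed
    show "R *v (S *v x) = 0"
    proof (rule cdot_eqI)
      fix z
      have "cdot (R *v (S *v x)) z = cdot x (S *v (R *v z))" using that by (simp add: hermitian_op_def)
      also have "S *v (R *v z) = 0"
        by (rule cdot_eqI) (use that in \<open>simp add: hermitian_op_def orthogonal_ranges_def\<close>, simp add: cdot_def)
      finally show "cdot (R *v (S *v x)) z = cdot 0 z" by (simp add: cdot_def)
    qed
  qed
  note DN = prod0[OF or(1) herm(1,2)] and DR = prod0[OF or(2) herm(1,3)] and NR = prod0[OF or(3) herm(2,3)]
  have atD: "at_vertex G v (PD *v x) = PD *v x" for x using sum[of "PD *v x"] idem DN DR by simp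
  have atR: "at_vertex G v (PR *v x) = PR *v x" for x using sum[of "PR *v x"] idem NR DR by simp
  have MR: "PR *v (M *v (PR *v x)) = M *v (PR *v x)" for x
  proof -
    have "M *v (PR *v x) \<in> range ((*v) PR)"
      using M unfolding selfadjoint_invertible_on_range_def bij_betw_def by blast
    then show ?thesis using idem(3) by auto
  qed
  have hM: "hermitian_op (\<lambda>x. M *v (PR *v x))"
    unfolding hermitian_op_def
  proof (intro allI)
    fix x y
    have PR: "cdot (PR *v a) b = cdot a (PR *v b)" for a b using herm(3) by (simp add: hermitian_op_def)
    have "cdot (M *v (PR *v x)) y = cdot (M *v (PR *v x)) (PR *v y)"
      using PR[of "M *v (PR *v x)" y] by (simp add: MR)
    also have "\<dots> = cdot (PR *v x) (M *v (PR *v y))"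
      using M unfolding selfadjoint_invertible_on_range_def by blast
    also have "\<dots> = cdot x (M *v (PR *v y))" using PR[of x "M *v (PR *v y)"] by (simp add: MR)
    finally show "cdot (M *v (PR *v x)) y = cdot x (M *v (PR *v y))" .
  qed
  have "form_cond G v ((*v) PD) (\<lambda>x. M *v (PR *v x)) B"
    unfolding form_cond_def
  proof (intro conjI allI herm idem hM atD)
    show "PD *v (M *v (PR *v x)) = 0" for x using DR[of "M *v (PR *v x)"] MR[of x] by simp
    show "at_vertex G v (M *v (PR *v x)) = M *v (PR *v x)" for x using atR[of "M *v (PR *v x)"] MR[of x] by simp
    fix F F'
    have at': "at_vertex G v F' - PD *v F' = PN *v F' + PR *v F'" using sum[of F'] by (simp add: algebra_simps)
    show "B F F' \<longleftrightarrow> PD *v F = 0 \<and> at_vertex G v F' - PD *v F' = M *v (PR *v F)"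
      unfolding B at'
    proof (intro iffI conjI; elim conjE)
      assume eq: "PN *v F' + PR *v F' = M *v (PR *v F)"
      have "PN *v (PN *v F' + PR *v F') = PN *v F'" using idem(2) NR by (simp add: matrix_vector_right_distrib)
      moreover have "PN *v (M *v (PR *v F)) = 0" using NR[of "M *v (PR *v F)"] MR[of F] by simp
      ultimately show *: "PN *v F' = 0" using eq by simp
      then show "PR *v F' = M *v (PR *v F)" using eq by simp
    qed auto
  qed
  then show ?thesis by blast
qed

definition end_sum :: "('v::finite, 'e::finite) metric_graph \<Rightarrow> 'v \<Rightarrow> 'e end_vec \<Rightarrow> complex" where
  "end_sum G v x = (\<Sum>p\<in>ends_at G v. x $ p)"

text \<open>
  The orthogonal projection onto the vectors that are constant at \<open>v\<close>. At an isolated vertex it is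
  0, by the convention for division by 0.
\<close>

definition end_mean :: "('v::finite, 'e::finite) metric_graph \<Rightarrow> 'v \<Rightarrow> 'e end_vec \<Rightarrow> 'e end_vec" where
  "end_mean G v x = (\<chi> p. if att G p = v then end_sum G v x / of_nat (deg G v) else 0)"

lemma sum_if_at_vertex: "(\<Sum>p\<in>UNIV. if att G p = v then f p else 0) = (\<Sum>p\<in>ends_at G v. f p)"
  unfolding ends_at_def by (simp add: sum.If_cases)

lemma cdot_end_mean: "cdot (end_mean G v x) y = cnj (end_sum G v x) * end_sum G v y / of_nat (deg G v)"
proof -
  have "cdot (end_mean G v x) y = (\<Sum>p\<in>UNIV. if att G p = v then cnj (end_sum G v x) / of_nat (deg G v) * y $ p else 0)"
    unfolding cdot_def end_mean_def by (intro sum.cong) auto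
  then show ?thesis
    unfolding sum_if_at_vertex sum_distrib_left[symmetric] end_sum_def[of G v y, symmetric] by simp
qed

lemma cdot_commute: "cdot x y = cnj (cdot y x)"
  by (simp add: cdot_def mult.commute)

lemma hermitian_end_mean: "hermitian_op (end_mean G v)"
  unfolding hermitian_op_def
proof (intro allI)
  fix x y
  have "cdot x (end_mean G v y) = cnj (cdot (end_mean G v y) x)" by (rule cdot_commute)
  then show "cdot (end_mean G v x) y = cdot x (end_mean G v y)" by (simp add: cdot_end_mean)
qed

lemma end_sum_end_mean: "end_sum G v (end_mean G v x) = end_sum G v x"
proof -
  have "end_sum G v (end_mean G v x) = (\<Sum>p\<in>ends_at G v. end_sum G v x / of_nat (deg G v))"
    unfolding end_sum_def[of G v "end_mean G v x"] by (intro sum.cong) (auto simp: end_mean_def ends_at_def)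
  also have "\<dots> = end_sum G v x"
    by (cases "ends_at G v = {}") (auto simp: deg_def end_sum_def)
  finally show ?thesis .
qed

lemma end_mean_idem: "end_mean G v (end_mean G v x) = end_mean G v x"
  unfolding end_mean_def[of G v "end_mean G v x"] end_sum_end_mean by (rule end_mean_def[symmetric])

lemma at_vertex_end_mean: "at_vertex G v (end_mean G v x) = end_mean G v x"
  by (simp add: at_vertex_def end_mean_def vec_eq_iff)

lemma hermitian_op_minus: "hermitian_op S \<Longrightarrow> hermitian_op T \<Longrightarrow> hermitian_op (\<lambda>x. S x - T x)"
  by (simp add: hermitian_op_def cdot_def algebra_simps sum_subtractf)

lemma cdot_mult_right: "cdot x (c *s y) = c * cdot x y"
  by (simp add: cdot_def sum_distrib_left mult.left_commute)

lemma hermitian_op_real_mult: "hermitian_op T \<Longrightarrow> hermitian_op (\<lambda>x. of_real r *s T x)"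
  by (simp add: hermitian_op_def cdot_mult_left cdot_mult_right)

text \<open>
  The Dirichlet part of a \<open>\<delta>\<close> condition forces \<open>F\<close> to be constant at \<open>v\<close>, and for constant \<open>F\<close> the equation for the sum of the
  derivatives is \<open>J F' = (\<alpha>/d) J F\<close>, with \<open>J\<close> the mean and \<open>d\<close> the degree.
\<close>

lemma delta_form_cond:
  "form_cond G v (\<lambda>x. at_vertex G v x - end_mean G v x) (\<lambda>x. of_real (\<alpha> / real (deg G v)) *s end_mean G v x)
     (delta_cond G v \<alpha>)"
  unfolding form_cond_def
proof (intro conjI allI)
  let ?at = "at_vertex G v" and ?J = "end_mean G v"
  note lin = hermitian_op_diff[OF hermitian_at_vertex] hermitian_op_diff[OF hermitian_end_mean]
    hermitian_op_mult[OF hermitian_at_vertex] hermitian_op_mult[OF hermitian_end_mean]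
  have Jat: "?J (?at x) = ?J x" for x by (rule hermitian_absorb_at_vertex[OF hermitian_end_mean at_vertex_end_mean])
  note s = lin at_vertex_end_mean Jat end_mean_idem at_vertex_at_vertex
  show "hermitian_op (\<lambda>x. ?at x - ?J x)" by (intro hermitian_op_minus hermitian_at_vertex hermitian_end_mean)
  show "hermitian_op (\<lambda>x. of_real (\<alpha> / real (deg G v)) *s ?J x)" by (intro hermitian_op_real_mult hermitian_end_mean)
  show "?at (?at x - ?J x) - ?J (?at x - ?J x) = ?at x - ?J x" for x by (simp add: s)
  show "?at (of_real (\<alpha> / real (deg G v)) *s ?J x) - ?J (of_real (\<alpha> / real (deg G v)) *s ?J x) = 0" for x by (simp add: s)
  show "?at (?at x - ?J x) = ?at x - ?J x" for x by (simp add: s)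
  show "?at (of_real (\<alpha> / real (deg G v)) *s ?J x) = of_real (\<alpha> / real (deg G v)) *s ?J x" for x by (simp add: s)
  fix F F'
  show "delta_cond G v \<alpha> F F' \<longleftrightarrow> ?at F - ?J F = 0 \<and> ?at F' - (?at F' - ?J F') = of_real (\<alpha> / real (deg G v)) *s ?J F"
  proof (cases "ends_at G v = {}")
    case True
    have "?at x = 0" "?J x = 0" for x using True by (auto simp: at_vertex_def end_mean_def ends_at_def vec_eq_iff)
    moreover have "delta_cond G v \<alpha> F F'" unfolding delta_cond_def using True by (intro exI[of _ 0]) auto
    ultimately show ?thesis by simp
  next
    case False
    then obtain p0 where p0: "att G p0 = v" by (auto simp: ends_at_def)
    have d: "deg G v \<noteq> 0" using False by (simp add: deg_def)
    have dirichlet: "?at F - ?J F = 0 \<longleftrightarrow> (\<forall>p\<in>ends_at G v. F $ p = end_sum G v F / of_nat (deg G v))"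
      by (auto simp: vec_eq_iff at_vertex_def end_mean_def ends_at_def)
    have robin: "?at F' - (?at F' - ?J F') = of_real (\<alpha> / real (deg G v)) *s ?J F \<longleftrightarrow>
        end_sum G v F' = of_real \<alpha> * (end_sum G v F / of_nat (deg G v))"
      using d p0 by (auto simp: vec_eq_iff end_mean_def field_simps simp del: split_paired_All split_paired_Ex)
    have const_value: "(\<exists>c. (\<forall>p\<in>ends_at G v. F $ p = c) \<and> end_sum G v F' = of_real \<alpha> * c) \<longleftrightarrow>
        (\<forall>p\<in>ends_at G v. F $ p = end_sum G v F / of_nat (deg G v)) \<and>
        end_sum G v F' = of_real \<alpha> * (end_sum G v F / of_nat (deg G v))"
    proof
      assume "\<exists>c. (\<forall>p\<in>ends_at G v. F $ p = c) \<and> end_sum G v F' = of_real \<alpha> * c"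
      then obtain c where c: "\<forall>p\<in>ends_at G v. F $ p = c" "end_sum G v F' = of_real \<alpha> * c" by blast
      have "end_sum G v F / of_nat (deg G v) = c"
        unfolding end_sum_def using c(1) d by (simp add: deg_def)
      then show "(\<forall>p\<in>ends_at G v. F $ p = end_sum G v F / of_nat (deg G v)) \<and>
          end_sum G v F' = of_real \<alpha> * (end_sum G v F / of_nat (deg G v))"
        using c by (simp only:)
    qed blast
    show ?thesis unfolding delta_cond_def end_sum_def[of G v F', symmetric] dirichlet robin const_value ..
  qed
qed

text \<open>
  A \<open>\<delta>'\<close> condition says that \<open>F'\<close> is the constant vector with entries \<open>(\<Sum> F) / \<beta>\<close>, which is \<open>d/\<beta>\<close> times the mean
  of \<open>F\<close>. There is no Dirichlet part.
\<close>

lemma delta_prime_form_cond: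
  assumes "\<beta> \<noteq> 0"
  shows "form_cond G v (\<lambda>x. 0) (\<lambda>x. of_real (real (deg G v) / \<beta>) *s end_mean G v x) (delta_prime_cond G v \<beta>)"
  unfolding form_cond_def
proof (intro conjI allI)
  let ?at = "at_vertex G v" and ?J = "end_mean G v"
  show "hermitian_op (\<lambda>x. of_real (real (deg G v) / \<beta>) *s ?J x)" by (intro hermitian_op_real_mult hermitian_end_mean)
  show "?at (of_real (real (deg G v) / \<beta>) *s ?J x) = of_real (real (deg G v) / \<beta>) *s ?J x" for x
    by (simp add: hermitian_op_mult[OF hermitian_at_vertex] at_vertex_end_mean)
  fix F F' :: "(complex, 'b \<times> bool) vec"
  have "?at F' - 0 = of_real (real (deg G v) / \<beta>) *s ?J F \<longleftrightarrow> (\<forall>p\<in>ends_at G v. F' $ p = end_sum G v F / of_real \<beta>)"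
  proof -
    have "deg G v \<noteq> 0" if "att G p = v" for p
    proof -
      have "p \<in> ends_at G v" using that by (simp add: ends_at_def)
      then show ?thesis by (auto simp: deg_def)
    qed
    then show ?thesis using assms
      by (auto simp: vec_eq_iff at_vertex_def end_mean_def ends_at_def simp del: split_paired_All split_paired_Ex)
  qed
  moreover have "delta_prime_cond G v \<beta> F F' \<longleftrightarrow> (\<forall>p\<in>ends_at G v. F' $ p = end_sum G v F / of_real \<beta>)"
  proof -
    have "end_sum G v F = of_real \<beta> * c \<longleftrightarrow> c = end_sum G v F / of_real \<beta>" for c
      using assms by (auto simp: field_simps)
    then show ?thesis unfolding delta_prime_cond_def end_sum_def[of G v F, symmetric] by auto
  qed
  ultimately show "delta_prime_cond G v \<beta> F F' \<longleftrightarrow>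
      0 = (0 :: (complex, 'b \<times> bool) vec) \<and> ?at F' - 0 = of_real (real (deg G v) / \<beta>) *s ?J F" by blast
qed (auto simp: hermitian_op_def cdot_def at_vertex_def vec_eq_iff)

lemma inner_real_mult_end_mean:
  "F \<bullet> (of_real r *s end_mean G v F) = r * ((cmod (end_sum G v F))\<^sup>2 / real (deg G v))"
proof -
  have "F \<bullet> (of_real r *s end_mean G v F) = Re (cdot (of_real r *s end_mean G v F) F)"
    unfolding Re_cdot by (rule inner_commute)
  also have "\<dots> = Re (of_real r * (cnj (end_sum G v F) * end_sum G v F / of_nat (deg G v)))"
    by (simp add: cdot_mult_left cdot_end_mean)
  also have "cnj (end_sum G v F) * end_sum G v F = of_real ((cmod (end_sum G v F))\<^sup>2)"
    by (simp only: mult.commute[of "cnj _"] complex_norm_square)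
  also have "Re (of_real r * (of_real ((cmod (end_sum G v F))\<^sup>2) / of_nat (deg G v))) = r * ((cmod (end_sum G v F))\<^sup>2 / real (deg G v))"
    by (simp add: Re_divide_of_nat)
  finally show ?thesis .
qed

theorem theorem5p4:
  fixes G :: "('v::finite, 'e::finite) metric_graph"
    and q :: "'e \<Rightarrow> real \<Rightarrow> real"
    and v0 :: 'v
    and B :: "'v \<Rightarrow> 'e vertex_cond"
    and \<alpha> \<beta> :: real
  assumes "compact_metric_graph G"
    and "real_Linf_potential G q"
    and "\<And>v. v \<noteq> v0 \<Longrightarrow> local_selfadjoint_cond G v (B v)"
    and "\<beta> \<noteq> 0"
    and "(real (deg G v0))\<^sup>2 / \<beta> \<le> \<alpha>"
  shows "\<forall>k\<ge>1. eigenvalue (schroedinger G q (B(v0 := delta_prime_cond G v0 \<beta>))) k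
               \<le> eigenvalue (schroedinger G q (B(v0 := delta_cond G v0 \<alpha>))) k"
proof (intro allI impI)
  fix k :: nat assume k: "1 \<le> k"
  have "\<forall>v. \<exists>PA. v \<noteq> v0 \<longrightarrow> form_cond G v (fst PA) (snd PA) (B v)"
    using local_selfadjoint_form_cond[OF assms(3)] by fastforce
  from choice[OF this] obtain PA where PA: "\<And>v. v \<noteq> v0 \<Longrightarrow> form_cond G v (fst (PA v)) (snd (PA v)) (B v)" by blast
  define P1 where "P1 = (\<lambda>v. fst (PA v))(v0 := \<lambda>x. at_vertex G v0 x - end_mean G v0 x)"
  define A1 where "A1 = (\<lambda>v. snd (PA v))(v0 := \<lambda>x. of_real (\<alpha> / real (deg G v0)) *s end_mean G v0 x)"
  define P2 where "P2 = (\<lambda>v. fst (PA v))(v0 := \<lambda>x. 0)"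
  define A2 where "A2 = (\<lambda>v. snd (PA v))(v0 := \<lambda>x. of_real (real (deg G v0) / \<beta>) *s end_mean G v0 x)"
  have fc1: "form_cond G v (P1 v) (A1 v) ((B(v0 := delta_cond G v0 \<alpha>)) v)" for v
    using PA delta_form_cond[of G v0 \<alpha>] by (simp add: P1_def A1_def)
  have fc2: "form_cond G v (P2 v) (A2 v) ((B(v0 := delta_prime_cond G v0 \<beta>)) v)" for v
    using PA delta_prime_form_cond[OF assms(4), of G v0] by (simp add: P2_def A2_def)
  have at1: "at_vertex G v (P1 v x) = P1 v x" for v x using fc1[of v] unfolding form_cond_def by blast
  show "eigenvalue (schroedinger G q (B(v0 := delta_prime_cond G v0 \<beta>))) k
      \<le> eigenvalue (schroedinger G q (B(v0 := delta_cond G v0 \<alpha>))) k"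
  proof (rule eigenvalue_comparison[OF graph_operator_of_vertex_conditions[OF assms(1,2) fc1]
        graph_operator_of_vertex_conditions[OF assms(1,2) fc2] _ _ k])
    fix F
    assume 0: "(\<Sum>v\<in>UNIV. P1 v F) = 0"
    have P10: "P1 v F = 0" for v
      using at_vertex_sum[of G "\<lambda>v. P1 v F" v, OF at1] 0 by simp
    show "(\<Sum>v\<in>UNIV. P2 v F) = 0"
    proof (rule sum.neutral, rule ballI)
      fix v show "P2 v F = 0" using P10[of v] by (cases "v = v0") (simp_all add: P1_def P2_def)
    qed
    have "F \<bullet> A2 v F \<le> F \<bullet> A1 v F" for v
    proof (cases "v = v0")
      case True
      \<comment> \<open>the hypothesis on the strengths, divided by the degree; at an isolated vertex both sides are 0\<close>
      have "real (deg G v0) / \<beta> * ((cmod (end_sum G v0 F))\<^sup>2 / real (deg G v0))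
          \<le> \<alpha> / real (deg G v0) * ((cmod (end_sum G v0 F))\<^sup>2 / real (deg G v0))"
      proof (cases "deg G v0 = 0")
        case False
        then have "real (deg G v0) / \<beta> \<le> \<alpha> / real (deg G v0)"
          using assms(5) by (simp add: pos_le_divide_eq power2_eq_square)
        then show ?thesis by (intro mult_right_mono) auto
      qed simp
      then show ?thesis by (simp only: True A1_def A2_def fun_upd_same inner_real_mult_end_mean)
    qed (simp add: A1_def A2_def)
    then show "F \<bullet> (\<Sum>v\<in>UNIV. A2 v F) \<le> F \<bullet> (\<Sum>v\<in>UNIV. A1 v F)"
      unfolding inner_sum_right by (intro sum_mono)
  qed
qed

end
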